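(* Let $H$ be a Hopf algebra over a field $\Bbbk$. Then the assignments $$\Psi\colon I\longmapsto {}^{\mathrm{co}\,H/I}H,\qquad \Phi\colon B\longmapsto HB^+$$ are well-defined, mutually inverse, inclusion-preserving bijections between the following two sets: (L) the set of left ideal coideals $I$ in $H$ for which $H\,\square^{H/I}\,H\rightrightarrows H\to H/I$ (the parallel maps being the restrictions of $\varepsilon\otimes H$ and $H\otimes\varepsilon$, the last map being the canonical projection) is a coequalizer of vector spaces; (R) the set of right coideal subalgebras $B$ of $H$ such that $B\to H\rightrightarrows H\otimes_B H$ (the first map being the inclusion, the parallel maps being $x\mapsto x\otimes_B 1$ and $x\mapsto 1\otimes_B x$) is an equalizer of vector spaces.
   Context: $\otimes=\otimes_\Bbbk$; $\Delta(x)=\sum x_1\otimes x_2$ and $\varepsilon$ denote the comultiplication and counit of $H$. A left ideal coideal of $H$ is a left ideal $I\subseteq H$ with $\Delta(I)\subseteq I\otimes H+H\otimes I$ and $\varepsilon(I)=0$. Then $H/I$ is a coalgebra, with coalgebra projection $\pi_I\colon H\to H/I$, and $H$ is a right and left $H/I$-comodule via $(H\otimes\pi_I)\Delta$ and $(\pi_I\otimes H)\Delta$. The coinvariants are ${}^{\mathrm{co}\,H/I}H=\{x\in H\mid\sum\pi_I(x_1)\otimes x_2=\pi_I(1)\otimes x\}$. The cotensor product $H\,\square^{H/I}\,H\subseteq H\otimes H$ is the equalizer of $(H\otimes\pi_I)\Delta\otimes H$ and $H\otimes(\pi_I\otimes H)\Delta$, from $H\otimes H$ to $H\otimes (H/I)\otimes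 H$. A right coideal subalgebra of $H$ is a subalgebra $B\subseteq H$ with $\Delta(B)\subseteq B\otimes H$. Put $B^+=B\cap\ker\varepsilon$; $HB^+$ is the left ideal of $H$ generated by $B^+$. *)

theory Defs
  imports "HOL-Algebra.QuotRing" "HOL-Algebra.Module" "HOL-Algebra.Subrings"
begin

section \<open>Linear algebra over a field\<close>

text \<open>Vector spaces over a field \<open>K\<close> are the modules of HOL-Algebra over \<open>K\<close>. The record type
  \<^typ>\<open>('k, 'a) module\<close> also has the fields \<^const>\<open>mult\<close> and \<^const>\<open>one\<close>; they carry the algebra
  structure where there is one and are ignored otherwise.\<close>

definition lin :: "'k ring \<Rightarrow> ('k, 'a) module \<Rightarrow> ('k, 'b) module \<Rightarrow> ('a \<Rightarrow> 'b) set" where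
  "lin K V W = {f \<in> carrier V \<rightarrow> carrier W.
     (\<forall>x \<in> carrier V. \<forall>y \<in> carrier V. f (x \<oplus>\<^bsub>V\<^esub> y) = f x \<oplus>\<^bsub>W\<^esub> f y) \<and>
     (\<forall>a \<in> carrier K. \<forall>x \<in> carrier V. f (a \<odot>\<^bsub>V\<^esub> x) = a \<odot>\<^bsub>W\<^esub> f x)}"

definition subspace_gen :: "'k ring \<Rightarrow> ('k, 'a) module \<Rightarrow> 'a set \<Rightarrow> 'a set" where
  "subspace_gen K V S = \<Inter> {N. submodule N K V \<and> S \<subseteq> N}"

definition ground_space :: "'k ring \<Rightarrow> ('k, 'k) module" where
  "ground_space K = \<lparr>carrier = carrier K, mult = mult K, one = one K,
     zero = zero K, add = add K, smult = mult K\<rparr>"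

text \<open>The first five fields are those of \<^term>\<open>V Quot N\<close>. The field \<^const>\<open>mult\<close> is meaningful only
  when \<open>N\<close> is a two-sided ideal. In \<^const>\<open>smult\<close> the summand \<open>N\<close> is needed because
  \<open>{a \<odot> x | x \<in> X}\<close> is not a full coset when \<open>a\<close> is zero.\<close>

definition quot_space :: "'k ring \<Rightarrow> ('k, 'a) module \<Rightarrow> 'a set \<Rightarrow> ('k, 'a set) module" where
  "quot_space K V N = \<lparr>carrier = a_rcosets\<^bsub>V\<^esub> N, mult = rcoset_mult V N,
     one = N +>\<^bsub>V\<^esub> \<one>\<^bsub>V\<^esub>, zero = N, add = set_add V,
     smult = (\<lambda>a X. \<Union>x\<in>X. N +>\<^bsub>V\<^esub> (a \<odot>\<^bsub>V\<^esub> x))\<rparr>"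


subsection \<open>Equalizers and coequalizers of vector spaces\<close>

text \<open>HOL cannot quantify over the type of the test space \<open>T\<close> inside a definition, so one type is
  fixed. This loses nothing: lemmas \<open>is_equalizer_universal\<close> and
  \<open>is_coequalizer_universal\<close> below give the universal property for test spaces of every type.\<close>

definition is_equalizer ::
    "'k ring \<Rightarrow> ('k, 'a) module \<Rightarrow> ('k, 'a) module \<Rightarrow> ('k, 'b) module \<Rightarrow>
     ('a \<Rightarrow> 'a) \<Rightarrow> ('a \<Rightarrow> 'b) \<Rightarrow> ('a \<Rightarrow> 'b) \<Rightarrow> bool" where
  "is_equalizer K E X Y e f g \<longleftrightarrow>
     e \<in> lin K E X \<and> (\<forall>z \<in> carrier E. f (e z) = g (e z)) \<and>
     (\<forall>(T :: ('k, 'a) module) t.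
        module K T \<longrightarrow> t \<in> lin K T X \<longrightarrow> (\<forall>z \<in> carrier T. f (t z) = g (t z)) \<longrightarrow>
        (\<exists>!u. u \<in> lin K T E \<inter> extensional (carrier T) \<and> (\<forall>z \<in> carrier T. e (u z) = t z)))"

definition is_coequalizer ::
    "'k ring \<Rightarrow> ('k, 'x) module \<Rightarrow> ('k, 'a) module \<Rightarrow> ('k, 'a set) module \<Rightarrow>
     ('x \<Rightarrow> 'a) \<Rightarrow> ('x \<Rightarrow> 'a) \<Rightarrow> ('a \<Rightarrow> 'a set) \<Rightarrow> bool" where
  "is_coequalizer K X Y Z f g c \<longleftrightarrow>
     c \<in> lin K Y Z \<and> (\<forall>x \<in> carrier X. c (f x) = c (g x)) \<and>
     (\<forall>(T :: ('k, 'a set) module) t.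
        module K T \<longrightarrow> t \<in> lin K Y T \<longrightarrow> (\<forall>x \<in> carrier X. t (f x) = t (g x)) \<longrightarrow>
        (\<exists>!u. u \<in> lin K Z T \<inter> extensional (carrier Z) \<and> (\<forall>y \<in> carrier Y. u (c y) = t y)))"


lemma linD:
  assumes "f \<in> lin K V W"
  shows "x \<in> carrier V \<Longrightarrow> f x \<in> carrier W"
    and "x \<in> carrier V \<Longrightarrow> y \<in> carrier V \<Longrightarrow> f (x \<oplus>\<^bsub>V\<^esub> y) = f x \<oplus>\<^bsub>W\<^esub> f y"
    and "a \<in> carrier K \<Longrightarrow> x \<in> carrier V \<Longrightarrow> f (a \<odot>\<^bsub>V\<^esub> x) = a \<odot>\<^bsub>W\<^esub> f x"
  using assms by (auto simp: lin_def)

lemma linI: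
  assumes "\<And>x. x \<in> carrier V \<Longrightarrow> f x \<in> carrier W"
    and "\<And>x y. x \<in> carrier V \<Longrightarrow> y \<in> carrier V \<Longrightarrow> f (x \<oplus>\<^bsub>V\<^esub> y) = f x \<oplus>\<^bsub>W\<^esub> f y"
    and "\<And>a x. a \<in> carrier K \<Longrightarrow> x \<in> carrier V \<Longrightarrow> f (a \<odot>\<^bsub>V\<^esub> x) = a \<odot>\<^bsub>W\<^esub> f x"
  shows "f \<in> lin K V W"
  using assms by (auto simp: lin_def)

lemma lin_comp:
  assumes "f \<in> lin K U V" "g \<in> lin K V W"
  shows "(\<lambda>x. g (f x)) \<in> lin K U W"
  by (rule linI) (simp_all add: linD[OF assms(1)] linD[OF assms(2)])

lemma lin_cong:
  assumes "f \<in> lin K V W" "module K V" "\<And>x. x \<in> carrier V \<Longrightarrow> f' x = f x"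
  shows "f' \<in> lin K V W"
proof -
  interpret V: module K V by fact
  show ?thesis by (rule linI) (simp_all add: linD[OF assms(1)] assms(3))
qed

lemma lin_zero_neg:
  assumes "module K V" "module K W" "f \<in> lin K V W"
  shows "f \<zero>\<^bsub>V\<^esub> = \<zero>\<^bsub>W\<^esub>" and "x \<in> carrier V \<Longrightarrow> f (\<ominus>\<^bsub>V\<^esub> x) = \<ominus>\<^bsub>W\<^esub> f x"
proof -
  interpret V: module K V by fact
  interpret W: module K W by fact
  have "f (\<zero>\<^bsub>K\<^esub> \<odot>\<^bsub>V\<^esub> \<zero>\<^bsub>V\<^esub>) = \<zero>\<^bsub>K\<^esub> \<odot>\<^bsub>W\<^esub> f \<zero>\<^bsub>V\<^esub>"
    by (rule linD(3)[OF assms(3)]) auto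
  then show 0: "f \<zero>\<^bsub>V\<^esub> = \<zero>\<^bsub>W\<^esub>" by (simp add: linD(1)[OF assms(3)])
  assume x: "x \<in> carrier V"
  have "f (\<ominus>\<^bsub>V\<^esub> x) \<oplus>\<^bsub>W\<^esub> f x = \<zero>\<^bsub>W\<^esub>"
    using x 0 by (simp add: V.M.l_neg flip: linD(2)[OF assms(3)])
  then show "f (\<ominus>\<^bsub>V\<^esub> x) = \<ominus>\<^bsub>W\<^esub> f x"
    using x by (simp add: W.M.minus_equality linD(1)[OF assms(3)])
qed

lemma submodule_abelian_subgroup:
  assumes "module K V" "submodule N K V"
  shows "abelian_subgroup N V"
proof -
  interpret V: module K V by fact
  interpret N: submodule N K V by fact
  show ?thesis
    by (rule abelian_subgroupI3)
      (auto intro: additive_subgroup.intro N.subgroup_axioms V.M.abelian_group_axioms)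
qed

lemma quot_space_simps [simp]:
  "zero (quot_space K V N) = N"
  "add (quot_space K V N) = set_add V"
  "carrier (quot_space K V N) = a_rcosets\<^bsub>V\<^esub> N"
  by (simp_all add: quot_space_def)

lemma quot_space_smult:
  assumes "module K V" "submodule N K V" "a \<in> carrier K" "x \<in> carrier V"
  shows "a \<odot>\<^bsub>quot_space K V N\<^esub> (N +>\<^bsub>V\<^esub> x) = N +>\<^bsub>V\<^esub> (a \<odot>\<^bsub>V\<^esub> x)"
proof -
  interpret V: module K V by fact
  interpret N: submodule N K V by fact
  interpret N: abelian_subgroup N V by (rule submodule_abelian_subgroup) fact+
  have "N +>\<^bsub>V\<^esub> (a \<odot>\<^bsub>V\<^esub> y) = N +>\<^bsub>V\<^esub> (a \<odot>\<^bsub>V\<^esub> x)" if y: "y \<in> N +>\<^bsub>V\<^esub> x" for y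
  proof -
    obtain n where n: "n \<in> N" "y = n \<oplus>\<^bsub>V\<^esub> x" using y by (auto simp: a_r_coset_def')
    then have "a \<odot>\<^bsub>V\<^esub> y = a \<odot>\<^bsub>V\<^esub> n \<oplus>\<^bsub>V\<^esub> a \<odot>\<^bsub>V\<^esub> x"
      using assms by (simp add: V.smult_r_distr N.a_Hcarr)
    moreover have "a \<odot>\<^bsub>V\<^esub> n \<in> N" using n assms by simp
    ultimately have "a \<odot>\<^bsub>V\<^esub> y \<in> N +>\<^bsub>V\<^esub> (a \<odot>\<^bsub>V\<^esub> x)" by (auto simp: a_r_coset_def')
    then show ?thesis using assms by (intro N.a_repr_independence'[symmetric]) auto
  qed
  then have "(\<Union>y\<in>N +>\<^bsub>V\<^esub> x. N +>\<^bsub>V\<^esub> (a \<odot>\<^bsub>V\<^esub> y)) = (\<Union>y\<in>N +>\<^bsub>V\<^esub> x. N +>\<^bsub>V\<^esub> (a \<odot>\<^bsub>V\<^esub> x))"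
    by (rule SUP_cong[OF refl])
  also have "\<dots> = N +>\<^bsub>V\<^esub> (a \<odot>\<^bsub>V\<^esub> x)"
    using N.a_rcos_self[OF assms(4)] by blast
  finally show ?thesis by (simp add: quot_space_def)
qed

lemma quot_space_module:
  assumes "module K V" "submodule N K V"
  shows "module K (quot_space K V N)"
proof -
  interpret V: module K V by fact
  interpret N: submodule N K V by fact
  interpret N: abelian_subgroup N V by (rule submodule_abelian_subgroup) fact+
  note [simp] = quot_space_smult[OF assms] N.a_rcos_sum
  have c: "\<exists>v \<in> carrier V. X = N +>\<^bsub>V\<^esub> v" if "X \<in> a_rcosets\<^bsub>V\<^esub> N" for X
    using that by (auto simp: A_RCOSETS_def')
  have c': "N +>\<^bsub>V\<^esub> v \<in> a_rcosets\<^bsub>V\<^esub> N" if "v \<in> carrier V" for v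
    using that by (auto simp: A_RCOSETS_def')
  show ?thesis
  proof (rule moduleI)
    show "cring K" by (rule V.R.cring_axioms)
    show "abelian_group (quot_space K V N)"
    proof (rule abelian_groupI)
      have N0: "N = N +>\<^bsub>V\<^esub> \<zero>\<^bsub>V\<^esub>" by (simp add: N.a_subset)
      show "\<zero>\<^bsub>quot_space K V N\<^esub> \<in> carrier (quot_space K V N)" using N0 c'[of "\<zero>\<^bsub>V\<^esub>"] by simp
      fix X assume "X \<in> carrier (quot_space K V N)"
      then obtain x where x: "x \<in> carrier V" "X = N +>\<^bsub>V\<^esub> x" using c by auto
      show "\<zero>\<^bsub>quot_space K V N\<^esub> \<oplus>\<^bsub>quot_space K V N\<^esub> X = X"
        using x N0 N.a_rcos_sum[of "\<zero>\<^bsub>V\<^esub>" x] by simp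
      have "N +>\<^bsub>V\<^esub> (\<ominus>\<^bsub>V\<^esub> x) <+>\<^bsub>V\<^esub> X = N"
        using x N0 by (simp add: V.M.l_neg)
      then show "\<exists>Y\<in>carrier (quot_space K V N). Y \<oplus>\<^bsub>quot_space K V N\<^esub> X = \<zero>\<^bsub>quot_space K V N\<^esub>"
        by (intro bexI[of _ "N +>\<^bsub>V\<^esub> (\<ominus>\<^bsub>V\<^esub> x)"]) (use x c'[of "\<ominus>\<^bsub>V\<^esub> x"] in auto)
      fix Y assume "Y \<in> carrier (quot_space K V N)"
      then obtain y where y: "y \<in> carrier V" "Y = N +>\<^bsub>V\<^esub> y" using c by auto
      show "X \<oplus>\<^bsub>quot_space K V N\<^esub> Y = Y \<oplus>\<^bsub>quot_space K V N\<^esub> X"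
        using x y V.M.a_comm[of x y] by simp
    qed (auto dest!: c simp: c' V.M.a_assoc)
  qed (auto dest!: c simp: c' V.smult_l_distr V.smult_r_distr V.smult_assoc1)
qed

lemma quot_space_proj:
  assumes "module K V" "submodule N K V"
  shows "(\<lambda>v. N +>\<^bsub>V\<^esub> v) \<in> lin K V (quot_space K V N)"
proof -
  interpret N: abelian_subgroup N V by (rule submodule_abelian_subgroup) fact+
  show ?thesis
    by (rule linI) (auto simp: quot_space_smult[OF assms] N.a_rcos_sum A_RCOSETS_def')
qed

lemma kernel_submodule:
  assumes "module K V" "module K W" "f \<in> lin K V W"
  shows "submodule {x \<in> carrier V. f x = \<zero>\<^bsub>W\<^esub>} K V"
proof -
  interpret V: module K V by fact
  interpret W: module K W by fact
  show ?thesis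
    by (rule V.submoduleI) (auto simp: linD[OF assms(3)] lin_zero_neg[OF assms])
qed

lemma kernel_coset_eq_iff:
  assumes "module K V" "module K W" "f \<in> lin K V W" "x \<in> carrier V" "y \<in> carrier V"
  shows "{x \<in> carrier V. f x = \<zero>\<^bsub>W\<^esub>} +>\<^bsub>V\<^esub> x = {x \<in> carrier V. f x = \<zero>\<^bsub>W\<^esub>} +>\<^bsub>V\<^esub> y \<longleftrightarrow> f x = f y"
    (is "?N +>\<^bsub>V\<^esub> x = ?N +>\<^bsub>V\<^esub> y \<longleftrightarrow> _")
proof -
  interpret V: module K V by fact
  interpret W: module K W by fact
  interpret N: abelian_subgroup ?N V
    by (rule submodule_abelian_subgroup[OF assms(1) kernel_submodule[OF assms(1-3)]])
  have fc: "f x \<in> carrier W" "f y \<in> carrier W" using linD(1)[OF assms(3,4)] linD(1)[OF assms(3,5)] .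
  have "f (x \<ominus>\<^bsub>V\<^esub> y) = f x \<oplus>\<^bsub>W\<^esub> \<ominus>\<^bsub>W\<^esub> f y"
    unfolding a_minus_def
    using linD(2)[OF assms(3,4) V.M.a_inv_closed[OF assms(5)]] lin_zero_neg(2)[OF assms(1-3,5)]
    by (simp only:)
  moreover have "f x \<oplus>\<^bsub>W\<^esub> \<ominus>\<^bsub>W\<^esub> f y = \<zero>\<^bsub>W\<^esub> \<longleftrightarrow> f x = f y"
  proof
    assume "f x \<oplus>\<^bsub>W\<^esub> \<ominus>\<^bsub>W\<^esub> f y = \<zero>\<^bsub>W\<^esub>"
    then have "\<ominus>\<^bsub>W\<^esub> (\<ominus>\<^bsub>W\<^esub> f y) = f x" by (rule W.M.minus_equality) (use fc in auto)
    then show "f x = f y" using fc by simp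
  qed (use fc in \<open>simp add: W.M.r_neg\<close>)
  ultimately have m: "x \<ominus>\<^bsub>V\<^esub> y \<in> ?N \<longleftrightarrow> f x = f y"
    using V.M.minus_closed[OF assms(4,5)] by (simp only: mem_Collect_eq simp_thms)
  have "?N +>\<^bsub>V\<^esub> x = ?N +>\<^bsub>V\<^esub> y \<longleftrightarrow> x \<in> ?N +>\<^bsub>V\<^esub> y"
  proof
    show "x \<in> ?N +>\<^bsub>V\<^esub> y" if "?N +>\<^bsub>V\<^esub> x = ?N +>\<^bsub>V\<^esub> y"
      using N.a_rcos_self[OF assms(4)] that by blast
    show "?N +>\<^bsub>V\<^esub> x = ?N +>\<^bsub>V\<^esub> y" if "x \<in> ?N +>\<^bsub>V\<^esub> y"
      using N.a_repr_independence'[OF that assms(5)] by (rule sym)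
  qed
  also have "\<dots> \<longleftrightarrow> x \<ominus>\<^bsub>V\<^esub> y \<in> ?N"
    using N.a_rcos_module[OF assms(5,4)] by (simp only: a_minus_def)
  finally show ?thesis using m by (simp only:)
qed

lemma lin_factor:
  assumes "module K V" "p \<in> lin K V P" "p ` carrier V = carrier P" "t \<in> lin K V T"
    and eq: "\<And>x y. x \<in> carrier V \<Longrightarrow> y \<in> carrier V \<Longrightarrow> p x = p y \<Longrightarrow> t x = t y"
  obtains u where "u \<in> lin K P T \<inter> extensional (carrier P)" "\<And>x. x \<in> carrier V \<Longrightarrow> u (p x) = t x"
proof -
  interpret V: module K V by fact
  define u where "u = restrict (\<lambda>z. t (SOME x. x \<in> carrier V \<and> p x = z)) (carrier P)"
  have u: "u (p x) = t x" if x: "x \<in> carrier V" for x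
  proof -
    have "(SOME x'. x' \<in> carrier V \<and> p x' = p x) \<in> carrier V \<and> p (SOME x'. x' \<in> carrier V \<and> p x' = p x) = p x"
      by (rule someI) (use x in auto)
    then have "t (SOME x'. x' \<in> carrier V \<and> p x' = p x) = t x" using eq x by blast
    then show ?thesis using linD(1)[OF assms(2) x] by (simp add: u_def)
  qed
  have "u \<in> lin K P T"
    unfolding lin_def assms(3)[symmetric] using linD[OF assms(4)]
    by (auto simp: u simp flip: linD(2,3)[OF assms(2)])
  moreover have "u \<in> extensional (carrier P)" by (simp add: u_def)
  ultimately show thesis using that u by blast
qed

lemma is_equalizer_universal:
  fixes T :: "('k, 't) module"
  assumes "module K E" "module K X" "module K Y" "f \<in> lin K X Y" "g \<in> lin K X Y"
    and eqz: "is_equalizer K E X Y e f g"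
    and "module K T" "t \<in> lin K T X" "\<And>z. z \<in> carrier T \<Longrightarrow> f (t z) = g (t z)"
  shows "\<exists>!u. u \<in> lin K T E \<inter> extensional (carrier T) \<and> (\<forall>z \<in> carrier T. e (u z) = t z)"
proof -
  interpret X: module K X by fact
  interpret Y: module K Y by fact
  interpret T: module K T by fact
  interpret E: module K E by fact
  note f = linD[OF assms(4)] lin_zero_neg[OF assms(2,3,4)]
    and g = linD[OF assms(5)] lin_zero_neg[OF assms(2,3,5)]
  have e: "e \<in> lin K E X" "\<And>z. z \<in> carrier E \<Longrightarrow> f (e z) = g (e z)"
    and un: "\<And>(T :: ('k, 'a) module) t. \<lbrakk>module K T; t \<in> lin K T X; \<forall>z \<in> carrier T. f (t z) = g (t z)\<rbrakk> \<Longrightarrow>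
        \<exists>!u. u \<in> lin K T E \<inter> extensional (carrier T) \<and> (\<forall>z \<in> carrier T. e (u z) = t z)"
    using eqz unfolding is_equalizer_def by blast+
  define C where "C = {x \<in> carrier X. f x = g x}"
  have sub: "submodule C K X"
    by (rule X.submoduleI) (auto simp: C_def f g)
  define XC where "XC = X\<lparr>carrier := C\<rparr>"
  have XC: "module K XC" unfolding XC_def by (rule submodule.submodule_is_module[OF sub assms(2)])
  have i: "(\<lambda>x. x) \<in> lin K XC X" by (rule linI) (auto simp: XC_def C_def)
  obtain v where v: "v \<in> lin K XC E" "\<And>z. z \<in> C \<Longrightarrow> e (v z) = z"
    using un[OF XC i] by (auto simp: XC_def C_def)
  have inj: "x = y" if "x \<in> carrier E" "y \<in> carrier E" "e x = e y" for x y
  proof -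
    have eXC: "e \<in> lin K E XC"
      by (rule linI) (use linD[OF e(1)] e(2) in \<open>auto simp: XC_def C_def\<close>)
    have 1: "restrict (\<lambda>x. v (e x)) (carrier E) \<in> lin K E E \<inter> extensional (carrier E)"
      using lin_cong[OF lin_comp[OF eXC v(1)] assms(1)] by simp
    have 2: "restrict (\<lambda>x. x) (carrier E) \<in> lin K E E \<inter> extensional (carrier E)"
      using lin_cong[of "\<lambda>x. x" K E E] assms(1) by (auto simp: lin_def)
    have "restrict (\<lambda>x. v (e x)) (carrier E) = restrict (\<lambda>x. x) (carrier E)"
      using un[OF assms(1) e(1)] 1 2 e(2) v(2) linD(1)[OF e(1)] by (auto simp: C_def)
    then have "v (e z) = z" if "z \<in> carrier E" for z using that by (metis restrict_apply')
    then show ?thesis using that by metis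
  qed
  have tXC: "t \<in> lin K T XC"
    by (rule linI) (use linD[OF assms(8)] assms(9) in \<open>auto simp: XC_def C_def\<close>)
  have tC: "t z \<in> C" if "z \<in> carrier T" for z using linD(1)[OF tXC that] by (simp add: XC_def)
  show ?thesis
  proof (rule ex1I[of _ "restrict (\<lambda>z. v (t z)) (carrier T)"])
    show "restrict (\<lambda>z. v (t z)) (carrier T) \<in> lin K T E \<inter> extensional (carrier T) \<and>
      (\<forall>z \<in> carrier T. e (restrict (\<lambda>z. v (t z)) (carrier T) z) = t z)"
      using lin_cong[OF lin_comp[OF tXC v(1)] assms(7)] tC v(2) by auto
    fix u assume u: "u \<in> lin K T E \<inter> extensional (carrier T) \<and> (\<forall>z \<in> carrier T. e (u z) = t z)"
    show "u = restrict (\<lambda>z. v (t z)) (carrier T)"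
    proof (rule extensionalityI[of _ "carrier T"])
      fix z assume z: "z \<in> carrier T"
      have "v (t z) \<in> carrier E" using linD(1)[OF lin_comp[OF tXC v(1)] z] .
      then have "u z = v (t z)" using u z inj tC v(2) linD(1)[of u K T E] by auto
      then show "u z = restrict (\<lambda>z. v (t z)) (carrier T) z" using z by simp
    qed (use u in auto)
  qed
qed

lemma is_coequalizer_universal:
  fixes Y :: "('k, 'b) module" and T :: "('k, 't) module"
  assumes "module K Y" "module K Z" "f \<in> lin K X Y" "g \<in> lin K X Y"
    and coeq: "is_coequalizer K X Y Z f g c"
    and "module K T" "t \<in> lin K Y T" "\<And>x. x \<in> carrier X \<Longrightarrow> t (f x) = t (g x)"
  shows "\<exists>!u. u \<in> lin K Z T \<inter> extensional (carrier Z) \<and> (\<forall>y \<in> carrier Y. u (c y) = t y)"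
proof -
  interpret Y: module K Y by fact
  interpret Z: module K Z by fact
  interpret T: module K T by fact
  have c: "c \<in> lin K Y Z" "\<And>x. x \<in> carrier X \<Longrightarrow> c (f x) = c (g x)"
    and un: "\<And>(T :: ('k, 'b set) module) t. \<lbrakk>module K T; t \<in> lin K Y T; \<forall>x \<in> carrier X. t (f x) = t (g x)\<rbrakk> \<Longrightarrow>
        \<exists>!u. u \<in> lin K Z T \<inter> extensional (carrier Z) \<and> (\<forall>y \<in> carrier Y. u (c y) = t y)"
    using coeq unfolding is_coequalizer_def by blast+
  have fac: "\<exists>u \<in> lin K Z (quot_space K Y {y \<in> carrier Y. s y = \<zero>\<^bsub>W\<^esub>}).
      \<forall>y \<in> carrier Y. u (c y) = {y \<in> carrier Y. s y = \<zero>\<^bsub>W\<^esub>} +>\<^bsub>Y\<^esub> y"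
    if W: "module K W" "s \<in> lin K Y W" "\<And>x. x \<in> carrier X \<Longrightarrow> s (f x) = s (g x)"
    for W :: "('k, 'w) module" and s
    using un[OF quot_space_module[OF assms(1) kernel_submodule[OF assms(1) W(1,2)]]
          quot_space_proj[OF assms(1) kernel_submodule[OF assms(1) W(1,2)]]]
      kernel_coset_eq_iff[OF assms(1) W(1,2)] linD(1)[OF assms(3)] linD(1)[OF assms(4)] W(3)
    by auto
  have fac': "\<exists>u \<in> lin K Z (quot_space K Y {y \<in> carrier Y. s y = \<zero>\<^bsub>W\<^esub>}).
      \<forall>y \<in> carrier Y. u (c y) = {y \<in> carrier Y. s y = \<zero>\<^bsub>W\<^esub>} +>\<^bsub>Y\<^esub> y"
    if W: "module K W" "s \<in> lin K Y W" "\<And>x. x \<in> carrier X \<Longrightarrow> s (f x) = s (g x)"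
    for W :: "('k, 't) module" and s
    using un[OF quot_space_module[OF assms(1) kernel_submodule[OF assms(1) W(1,2)]]
          quot_space_proj[OF assms(1) kernel_submodule[OF assms(1) W(1,2)]]]
      kernel_coset_eq_iff[OF assms(1) W(1,2)] linD(1)[OF assms(3)] linD(1)[OF assms(4)] W(3)
    by auto
  have surj: "c ` carrier Y = carrier Z"
  proof
    show "c ` carrier Y \<subseteq> carrier Z" using linD(1)[OF c(1)] by auto
    let ?N = "{y \<in> carrier Y. c y = \<zero>\<^bsub>Z\<^esub>}"
    note N = kernel_submodule[OF assms(1,2) c(1)]
    obtain u where u: "u \<in> lin K Z (quot_space K Y ?N)" "\<And>y. y \<in> carrier Y \<Longrightarrow> u (c y) = ?N +>\<^bsub>Y\<^esub> y"
      using fac[OF assms(2) c] by blast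
    have "(\<lambda>y. ?N +>\<^bsub>Y\<^esub> y) ` carrier Y = carrier (quot_space K Y ?N)"
      by (auto simp: A_RCOSETS_def')
    then obtain s where s': "s \<in> lin K (quot_space K Y ?N) Z \<inter> extensional (carrier (quot_space K Y ?N))"
        "\<And>y. y \<in> carrier Y \<Longrightarrow> s (?N +>\<^bsub>Y\<^esub> y) = c y"
      by (rule lin_factor[OF assms(1) quot_space_proj[OF assms(1) N] _ c(1)])
        (simp_all only: kernel_coset_eq_iff[OF assms(1,2) c(1)])
    note s = IntD1[OF s'(1)] s'(2)
    have 1: "restrict (\<lambda>z. s (u z)) (carrier Z) \<in> lin K Z Z \<inter> extensional (carrier Z)"
      using lin_cong[OF lin_comp[OF u(1) s(1)] assms(2)] by simp
    have 2: "restrict (\<lambda>z. z) (carrier Z) \<in> lin K Z Z \<inter> extensional (carrier Z)"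
      using lin_cong[of "\<lambda>x. x" K Z Z] assms(2) by (auto simp: lin_def)
    have "restrict (\<lambda>z. s (u z)) (carrier Z) = restrict (\<lambda>z. z) (carrier Z)"
      using un[OF assms(2) c(1)] 1 2 c(2) u(2) s(2) linD(1)[OF c(1)] by auto
    then have su: "s (u z) = z" if "z \<in> carrier Z" for z using that by (metis restrict_apply')
    show "carrier Z \<subseteq> c ` carrier Y"
    proof
      fix z assume z: "z \<in> carrier Z"
      then obtain y where "y \<in> carrier Y" "u z = ?N +>\<^bsub>Y\<^esub> y"
        using linD(1)[OF u(1) z] by (auto simp: A_RCOSETS_def')
      then show "z \<in> c ` carrier Y" using su[OF z] s(2) by auto
    qed
  qed
  obtain u where u: "u \<in> lin K Z (quot_space K Y {y \<in> carrier Y. t y = \<zero>\<^bsub>T\<^esub>})"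
      "\<And>y. y \<in> carrier Y \<Longrightarrow> u (c y) = {y \<in> carrier Y. t y = \<zero>\<^bsub>T\<^esub>} +>\<^bsub>Y\<^esub> y"
    using fac'[OF assms(6-8)] by blast
  have "t x = t y" if "x \<in> carrier Y" "y \<in> carrier Y" "c x = c y" for x y
    using that u(2)[of x] u(2)[of y] kernel_coset_eq_iff[OF assms(1,6,7)] by auto
  then obtain w where w: "w \<in> lin K Z T \<inter> extensional (carrier Z)" "\<And>y. y \<in> carrier Y \<Longrightarrow> w (c y) = t y"
    using lin_factor[OF assms(1) c(1) surj assms(7)] by blast
  show ?thesis
  proof (rule ex1I[of _ w])
    fix w' assume w': "w' \<in> lin K Z T \<inter> extensional (carrier Z) \<and> (\<forall>y \<in> carrier Y. w' (c y) = t y)"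
    show "w' = w"
    proof (rule extensionalityI[of _ "carrier Z"])
      fix z assume "z \<in> carrier Z"
      then obtain y where "y \<in> carrier Y" "z = c y" using surj by blast
      then show "w' z = w z" using w w' by simp
    qed (use w w' in auto)
  qed (use w in auto)
qed


subsection \<open>Tensor products\<close>

definition free_space :: "'k ring \<Rightarrow> 'a set \<Rightarrow> ('k, 'a \<Rightarrow> 'k) module" where
  "free_space K A = \<lparr>
     carrier = {p. (\<forall>z. p z \<in> carrier K) \<and> (\<forall>z. z \<notin> A \<longrightarrow> p z = \<zero>\<^bsub>K\<^esub>) \<and> finite {z. p z \<noteq> \<zero>\<^bsub>K\<^esub>}},
     mult = undefined, one = undefined, zero = (\<lambda>z. \<zero>\<^bsub>K\<^esub>),
     add = (\<lambda>p q z. p z \<oplus>\<^bsub>K\<^esub> q z), smult = (\<lambda>a p z. a \<otimes>\<^bsub>K\<^esub> p z)\<rparr>"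

definition free_gen :: "'k ring \<Rightarrow> 'a \<Rightarrow> 'a \<Rightarrow> 'k" where
  "free_gen K z = (\<lambda>z'. if z' = z then \<one>\<^bsub>K\<^esub> else \<zero>\<^bsub>K\<^esub>)"

definition tensor_rel ::
    "'k ring \<Rightarrow> ('k, 'a) module \<Rightarrow> ('k, 'b) module \<Rightarrow> ('a \<times> 'b \<Rightarrow> 'k) set" where
  "tensor_rel K V W =
     (let F = free_space K (carrier V \<times> carrier W); d = free_gen K in
      {d (v \<oplus>\<^bsub>V\<^esub> v', w) \<ominus>\<^bsub>F\<^esub> (d (v, w) \<oplus>\<^bsub>F\<^esub> d (v', w)) | v v' w.
         v \<in> carrier V \<and> v' \<in> carrier V \<and> w \<in> carrier W} \<union>
      {d (v, w \<oplus>\<^bsub>W\<^esub> w') \<ominus>\<^bsub>F\<^esub> (d (v, w) \<oplus>\<^bsub>F\<^esub> d (v, w')) | v w w'.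
         v \<in> carrier V \<and> w \<in> carrier W \<and> w' \<in> carrier W} \<union>
      {d (a \<odot>\<^bsub>V\<^esub> v, w) \<ominus>\<^bsub>F\<^esub> a \<odot>\<^bsub>F\<^esub> d (v, w) | a v w.
         a \<in> carrier K \<and> v \<in> carrier V \<and> w \<in> carrier W} \<union>
      {d (v, a \<odot>\<^bsub>W\<^esub> w) \<ominus>\<^bsub>F\<^esub> a \<odot>\<^bsub>F\<^esub> d (v, w) | a v w.
         a \<in> carrier K \<and> v \<in> carrier V \<and> w \<in> carrier W})"

definition tensor_null ::
    "'k ring \<Rightarrow> ('k, 'a) module \<Rightarrow> ('k, 'b) module \<Rightarrow> ('a \<times> 'b \<Rightarrow> 'k) set" where
  "tensor_null K V W =
     subspace_gen K (free_space K (carrier V \<times> carrier W)) (tensor_rel K V W)"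

definition tensor_space ::
    "'k ring \<Rightarrow> ('k, 'a) module \<Rightarrow> ('k, 'b) module \<Rightarrow> ('k, ('a \<times> 'b \<Rightarrow> 'k) set) module" where
  "tensor_space K V W =
     quot_space K (free_space K (carrier V \<times> carrier W)) (tensor_null K V W)"

text \<open>\<open>tens K V W v w\<close> is the element \<open>v \<otimes> w\<close> of \<open>V \<otimes> W\<close>.\<close>

definition tens ::
    "'k ring \<Rightarrow> ('k, 'a) module \<Rightarrow> ('k, 'b) module \<Rightarrow> 'a \<Rightarrow> 'b \<Rightarrow> ('a \<times> 'b \<Rightarrow> 'k) set" where
  "tens K V W v w =
     tensor_null K V W +>\<^bsub>free_space K (carrier V \<times> carrier W)\<^esub> free_gen K (v, w)"

text \<open>The linear map from a tensor product to \<open>Z\<close> that is induced by a bilinear map \<open>f\<close>: the sum of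
  \<open>p (v, w) \<odot> f v w\<close> is the same for all representatives \<open>p\<close> of a tensor (see
  \<open>tensor_lift_universal\<close> below).\<close>

definition tensor_lift ::
    "'k ring \<Rightarrow> ('k, 'c) module \<Rightarrow> ('a \<Rightarrow> 'b \<Rightarrow> 'c) \<Rightarrow> ('a \<times> 'b \<Rightarrow> 'k) set \<Rightarrow> 'c" where
  "tensor_lift K Z f X =
     the_elem ((\<lambda>p. \<Oplus>\<^bsub>Z\<^esub>z\<in>{z. p z \<noteq> \<zero>\<^bsub>K\<^esub>}. p z \<odot>\<^bsub>Z\<^esub> f (fst z) (snd z)) ` X)"

text \<open>The space \<open>V \<otimes> W\<close> together with the multiplication
  \<open>(v \<otimes> w) (v' \<otimes> w') = v v' \<otimes> w w'\<close> and the unit \<open>1 \<otimes> 1\<close>, which are meaningful when \<open>V\<close> and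
  \<open>W\<close> are algebras.\<close>

definition tensor ::
    "'k ring \<Rightarrow> ('k, 'a) module \<Rightarrow> ('k, 'b) module \<Rightarrow> ('k, ('a \<times> 'b \<Rightarrow> 'k) set) module" where
  "tensor K V W = (let T = tensor_space K V W in
     T\<lparr>mult := (\<lambda>X Y.
          tensor_lift K T (\<lambda>v w.
            tensor_lift K T (\<lambda>v' w'. tens K V W (v \<otimes>\<^bsub>V\<^esub> v') (w \<otimes>\<^bsub>W\<^esub> w')) Y) X),
       one := tens K V W \<one>\<^bsub>V\<^esub> \<one>\<^bsub>W\<^esub>\<rparr>)"

text \<open>\<open>tensor_map K V' W' f g\<close> is \<open>f \<otimes> g\<close>, where \<open>V'\<close> and \<open>W'\<close> are the codomains of \<open>f\<close> and \<open>g\<close>.\<close>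

definition tensor_map ::
    "'k ring \<Rightarrow> ('k, 'c) module \<Rightarrow> ('k, 'd) module \<Rightarrow> ('a \<Rightarrow> 'c) \<Rightarrow> ('b \<Rightarrow> 'd) \<Rightarrow>
     ('a \<times> 'b \<Rightarrow> 'k) set \<Rightarrow> ('c \<times> 'd \<Rightarrow> 'k) set" where
  "tensor_map K V' W' f g =
     tensor_lift K (tensor K V' W') (\<lambda>v w. tens K V' W' (f v) (g w))"

text \<open>The associativity isomorphism from \<open>(U \<otimes> V) \<otimes> W\<close> to \<open>U \<otimes> (V \<otimes> W)\<close>.\<close>

definition tensor_assoc ::
    "'k ring \<Rightarrow> ('k, 'a) module \<Rightarrow> ('k, 'b) module \<Rightarrow> ('k, 'c) module \<Rightarrow>
     (('a \<times> 'b \<Rightarrow> 'k) set \<times> 'c \<Rightarrow> 'k) set \<Rightarrow> ('a \<times> ('b \<times> 'c \<Rightarrow> 'k) set \<Rightarrow> 'k) set" where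
  "tensor_assoc K U V W =
     (let T = tensor K U (tensor K V W) in
      tensor_lift K T (\<lambda>s w.
        tensor_lift K T (\<lambda>u v. tens K U (tensor K V W) u (tens K V W v w)) s))"

text \<open>\<open>tensor_sub K V W A B\<close> is \<open>A \<otimes> B\<close>, regarded as a subspace of \<open>V \<otimes> W\<close>.\<close>

definition tensor_sub ::
    "'k ring \<Rightarrow> ('k, 'a) module \<Rightarrow> ('k, 'b) module \<Rightarrow> 'a set \<Rightarrow> 'b set \<Rightarrow>
     ('a \<times> 'b \<Rightarrow> 'k) set set" where
  "tensor_sub K V W A B =
     subspace_gen K (tensor K V W) {tens K V W v w | v w. v \<in> A \<and> w \<in> B}"


lemma subspace_gen_submodule:
  assumes "module K V" "S \<subseteq> carrier V"
  shows "submodule (subspace_gen K V S) K V"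
proof -
  interpret V: module K V by fact
  have "subspace_gen K V S \<subseteq> carrier V"
    using V.carrier_is_submodule assms(2) by (auto simp: subspace_gen_def)
  then show ?thesis
    by (intro V.submoduleI)
      (auto simp: subspace_gen_def V.submoduleE submodule.smult_closed
        dest: submodule.axioms(1) subgroup.one_closed[of _ "add_monoid V", simplified])
qed

lemma subspace_gen_incl: "S \<subseteq> subspace_gen K V S"
  by (auto simp: subspace_gen_def)

lemma subspace_gen_least: "submodule N K V \<Longrightarrow> S \<subseteq> N \<Longrightarrow> subspace_gen K V S \<subseteq> N"
  by (auto simp: subspace_gen_def)

lemma free_space_simps [simp]:
  "zero (free_space K A) = (\<lambda>z. \<zero>\<^bsub>K\<^esub>)"
  "add (free_space K A) = (\<lambda>p q z. p z \<oplus>\<^bsub>K\<^esub> q z)"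
  "smult (free_space K A) = (\<lambda>a p z. a \<otimes>\<^bsub>K\<^esub> p z)"
  by (simp_all add: free_space_def)

lemma free_space_carrier:
  "p \<in> carrier (free_space K A) \<longleftrightarrow>
    (\<forall>z. p z \<in> carrier K) \<and> (\<forall>z. z \<notin> A \<longrightarrow> p z = \<zero>\<^bsub>K\<^esub>) \<and> finite {z. p z \<noteq> \<zero>\<^bsub>K\<^esub>}"
  by (simp add: free_space_def)

lemma free_space_module:
  assumes "cring K"
  shows "module K (free_space K A)"
proof -
  interpret K: cring K by fact
  have add: "(\<lambda>z. p z \<oplus>\<^bsub>K\<^esub> q z) \<in> carrier (free_space K A)"
    if "p \<in> carrier (free_space K A)" "q \<in> carrier (free_space K A)" for p q
  proof -
    have "{z. p z \<oplus>\<^bsub>K\<^esub> q z \<noteq> \<zero>\<^bsub>K\<^esub>} \<subseteq> {z. p z \<noteq> \<zero>\<^bsub>K\<^esub>} \<union> {z. q z \<noteq> \<zero>\<^bsub>K\<^esub>}" by auto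
    moreover have "finite ({z. p z \<noteq> \<zero>\<^bsub>K\<^esub>} \<union> {z. q z \<noteq> \<zero>\<^bsub>K\<^esub>})"
      using that by (simp add: free_space_carrier)
    ultimately have "finite {z. p z \<oplus>\<^bsub>K\<^esub> q z \<noteq> \<zero>\<^bsub>K\<^esub>}" by (rule finite_subset)
    then show ?thesis using that by (simp add: free_space_carrier)
  qed
  have sm: "(\<lambda>z. a \<otimes>\<^bsub>K\<^esub> p z) \<in> carrier (free_space K A)"
    if "p \<in> carrier (free_space K A)" "a \<in> carrier K" for p a
  proof -
    have "{z. a \<otimes>\<^bsub>K\<^esub> p z \<noteq> \<zero>\<^bsub>K\<^esub>} \<subseteq> {z. p z \<noteq> \<zero>\<^bsub>K\<^esub>}" using that by auto
    then have "finite {z. a \<otimes>\<^bsub>K\<^esub> p z \<noteq> \<zero>\<^bsub>K\<^esub>}"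
      using that finite_subset by (auto simp: free_space_carrier)
    then show ?thesis using that by (simp add: free_space_carrier)
  qed
  show ?thesis
  proof (rule moduleI)
    show "cring K" by fact
    show "abelian_group (free_space K A)"
    proof (rule abelian_groupI)
      fix p assume p: "p \<in> carrier (free_space K A)"
      show "\<exists>q\<in>carrier (free_space K A). q \<oplus>\<^bsub>free_space K A\<^esub> p = \<zero>\<^bsub>free_space K A\<^esub>"
        by (intro bexI[of _ "\<lambda>z. (\<ominus>\<^bsub>K\<^esub> \<one>\<^bsub>K\<^esub>) \<otimes>\<^bsub>K\<^esub> p z"] sm)
          (use p in \<open>auto simp: free_space_carrier K.l_minus K.l_neg\<close>)
    qed (use add in \<open>auto simp: free_space_carrier K.a_ac\<close>)
  qed (use sm in \<open>auto simp: free_space_carrier K.m_assoc K.l_distr K.r_distr\<close>)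
qed

lemma free_gen_closed:
  assumes "cring K" "z \<in> A"
  shows "free_gen K z \<in> carrier (free_space K A)"
proof -
  interpret K: cring K by fact
  have "{z'. free_gen K z z' \<noteq> \<zero>\<^bsub>K\<^esub>} \<subseteq> {z}" by (auto simp: free_gen_def)
  then have "finite {z'. free_gen K z z' \<noteq> \<zero>\<^bsub>K\<^esub>}" using finite_subset by blast
  then show ?thesis using assms(2) by (auto simp: free_space_carrier) (auto simp: free_gen_def)
qed

lemma tensor_rel_closed:
  assumes "module K V" "module K W"
  shows "tensor_rel K V W \<subseteq> carrier (free_space K (carrier V \<times> carrier W))"
proof -
  interpret V: module K V by fact
  interpret W: module K W by fact
  interpret F: module K "free_space K (carrier V \<times> carrier W)"
    by (rule free_space_module) (rule V.R.cring_axioms)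
  note g = free_gen_closed[OF V.R.cring_axioms, of _ "carrier V \<times> carrier W"]
  show ?thesis
    unfolding tensor_rel_def Let_def
    by (auto simp del: free_space_simps intro!: F.M.minus_closed F.M.a_closed F.smult_closed g)
qed

lemma tensor_null_submodule:
  assumes "module K V" "module K W"
  shows "submodule (tensor_null K V W) K (free_space K (carrier V \<times> carrier W))"
  unfolding tensor_null_def
  using assms by (intro subspace_gen_submodule free_space_module tensor_rel_closed) (auto simp: module_def)

lemma tensor_sel [simp]:
  "carrier (tensor K V W) = carrier (tensor_space K V W)"
  "zero (tensor K V W) = zero (tensor_space K V W)"
  "add (tensor K V W) = add (tensor_space K V W)"
  "smult (tensor K V W) = smult (tensor_space K V W)"
  by (simp_all add: tensor_def Let_def)

lemma tensor_space_module:
  assumes "module K V" "module K W"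
  shows "module K (tensor_space K V W)"
  unfolding tensor_space_def
  using assms by (intro quot_space_module free_space_module tensor_null_submodule) (auto simp: module_def)

lemma module_cong:
  assumes "module K V" "carrier V' = carrier V" "zero V' = zero V" "add V' = add V" "smult V' = smult V"
  shows "module K V'"
proof -
  interpret V: module K V by fact
  show ?thesis
    by (rule moduleI, rule V.R.cring_axioms, rule abelian_groupI)
      (auto simp: assms(2-5) V.smult_l_distr V.smult_r_distr V.smult_assoc1 V.M.a_ac
        intro: V.M.l_neg)
qed

lemma tensor_module: "module K V \<Longrightarrow> module K W \<Longrightarrow> module K (tensor K V W)"
  by (rule module_cong[OF tensor_space_module]) simp_all

definition bilin ::
    "'k ring \<Rightarrow> ('k, 'a) module \<Rightarrow> ('k, 'b) module \<Rightarrow> ('k, 'c) module \<Rightarrow> ('a \<Rightarrow> 'b \<Rightarrow> 'c) \<Rightarrow> bool" where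
  "bilin K V W Z f \<longleftrightarrow> (\<forall>w \<in> carrier W. (\<lambda>v. f v w) \<in> lin K V Z) \<and> (\<forall>v \<in> carrier V. f v \<in> lin K W Z)"

lemma tensor_lift_universal:
  assumes "module K V" "module K W" "module K Z" "bilin K V W Z f"
  shows "tensor_lift K Z f \<in> lin K (tensor K V W) Z"
    and "v \<in> carrier V \<Longrightarrow> w \<in> carrier W \<Longrightarrow> tensor_lift K Z f (tens K V W v w) = f v w"
proof -
  interpret V: module K V by fact
  interpret W: module K W by fact
  interpret Z: module K Z by fact
  let ?F = "free_space K (carrier V \<times> carrier W)" and ?N = "tensor_null K V W"
  interpret F: module K ?F by (rule free_space_module) (rule V.R.cring_axioms)
  note N = tensor_null_submodule[OF assms(1,2)]
  interpret N: submodule ?N K ?F by (rule N)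
  interpret N: abelian_subgroup ?N ?F by (rule submodule_abelian_subgroup) (use N F.module_axioms in auto)
  note f = linD[OF bspec[OF conjunct1[OF assms(4)[unfolded bilin_def]]]]
     linD[OF bspec[OF conjunct2[OF assms(4)[unfolded bilin_def]]]]
  define ev where "ev = (\<lambda>p. \<Oplus>\<^bsub>Z\<^esub>z\<in>{z. p z \<noteq> \<zero>\<^bsub>K\<^esub>}. p z \<odot>\<^bsub>Z\<^esub> f (fst z) (snd z))"
  have fc: "f (fst z) (snd z) \<in> carrier Z" if "z \<in> carrier V \<times> carrier W" for z
    using that f(1) by (auto simp: mem_Times_iff)
  have ev_eq: "ev p = (\<Oplus>\<^bsub>Z\<^esub>z\<in>A. p z \<odot>\<^bsub>Z\<^esub> f (fst z) (snd z))"
    if "p \<in> carrier ?F" "finite A" "{z. p z \<noteq> \<zero>\<^bsub>K\<^esub>} \<subseteq> A" "A \<subseteq> carrier V \<times> carrier W" for p A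
    unfolding ev_def
    by (rule Z.M.add.finprod_mono_neutral_cong_left) (use that fc in \<open>auto simp: free_space_carrier\<close>)
  have sup: "{z. p z \<noteq> \<zero>\<^bsub>K\<^esub>} \<subseteq> carrier V \<times> carrier W" "finite {z. p z \<noteq> \<zero>\<^bsub>K\<^esub>}" "\<And>z. p z \<in> carrier K"
    if "p \<in> carrier ?F" for p using that by (auto simp: free_space_carrier)
  have ev_lin: "ev \<in> lin K ?F Z"
  proof (rule linI)
    fix p assume p: "p \<in> carrier ?F"
    show "ev p \<in> carrier Z" unfolding ev_def
      by (rule Z.M.finsum_closed) (use sup[OF p] fc in auto)
    { fix q assume q: "q \<in> carrier ?F"
      have pq: "p \<oplus>\<^bsub>?F\<^esub> q \<in> carrier ?F" using p q by (rule F.M.a_closed)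
      let ?A = "{z. p z \<noteq> \<zero>\<^bsub>K\<^esub>} \<union> {z. q z \<noteq> \<zero>\<^bsub>K\<^esub>}"
      have A: "finite ?A" "?A \<subseteq> carrier V \<times> carrier W" using sup[OF p] sup[OF q] by auto
      have sub: "{z. p z \<oplus>\<^bsub>K\<^esub> q z \<noteq> \<zero>\<^bsub>K\<^esub>} \<subseteq> ?A" by auto
      have "ev (p \<oplus>\<^bsub>?F\<^esub> q) = (\<Oplus>\<^bsub>Z\<^esub>z\<in>?A. (p z \<oplus>\<^bsub>K\<^esub> q z) \<odot>\<^bsub>Z\<^esub> f (fst z) (snd z))"
        using ev_eq[OF pq A(1) _ A(2)] sub by simp
      also have "\<dots> = (\<Oplus>\<^bsub>Z\<^esub>z\<in>?A. p z \<odot>\<^bsub>Z\<^esub> f (fst z) (snd z) \<oplus>\<^bsub>Z\<^esub> q z \<odot>\<^bsub>Z\<^esub> f (fst z) (snd z))"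
        by (rule Z.M.finsum_cong') (use sup[OF p] sup[OF q] fc A in \<open>auto simp: Z.smult_l_distr subset_iff\<close>)
      also have "\<dots> = ev p \<oplus>\<^bsub>Z\<^esub> ev q"
        using ev_eq[OF p A(1) _ A(2)] ev_eq[OF q A(1) _ A(2)] sup[OF p] sup[OF q] fc A(2)
        by (subst Z.M.finsum_addf) (auto simp: subset_iff)
      finally show "ev (p \<oplus>\<^bsub>?F\<^esub> q) = ev p \<oplus>\<^bsub>Z\<^esub> ev q" . }
    fix a assume a: "a \<in> carrier K"
    have ap: "a \<odot>\<^bsub>?F\<^esub> p \<in> carrier ?F" using a p by (rule F.smult_closed)
    have sub: "{z. a \<otimes>\<^bsub>K\<^esub> p z \<noteq> \<zero>\<^bsub>K\<^esub>} \<subseteq> {z. p z \<noteq> \<zero>\<^bsub>K\<^esub>}" using a by auto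
    have "ev (a \<odot>\<^bsub>?F\<^esub> p) = (\<Oplus>\<^bsub>Z\<^esub>z\<in>{z. p z \<noteq> \<zero>\<^bsub>K\<^esub>}. (a \<otimes>\<^bsub>K\<^esub> p z) \<odot>\<^bsub>Z\<^esub> f (fst z) (snd z))"
      using ev_eq[OF ap sup(2)[OF p] _ sup(1)[OF p]] sub by simp
    also have "\<dots> = (\<Oplus>\<^bsub>Z\<^esub>z\<in>{z. p z \<noteq> \<zero>\<^bsub>K\<^esub>}. a \<odot>\<^bsub>Z\<^esub> (p z \<odot>\<^bsub>Z\<^esub> f (fst z) (snd z)))"
      by (rule Z.M.finsum_cong') (use sup[OF p] fc a in \<open>auto simp: Z.smult_assoc1 subset_iff\<close>)
    also have "\<dots> = a \<odot>\<^bsub>Z\<^esub> ev p" unfolding ev_def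
      by (rule Z.finsum_smult_ldistr[symmetric]) (use sup[OF p] fc a in auto)
    finally show "ev (a \<odot>\<^bsub>?F\<^esub> p) = a \<odot>\<^bsub>Z\<^esub> ev p" .
  qed
  have gen: "free_gen K (v, w) \<in> carrier ?F" if "v \<in> carrier V" "w \<in> carrier W" for v w
    using that by (intro free_gen_closed V.R.cring_axioms) auto
  have ev_gen: "ev (free_gen K (v, w)) = f v w" if "v \<in> carrier V" "w \<in> carrier W" for v w
  proof -
    have "{z. free_gen K (v, w) z \<noteq> \<zero>\<^bsub>K\<^esub>} \<subseteq> {(v, w)}" by (auto simp: free_gen_def)
    then show ?thesis
      using ev_eq[OF gen[OF that], of "{(v, w)}"] that f(1)[OF that(2,1)] by (simp add: free_gen_def)
  qed
  note evD = linD[OF ev_lin] lin_zero_neg[OF F.module_axioms assms(3) ev_lin]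
  have "tensor_rel K V W \<subseteq> {p \<in> carrier ?F. ev p = \<zero>\<^bsub>Z\<^esub>}"
    using tensor_rel_closed[OF assms(1,2)]
    unfolding tensor_rel_def Let_def F.M.minus_eq
    by (auto simp del: free_space_simps
        simp: evD gen ev_gen f F.M.a_closed F.smult_closed Z.M.r_neg)
  then have null: "?N \<subseteq> {p \<in> carrier ?F. ev p = \<zero>\<^bsub>Z\<^esub>}"
    unfolding tensor_null_def
    by (intro subspace_gen_least kernel_submodule F.module_axioms assms(3) ev_lin)
  have coset: "tensor_lift K Z f (?N +>\<^bsub>?F\<^esub> p) = ev p" if p: "p \<in> carrier ?F" for p
  proof -
    have "ev q = ev p" if "q \<in> ?N +>\<^bsub>?F\<^esub> p" for q
    proof -
      obtain n where n: "n \<in> ?N" "q = n \<oplus>\<^bsub>?F\<^esub> p" using \<open>q \<in> _\<close> by (auto simp: a_r_coset_def')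
      then show ?thesis using null p evD by (auto simp del: free_space_simps)
    qed
    then have "ev ` (?N +>\<^bsub>?F\<^esub> p) = {ev p}" using N.a_rcos_self[OF p] by blast
    then show ?thesis unfolding tensor_lift_def ev_def[symmetric] by simp
  qed
  show "tensor_lift K Z f (tens K V W v w) = f v w" if "v \<in> carrier V" "w \<in> carrier W"
    using that by (simp add: tens_def coset gen ev_gen)
  have c: "\<exists>p \<in> carrier ?F. X = ?N +>\<^bsub>?F\<^esub> p" if "X \<in> carrier (tensor K V W)" for X
    using that by (auto simp: A_RCOSETS_def' tensor_space_def)
  have s: "a \<odot>\<^bsub>tensor K V W\<^esub> (?N +>\<^bsub>?F\<^esub> p) = ?N +>\<^bsub>?F\<^esub> (a \<odot>\<^bsub>?F\<^esub> p)" if "a \<in> carrier K" "p \<in> carrier ?F" for a p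
    using quot_space_smult[OF F.module_axioms N that] by (simp add: tensor_space_def)
  have a: "(?N +>\<^bsub>?F\<^esub> p) \<oplus>\<^bsub>tensor K V W\<^esub> (?N +>\<^bsub>?F\<^esub> q) = ?N +>\<^bsub>?F\<^esub> (p \<oplus>\<^bsub>?F\<^esub> q)"
    if "p \<in> carrier ?F" "q \<in> carrier ?F" for p q
    using N.a_rcos_sum[OF that] by (simp add: tensor_space_def)
  show "tensor_lift K Z f \<in> lin K (tensor K V W) Z"
    by (rule linI) (auto dest!: c simp: s a coset evD F.M.a_closed F.smult_closed simp del: free_space_simps tensor_sel)
qed

lemma tens_bilin:
  assumes "module K V" "module K W"
  shows "bilin K V W (tensor K V W) (tens K V W)"
proof -
  interpret V: module K V by fact
  interpret W: module K W by fact
  let ?F = "free_space K (carrier V \<times> carrier W)" and ?N = "tensor_null K V W"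
  interpret F: module K ?F by (rule free_space_module) (rule V.R.cring_axioms)
  note N = tensor_null_submodule[OF assms(1,2)]
  interpret N: submodule ?N K ?F by (rule N)
  interpret N: abelian_subgroup ?N ?F by (rule submodule_abelian_subgroup) (use N F.module_axioms in auto)
  have gen: "free_gen K (v, w) \<in> carrier ?F" if "v \<in> carrier V" "w \<in> carrier W" for v w
    using that by (intro free_gen_closed V.R.cring_axioms) auto
  have e: "?N +>\<^bsub>?F\<^esub> p = ?N +>\<^bsub>?F\<^esub> q" if "p \<in> carrier ?F" "q \<in> carrier ?F" "p \<ominus>\<^bsub>?F\<^esub> q \<in> tensor_rel K V W" for p q
  proof -
    have "p \<ominus>\<^bsub>?F\<^esub> q \<in> ?N" using that(3) unfolding tensor_null_def by (rule subsetD[OF subspace_gen_incl])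
    then have "p \<in> ?N +>\<^bsub>?F\<^esub> q" using N.a_rcos_module[OF that(2,1)] by (simp only: a_minus_def)
    from N.a_repr_independence'[OF this that(2)] show ?thesis by (rule sym)
  qed
  have s: "a \<odot>\<^bsub>tensor K V W\<^esub> (?N +>\<^bsub>?F\<^esub> p) = ?N +>\<^bsub>?F\<^esub> (a \<odot>\<^bsub>?F\<^esub> p)" if "a \<in> carrier K" "p \<in> carrier ?F" for a p
    using quot_space_smult[OF F.module_axioms N that] by (simp add: tensor_space_def)
  have a: "(?N +>\<^bsub>?F\<^esub> p) \<oplus>\<^bsub>tensor K V W\<^esub> (?N +>\<^bsub>?F\<^esub> q) = ?N +>\<^bsub>?F\<^esub> (p \<oplus>\<^bsub>?F\<^esub> q)"
    if "p \<in> carrier ?F" "q \<in> carrier ?F" for p q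
    using N.a_rcos_sum[OF that] by (simp add: tensor_space_def)
  have cl: "tens K V W v w \<in> carrier (tensor K V W)" if "v \<in> carrier V" "w \<in> carrier W" for v w
    using gen[OF that] by (auto simp: tens_def A_RCOSETS_def' tensor_space_def)
  have 1: "tens K V W (v \<oplus>\<^bsub>V\<^esub> v') w = tens K V W v w \<oplus>\<^bsub>tensor K V W\<^esub> tens K V W v' w" if c: "v \<in> carrier V" "v' \<in> carrier V" "w \<in> carrier W" for v v' w
  proof -
    note g = gen c F.M.a_closed F.smult_closed V.M.a_closed W.M.a_closed V.smult_closed W.smult_closed
    show ?thesis
      unfolding tens_def a[OF gen[OF c(1,3)] gen[OF c(2,3)]]
      by (rule e; (intro g)?; unfold tensor_rel_def Let_def; use c in blast)
  qed
  have 2: "tens K V W v (w \<oplus>\<^bsub>W\<^esub> w') = tens K V W v w \<oplus>\<^bsub>tensor K V W\<^esub> tens K V W v w'" if c: "v \<in> carrier V" "w \<in> carrier W" "w' \<in> carrier W" for v w w'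
  proof -
    note g = gen c F.M.a_closed F.smult_closed V.M.a_closed W.M.a_closed V.smult_closed W.smult_closed
    show ?thesis
      unfolding tens_def a[OF gen[OF c(1,2)] gen[OF c(1,3)]]
      by (rule e; (intro g)?; unfold tensor_rel_def Let_def; use c in blast)
  qed
  have 3: "tens K V W (x \<odot>\<^bsub>V\<^esub> v) w = x \<odot>\<^bsub>tensor K V W\<^esub> tens K V W v w" if c: "x \<in> carrier K" "v \<in> carrier V" "w \<in> carrier W" for x v w
  proof -
    note g = gen c F.M.a_closed F.smult_closed V.M.a_closed W.M.a_closed V.smult_closed W.smult_closed
    show ?thesis
      unfolding tens_def s[OF c(1) gen[OF c(2,3)]]
      by (rule e; (intro g)?; unfold tensor_rel_def Let_def; use c in blast)
  qed
  have 4: "tens K V W v (x \<odot>\<^bsub>W\<^esub> w) = x \<odot>\<^bsub>tensor K V W\<^esub> tens K V W v w" if c: "x \<in> carrier K" "v \<in> carrier V" "w \<in> carrier W" for x v w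
  proof -
    note g = gen c F.M.a_closed F.smult_closed V.M.a_closed W.M.a_closed V.smult_closed W.smult_closed
    show ?thesis
      unfolding tens_def s[OF c(1) gen[OF c(2,3)]]
      by (rule e; (intro g)?; unfold tensor_rel_def Let_def; use c in blast)
  qed
  show ?thesis unfolding bilin_def
    by (intro conjI ballI linI cl 1 2 3 4)
qed


section \<open>Hopf algebras\<close>

text \<open>The antipode axiom is \<open>\<Sum> S x\<^sub>1 x\<^sub>2 = \<epsilon>(x) 1 = \<Sum> x\<^sub>1 S x\<^sub>2\<close>. In the counit axiom \<open>K \<otimes> H\<close> and \<open>H \<otimes> K\<close>
  are identified with \<open>H\<close>.\<close>

locale hopf_algebra =
  fixes K :: "'k ring" (structure)
    and H :: "('k, 'h) module" (structure)
    and \<Delta> :: "'h \<Rightarrow> ('h \<times> 'h \<Rightarrow> 'k) set"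
    and \<epsilon> :: "'h \<Rightarrow> 'k"
    and S :: "'h \<Rightarrow> 'h"
  assumes field: "field K"
    and ring: "ring H"
    and module: "module K H"
    and smult_mult_left: "\<And>a x y. \<lbrakk>a \<in> carrier K; x \<in> carrier H; y \<in> carrier H\<rbrakk> \<Longrightarrow>
      (a \<odot>\<^bsub>H\<^esub> x) \<otimes>\<^bsub>H\<^esub> y = a \<odot>\<^bsub>H\<^esub> (x \<otimes>\<^bsub>H\<^esub> y)"
    and smult_mult_right: "\<And>a x y. \<lbrakk>a \<in> carrier K; x \<in> carrier H; y \<in> carrier H\<rbrakk> \<Longrightarrow>
      x \<otimes>\<^bsub>H\<^esub> (a \<odot>\<^bsub>H\<^esub> y) = a \<odot>\<^bsub>H\<^esub> (x \<otimes>\<^bsub>H\<^esub> y)"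
    and comult_lin: "\<Delta> \<in> lin K H (tensor K H H)"
    and counit_lin: "\<epsilon> \<in> lin K H (ground_space K)"
    and coassoc: "\<And>x. x \<in> carrier H \<Longrightarrow>
      tensor_assoc K H H H (tensor_map K (tensor K H H) H \<Delta> (\<lambda>y. y) (\<Delta> x)) =
      tensor_map K H (tensor K H H) (\<lambda>y. y) \<Delta> (\<Delta> x)"
    and counit_left: "\<And>x. x \<in> carrier H \<Longrightarrow> tensor_lift K H (\<lambda>y z. \<epsilon> y \<odot>\<^bsub>H\<^esub> z) (\<Delta> x) = x"
    and counit_right: "\<And>x. x \<in> carrier H \<Longrightarrow> tensor_lift K H (\<lambda>y z. \<epsilon> z \<odot>\<^bsub>H\<^esub> y) (\<Delta> x) = x"
    and comult_hom: "\<Delta> \<in> ring_hom H (tensor K H H)"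
    and counit_hom: "\<epsilon> \<in> ring_hom H K"
    and antipode_lin: "S \<in> lin K H H"
    and antipode_left: "\<And>x. x \<in> carrier H \<Longrightarrow>
      tensor_lift K H (\<lambda>y z. S y \<otimes>\<^bsub>H\<^esub> z) (\<Delta> x) = \<epsilon> x \<odot>\<^bsub>H\<^esub> \<one>\<^bsub>H\<^esub>"
    and antipode_right: "\<And>x. x \<in> carrier H \<Longrightarrow>
      tensor_lift K H (\<lambda>y z. y \<otimes>\<^bsub>H\<^esub> S z) (\<Delta> x) = \<epsilon> x \<odot>\<^bsub>H\<^esub> \<one>\<^bsub>H\<^esub>"


subsection \<open>Left ideal coideals\<close>

definition left_ideal :: "'h set \<Rightarrow> ('k, 'h) module \<Rightarrow> bool" where
  "left_ideal I H \<longleftrightarrow> additive_subgroup I H \<and> (\<forall>h \<in> carrier H. \<forall>x \<in> I. h \<otimes>\<^bsub>H\<^esub> x \<in> I)"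

definition left_ideal_gen :: "('k, 'h) module \<Rightarrow> 'h set \<Rightarrow> 'h set" where
  "left_ideal_gen H S = \<Inter> {I. left_ideal I H \<and> S \<subseteq> I}"

definition left_ideal_coideal ::
    "'k ring \<Rightarrow> ('k, 'h) module \<Rightarrow> ('h \<Rightarrow> ('h \<times> 'h \<Rightarrow> 'k) set) \<Rightarrow> ('h \<Rightarrow> 'k) \<Rightarrow> 'h set \<Rightarrow> bool" where
  "left_ideal_coideal K H \<Delta> \<epsilon> I \<longleftrightarrow> left_ideal I H \<and>
     \<Delta> ` I \<subseteq> tensor_sub K H H I (carrier H) <+>\<^bsub>tensor K H H\<^esub> tensor_sub K H H (carrier H) I \<and>
     (\<forall>x \<in> I. \<epsilon> x = \<zero>\<^bsub>K\<^esub>)"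

definition proj :: "('k, 'h) module \<Rightarrow> 'h set \<Rightarrow> 'h \<Rightarrow> 'h set" where
  "proj H I x = I +>\<^bsub>H\<^esub> x"

text \<open>The coactions \<open>(H \<otimes> \<pi>\<^sub>I) \<Delta>\<close> and \<open>(\<pi>\<^sub>I \<otimes> H) \<Delta>\<close> of \<open>H/I\<close> on \<open>H\<close>.\<close>

definition right_coaction ::
    "'k ring \<Rightarrow> ('k, 'h) module \<Rightarrow> ('h \<Rightarrow> ('h \<times> 'h \<Rightarrow> 'k) set) \<Rightarrow> 'h set \<Rightarrow>
     'h \<Rightarrow> ('h \<times> 'h set \<Rightarrow> 'k) set" where
  "right_coaction K H \<Delta> I x = tensor_map K H (quot_space K H I) (\<lambda>y. y) (proj H I) (\<Delta> x)"

definition left_coaction ::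
    "'k ring \<Rightarrow> ('k, 'h) module \<Rightarrow> ('h \<Rightarrow> ('h \<times> 'h \<Rightarrow> 'k) set) \<Rightarrow> 'h set \<Rightarrow>
     'h \<Rightarrow> ('h set \<times> 'h \<Rightarrow> 'k) set" where
  "left_coaction K H \<Delta> I x = tensor_map K (quot_space K H I) H (proj H I) (\<lambda>y. y) (\<Delta> x)"

definition coinvariants ::
    "'k ring \<Rightarrow> ('k, 'h) module \<Rightarrow> ('h \<Rightarrow> ('h \<times> 'h \<Rightarrow> 'k) set) \<Rightarrow> 'h set \<Rightarrow> 'h set" where
  "coinvariants K H \<Delta> I =
     {x \<in> carrier H. left_coaction K H \<Delta> I x = tens K (quot_space K H I) H (proj H I \<one>\<^bsub>H\<^esub>) x}"

text \<open>The associativity isomorphism makes both maps take values in \<open>H \<otimes> (H/I \<otimes> H)\<close>.\<close>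

definition cotensor ::
    "'k ring \<Rightarrow> ('k, 'h) module \<Rightarrow> ('h \<Rightarrow> ('h \<times> 'h \<Rightarrow> 'k) set) \<Rightarrow> 'h set \<Rightarrow>
     ('h \<times> 'h \<Rightarrow> 'k) set set" where
  "cotensor K H \<Delta> I = (let Q = quot_space K H I in
     {t \<in> carrier (tensor K H H).
        tensor_assoc K H Q H
          (tensor_map K (tensor K H Q) H (right_coaction K H \<Delta> I) (\<lambda>y. y) t) =
        tensor_map K H (tensor K Q H) (\<lambda>y. y) (left_coaction K H \<Delta> I) t})"

definition coequalizer_left_ideal_coideals ::
    "'k ring \<Rightarrow> ('k, 'h) module \<Rightarrow> ('h \<Rightarrow> ('h \<times> 'h \<Rightarrow> 'k) set) \<Rightarrow> ('h \<Rightarrow> 'k) \<Rightarrow> 'h set set" where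
  "coequalizer_left_ideal_coideals K H \<Delta> \<epsilon> =
     {I. left_ideal_coideal K H \<Delta> \<epsilon> I \<and>
         is_coequalizer K ((tensor K H H)\<lparr>carrier := cotensor K H \<Delta> I\<rparr>) H (quot_space K H I)
           (tensor_lift K H (\<lambda>x y. \<epsilon> x \<odot>\<^bsub>H\<^esub> y)) (tensor_lift K H (\<lambda>x y. \<epsilon> y \<odot>\<^bsub>H\<^esub> x))
           (proj H I)}"


subsection \<open>Right coideal subalgebras\<close>

definition right_coideal_subalgebra ::
    "'k ring \<Rightarrow> ('k, 'h) module \<Rightarrow> ('h \<Rightarrow> ('h \<times> 'h \<Rightarrow> 'k) set) \<Rightarrow> 'h set \<Rightarrow> bool" where
  "right_coideal_subalgebra K H \<Delta> B \<longleftrightarrow> subring B H \<and> submodule B K H \<and>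
     \<Delta> ` B \<subseteq> tensor_sub K H H B (carrier H)"

definition balanced_null ::
    "'k ring \<Rightarrow> ('k, 'h) module \<Rightarrow> 'h set \<Rightarrow> ('h \<times> 'h \<Rightarrow> 'k) set set" where
  "balanced_null K H B = subspace_gen K (tensor K H H)
     {tens K H H (x \<otimes>\<^bsub>H\<^esub> b) y \<ominus>\<^bsub>tensor K H H\<^esub> tens K H H x (b \<otimes>\<^bsub>H\<^esub> y) | x b y.
        x \<in> carrier H \<and> b \<in> B \<and> y \<in> carrier H}"

text \<open>\<open>H \<otimes>\<^sub>B H\<close> and its elements \<open>x \<otimes>\<^sub>B y\<close>.\<close>

definition balanced_tensor ::
    "'k ring \<Rightarrow> ('k, 'h) module \<Rightarrow> 'h set \<Rightarrow> ('k, ('h \<times> 'h \<Rightarrow> 'k) set set) module" where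
  "balanced_tensor K H B = quot_space K (tensor K H H) (balanced_null K H B)"

definition balanced_tens ::
    "'k ring \<Rightarrow> ('k, 'h) module \<Rightarrow> 'h set \<Rightarrow> 'h \<Rightarrow> 'h \<Rightarrow> ('h \<times> 'h \<Rightarrow> 'k) set set" where
  "balanced_tens K H B x y = balanced_null K H B +>\<^bsub>tensor K H H\<^esub> tens K H H x y"

definition augmentation_part :: "'k ring \<Rightarrow> ('h \<Rightarrow> 'k) \<Rightarrow> 'h set \<Rightarrow> 'h set" where
  "augmentation_part K \<epsilon> B = {b \<in> B. \<epsilon> b = \<zero>\<^bsub>K\<^esub>}"

definition equalizer_right_coideal_subalgebras ::
    "'k ring \<Rightarrow> ('k, 'h) module \<Rightarrow> ('h \<Rightarrow> ('h \<times> 'h \<Rightarrow> 'k) set) \<Rightarrow> 'h set set" where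
  "equalizer_right_coideal_subalgebras K H \<Delta> =
     {B. right_coideal_subalgebra K H \<Delta> B \<and>
         is_equalizer K (H\<lparr>carrier := B\<rparr>) H (balanced_tensor K H B) (\<lambda>b. b)
           (\<lambda>x. balanced_tens K H B x \<one>\<^bsub>H\<^esub>) (\<lambda>x. balanced_tens K H B \<one>\<^bsub>H\<^esub> x)}"

end

theory Submission
  imports Defs
begin

text \<open>The map \<open>\<kappa>(x \<otimes> y) = \<Sum> x\<^sub>1 \<otimes> x\<^sub>2 y\<close> is bijective on \<open>H \<otimes> H\<close>, with inverse \<open>x \<otimes> y \<mapsto> \<Sum> x\<^sub>1 \<otimes> S x\<^sub>2 y\<close>;
  the antipode enters the proof only through this inverse and its analogue with a left module in
  the second factor. For a right coideal subalgebra \<open>B\<close>, \<open>\<kappa>\<close> maps the kernel of \<open>H \<otimes> H \<rightarrow> H \<otimes>\<^sub>B H\<close>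
  onto \<open>HB\<^sup>+ \<otimes> H\<close> and \<open>x \<otimes> 1 - 1 \<otimes> x\<close> to \<open>\<Delta> x - 1 \<otimes> x\<close>, so the equalizer condition says
  \<open>B = \<Psi> (\<Phi> B)\<close>. For a left ideal coideal \<open>I\<close> and \<open>B = \<Psi> I\<close>, \<open>\<kappa>\<close> maps \<open>H \<otimes> B\<close> onto the cotensor
  product, and the difference of the two parallel maps becomes \<open>x \<otimes> b \<mapsto> x (b - \<epsilon>(b))\<close> with image
  \<open>HB\<^sup>+\<close>, so the coequalizer condition says \<open>I = \<Phi> (\<Psi> I)\<close>. The rest is a Galois connection.\<close>

section \<open>Linear maps and tensor products\<close>

text \<open>No flatness of \<open>H\<close> over \<open>B\<close> and no coflatness over
  \<open>H/I\<close> is assumed, so tensoring over them preserves no exact sequence. Both diagrams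
  are therefore first turned into equalities of subspaces of \<open>H\<close>, and equations in a
  quotient into membership statements. Coinvariance of x reads \<Delta> x \<equiv> 1 \<otimes> x
  modulo I \<otimes> H; this fits \<kappa>, because I \<otimes> H is a left ideal of H \<otimes> H
  and \<kappa> multiplies by \<Delta> x from the left. Exactness is used only over the field, for
  the kernels of f \<otimes> id and id \<otimes> f.

  The cotensor product is the harder side, since its defining equation has three tensor factors.
  Composed with \<kappa>, its two maps become, before the projection to H/I, one and the same twist
  applied to x \<otimes> (1 \<otimes> z) and to x \<otimes> \<Delta> z. This twist is the analogue
  of \<kappa> for H \<otimes> H as a module through \<Delta>. It and its inverse preserve H
  \<otimes> (I \<otimes> H), so it can be cancelled, and what is left is the coinvariance of
  z.\<close>

declare tensor_sel [simp del] quot_space_simps [simp del] free_space_simps [simp del]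

lemma lin_ident: "(\<lambda>x. x) \<in> lin K V V"
  by (simp add: lin_def)

lemma lin_add:
  assumes "module K W" "f \<in> lin K V W" "g \<in> lin K V W"
  shows "(\<lambda>x. f x \<oplus>\<^bsub>W\<^esub> g x) \<in> lin K V W"
proof -
  interpret W: module K W by fact
  note f = linD[OF assms(2)] and g = linD[OF assms(3)]
  show ?thesis by (rule linI) (simp_all add: f g W.M.a_ac W.smult_r_distr)
qed

lemma lin_uminus:
  assumes "module K W" "f \<in> lin K V W"
  shows "(\<lambda>x. \<ominus>\<^bsub>W\<^esub> f x) \<in> lin K V W"
proof -
  interpret W: module K W by fact
  note f = linD[OF assms(2)]
  show ?thesis by (rule linI) (simp_all add: f W.M.minus_add W.smult_r_minus)
qed

lemma lin_minus:
  assumes "module K W" "f \<in> lin K V W" "g \<in> lin K V W"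
  shows "(\<lambda>x. f x \<ominus>\<^bsub>W\<^esub> g x) \<in> lin K V W"
  unfolding a_minus_def by (intro lin_add lin_uminus assms)

lemma lin_smult:
  assumes "module K W" "a \<in> carrier K" "f \<in> lin K V W"
  shows "(\<lambda>x. a \<odot>\<^bsub>W\<^esub> f x) \<in> lin K V W"
proof -
  interpret W: module K W by fact
  note f = linD[OF assms(3)]
  show ?thesis
    by (rule linI) (simp_all add: f assms(2) W.smult_r_distr W.smult_assoc1[symmetric] W.R.m_comm)
qed

lemma lin_scalar:
  assumes "module K W" "f \<in> lin K V (ground_space K)" "w \<in> carrier W"
  shows "(\<lambda>x. f x \<odot>\<^bsub>W\<^esub> w) \<in> lin K V W"
proof -
  interpret W: module K W by fact
  note f = linD[OF assms(2), unfolded ground_space_def, simplified]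
  show ?thesis by (rule linI) (simp_all add: f assms(3) W.smult_l_distr W.smult_assoc1)
qed

lemma lin_diff_eq:
  assumes "module K V" "module K W" "f \<in> lin K V W" "x \<in> carrier V" "y \<in> carrier V"
  shows "f (x \<ominus>\<^bsub>V\<^esub> y) = f x \<ominus>\<^bsub>W\<^esub> f y"
proof -
  interpret V: module K V by fact
  show ?thesis using assms(4,5)
    by (simp add: a_minus_def linD[OF assms(3)] lin_zero_neg[OF assms(1-3)])
qed

lemma module_diff_eq_zero_iff:
  assumes "module K V" "x \<in> carrier V" "y \<in> carrier V"
  shows "x \<ominus>\<^bsub>V\<^esub> y = \<zero>\<^bsub>V\<^esub> \<longleftrightarrow> x = y"
proof -
  interpret V: module K V by fact
  show ?thesis
  proof
    assume "x \<ominus>\<^bsub>V\<^esub> y = \<zero>\<^bsub>V\<^esub>"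
    then have "\<ominus>\<^bsub>V\<^esub> (\<ominus>\<^bsub>V\<^esub> y) = x"
      unfolding a_minus_def by (rule V.M.minus_equality) (use assms(2,3) in auto)
    then show "x = y" using assms(3) by simp
  qed (use assms(2,3) in \<open>simp add: a_minus_def V.M.r_neg\<close>)
qed

lemma bilinI:
  assumes "\<And>w. w \<in> carrier W \<Longrightarrow> (\<lambda>v. f v w) \<in> lin K V Z"
    and "\<And>v. v \<in> carrier V \<Longrightarrow> (\<lambda>w. f v w) \<in> lin K W Z"
  shows "bilin K V W Z f"
  using assms by (simp add: bilin_def)

lemma bilin_left:
  assumes "bilin K V W Z f" "g \<in> lin K X V" "w \<in> carrier W"
  shows "(\<lambda>x. f (g x) w) \<in> lin K X Z"
  using lin_comp[OF assms(2), of "\<lambda>v. f v w" Z] assms(1,3) by (simp add: bilin_def)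

lemma bilin_right:
  assumes "bilin K V W Z f" "v \<in> carrier V" "g \<in> lin K X W"
  shows "(\<lambda>x. f v (g x)) \<in> lin K X Z"
  using lin_comp[OF assms(3), of "f v" Z] assms(1,2) by (simp add: bilin_def)

lemma bilin_closed:
  "bilin K V W Z f \<Longrightarrow> v \<in> carrier V \<Longrightarrow> w \<in> carrier W \<Longrightarrow> f v w \<in> carrier Z"
  by (auto simp: bilin_def lin_def)

lemmas lin_tens_left = bilin_left[OF tens_bilin]
lemmas lin_tens_right = bilin_right[OF tens_bilin]
lemmas tens_closed = bilin_closed[OF tens_bilin]

section \<open>Submodules: closure, images, preimages and spans\<close>

lemma submodule_closed:
  assumes "module K V" "submodule N K V"
  shows "x \<in> N \<Longrightarrow> x \<in> carrier V" "\<zero>\<^bsub>V\<^esub> \<in> N"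
    "x \<in> N \<Longrightarrow> y \<in> N \<Longrightarrow> x \<oplus>\<^bsub>V\<^esub> y \<in> N"
    "x \<in> N \<Longrightarrow> \<ominus>\<^bsub>V\<^esub> x \<in> N"
    "x \<in> N \<Longrightarrow> y \<in> N \<Longrightarrow> x \<ominus>\<^bsub>V\<^esub> y \<in> N"
    "a \<in> carrier K \<Longrightarrow> x \<in> N \<Longrightarrow> a \<odot>\<^bsub>V\<^esub> x \<in> N"
proof -
  interpret V: module K V by fact
  note E = V.submoduleE[OF assms(2)]
  interpret N: submodule N K V by fact
  show "x \<in> N \<Longrightarrow> x \<in> carrier V" using E(1) by blast
  show "\<zero>\<^bsub>V\<^esub> \<in> N" using N.one_closed by simp
  show "x \<in> N \<Longrightarrow> y \<in> N \<Longrightarrow> x \<oplus>\<^bsub>V\<^esub> y \<in> N" by (rule E(5))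
  show "x \<in> N \<Longrightarrow> \<ominus>\<^bsub>V\<^esub> x \<in> N" by (rule E(3))
  show "x \<in> N \<Longrightarrow> y \<in> N \<Longrightarrow> x \<ominus>\<^bsub>V\<^esub> y \<in> N" unfolding a_minus_def by (intro E(5) E(3))
  show "a \<in> carrier K \<Longrightarrow> x \<in> N \<Longrightarrow> a \<odot>\<^bsub>V\<^esub> x \<in> N" by (rule E(4))
qed

text \<open>Negatives come for free as multiples by -1.\<close>

lemma submodule_intro:
  assumes "module K V" "N \<subseteq> carrier V" "\<zero>\<^bsub>V\<^esub> \<in> N"
    "\<And>x y. x \<in> N \<Longrightarrow> y \<in> N \<Longrightarrow> x \<oplus>\<^bsub>V\<^esub> y \<in> N"
    "\<And>a x. a \<in> carrier K \<Longrightarrow> x \<in> N \<Longrightarrow> a \<odot>\<^bsub>V\<^esub> x \<in> N"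
  shows "submodule N K V"
proof -
  interpret V: module K V by fact
  have "\<ominus>\<^bsub>V\<^esub> x \<in> N" if "x \<in> N" for x
  proof -
    have x: "x \<in> carrier V" using that assms(2) by blast
    have "\<ominus>\<^bsub>V\<^esub> x = (\<ominus>\<^bsub>K\<^esub> \<one>\<^bsub>K\<^esub>) \<odot>\<^bsub>V\<^esub> x" using x by (simp add: V.smult_l_minus)
    then show ?thesis using assms(5)[of "\<ominus>\<^bsub>K\<^esub> \<one>\<^bsub>K\<^esub>" x] that by simp
  qed
  then show ?thesis using assms by (intro V.submoduleI) auto
qed

lemma preimage_submodule:
  assumes "module K V" "module K W" "f \<in> lin K V W" "submodule N K W"
  shows "submodule {x \<in> carrier V. f x \<in> N} K V"
proof -
  interpret V: module K V by fact
  show ?thesis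
    by (rule submodule_intro[OF assms(1)])
      (auto simp: linD[OF assms(3)] lin_zero_neg[OF assms(1-3)] submodule_closed[OF assms(2,4)])
qed

lemma image_submodule:
  assumes "module K V" "module K W" "f \<in> lin K V W" "submodule N K V"
  shows "submodule (f ` N) K W"
proof -
  note N = submodule_closed[OF assms(1,4)] and f = linD[OF assms(3)]
  have fN: "f (x \<oplus>\<^bsub>V\<^esub> y) = f x \<oplus>\<^bsub>W\<^esub> f y" "a \<in> carrier K \<Longrightarrow> f (a \<odot>\<^bsub>V\<^esub> x) = a \<odot>\<^bsub>W\<^esub> f x"
    if "x \<in> N" "y \<in> N" for a x y using that f N by simp_all
  show ?thesis
  proof (rule submodule_intro[OF assms(2)])
    show "f ` N \<subseteq> carrier W" using N(1) f(1) by blast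
    show "\<zero>\<^bsub>W\<^esub> \<in> f ` N" using N(2) lin_zero_neg(1)[OF assms(1-3)] by (metis imageI)
    show "x \<oplus>\<^bsub>W\<^esub> y \<in> f ` N" if "x \<in> f ` N" "y \<in> f ` N" for x y
      using that fN(1) N(3) by (metis (no_types, lifting) imageE imageI)
    show "a \<odot>\<^bsub>W\<^esub> x \<in> f ` N" if "a \<in> carrier K" "x \<in> f ` N" for a x
      using that fN(2) N(6) by (metis (no_types, lifting) imageE imageI)
  qed
qed

text \<open>The preimage of \<open>N\<close> is a submodule containing \<open>A\<close>. This serves
  as the induction principle for spans: every membership claim that is linear in x is checked on
  generators only.\<close>

lemma lin_subspace_gen:
  assumes "module K V" "module K W" "f \<in> lin K V W" "submodule N K W"
    "A \<subseteq> carrier V" "\<And>a. a \<in> A \<Longrightarrow> f a \<in> N" "x \<in> subspace_gen K V A"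
  shows "f x \<in> N"
  using subspace_gen_least[OF preimage_submodule[OF assms(1-4)], of A] assms(5-7) by blast

lemma subspace_gen_mono: "A \<subseteq> B \<Longrightarrow> subspace_gen K V A \<subseteq> subspace_gen K V B"
  by (auto simp: subspace_gen_def)

section \<open>Subspaces of tensor products and reduction to pure tensors\<close>

lemma tensor_sub_submodule:
  assumes "module K V" "module K W" "A \<subseteq> carrier V" "B \<subseteq> carrier W"
  shows "submodule (tensor_sub K V W A B) K (tensor K V W)"
  unfolding tensor_sub_def
  using assms by (intro subspace_gen_submodule tensor_module) (auto intro!: tens_closed)

lemma tens_in_tensor_sub: "v \<in> A \<Longrightarrow> w \<in> B \<Longrightarrow> tens K V W v w \<in> tensor_sub K V W A B"
  unfolding tensor_sub_def by (rule subsetD[OF subspace_gen_incl]) blast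

lemma tensor_sub_mono: "A \<subseteq> A' \<Longrightarrow> B \<subseteq> B' \<Longrightarrow> tensor_sub K V W A B \<subseteq> tensor_sub K V W A' B'"
  unfolding tensor_sub_def by (rule subspace_gen_mono) blast

lemma lin_tensor_sub:
  assumes "module K V" "module K W" "module K Z" "f \<in> lin K (tensor K V W) Z" "submodule N K Z"
    "A \<subseteq> carrier V" "B \<subseteq> carrier W" "\<And>a b. a \<in> A \<Longrightarrow> b \<in> B \<Longrightarrow> f (tens K V W a b) \<in> N"
    "t \<in> tensor_sub K V W A B"
  shows "f t \<in> N"
  by (rule lin_subspace_gen[OF tensor_module[OF assms(1,2)] assms(3-5) _ _ assms(9)[unfolded tensor_sub_def]])
    (use assms in \<open>auto intro: tens_closed\<close>)

text \<open>The difference of the two maps sends the generators into the zero submodule, so the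
  membership principle \<open>lin_tensor_sub\<close> also yields equations.\<close>

lemma lin_eq_on_tensor_sub:
  assumes "module K V" "module K W" "module K Z"
    and fg: "f \<in> lin K (tensor K V W) Z" "g \<in> lin K (tensor K V W) Z"
    and "A \<subseteq> carrier V" "B \<subseteq> carrier W"
    and eq: "\<And>a b. a \<in> A \<Longrightarrow> b \<in> B \<Longrightarrow> f (tens K V W a b) = g (tens K V W a b)"
    and "t \<in> tensor_sub K V W A B"
  shows "f t = g t"
proof -
  note T = tensor_module[OF assms(1,2)]
  interpret Z: module K Z by fact
  have 0: "submodule {\<zero>\<^bsub>Z\<^esub>} K Z" by (rule submodule_intro[OF assms(3)]) auto
  have t: "t \<in> carrier (tensor K V W)"
    using submodule_closed(1)[OF T tensor_sub_submodule[OF assms(1,2,6,7)] assms(9)] .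
  have "f t \<ominus>\<^bsub>Z\<^esub> g t \<in> {\<zero>\<^bsub>Z\<^esub>}"
  proof (rule lin_tensor_sub[OF assms(1-3) lin_minus[OF assms(3) fg] 0 assms(6,7) _ assms(9)])
    fix a b assume ab: "a \<in> A" "b \<in> B"
    have "tens K V W a b \<in> carrier (tensor K V W)" using ab assms(6,7) by (intro tens_closed assms(1,2)) auto
    then show "f (tens K V W a b) \<ominus>\<^bsub>Z\<^esub> g (tens K V W a b) \<in> {\<zero>\<^bsub>Z\<^esub>}"
      using eq[OF ab] linD(1)[OF fg(2)] module_diff_eq_zero_iff[OF assms(3)] by simp
  qed
  then show ?thesis using module_diff_eq_zero_iff[OF assms(3)] linD(1)[OF fg(1) t] linD(1)[OF fg(2) t] by simp
qed

text \<open>Induction on the finite support of \<open>p\<close>: setting one nonzero value to zero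
  shrinks the support, and the removed part is a multiple of a \<open>free_gen\<close>.\<close>

lemma free_space_span:
  assumes "cring K" "submodule N K (free_space K A)" "\<And>z. z \<in> A \<Longrightarrow> free_gen K z \<in> N"
    "p \<in> carrier (free_space K A)"
  shows "p \<in> N"
proof -
  interpret K: cring K by fact
  note F = free_space_module[OF assms(1), of A]
  note N = submodule_closed[OF F assms(2)]
  have "finite {z. p z \<noteq> \<zero>\<^bsub>K\<^esub>}" using assms(4) by (simp add: free_space_carrier)
  then show ?thesis using assms(4)
  proof (induction "{z. p z \<noteq> \<zero>\<^bsub>K\<^esub>}" arbitrary: p rule: finite_psubset_induct)
    case psubset
    note p = psubset.prems[unfolded free_space_carrier]
    show ?case
    proof (cases "{z. p z \<noteq> \<zero>\<^bsub>K\<^esub>} = {}")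
      case True
      then have "p = \<zero>\<^bsub>free_space K A\<^esub>" by (auto simp: free_space_simps)
      then show ?thesis using N(2) by simp
    next
      case False
      then obtain z0 where z0: "p z0 \<noteq> \<zero>\<^bsub>K\<^esub>" by blast
      define q where "q = p(z0 := \<zero>\<^bsub>K\<^esub>)"
      have sup: "{z. q z \<noteq> \<zero>\<^bsub>K\<^esub>} \<subset> {z. p z \<noteq> \<zero>\<^bsub>K\<^esub>}" using z0 by (auto simp: q_def)
      have "q \<in> carrier (free_space K A)"
        using p finite_subset[OF psubset_imp_subset[OF sup]]
        by (auto simp: free_space_carrier q_def)
      with psubset.hyps(2)[OF sup] have q: "q \<in> N" by blast
      have "z0 \<in> A" using p z0 by blast
      then have "p z0 \<odot>\<^bsub>free_space K A\<^esub> free_gen K z0 \<in> N" using assms(3) N(6) p by blast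
      with q have "q \<oplus>\<^bsub>free_space K A\<^esub> (p z0 \<odot>\<^bsub>free_space K A\<^esub> free_gen K z0) \<in> N" by (rule N(3))
      moreover have "q \<oplus>\<^bsub>free_space K A\<^esub> (p z0 \<odot>\<^bsub>free_space K A\<^esub> free_gen K z0) = p"
        using p by (auto simp: free_space_simps q_def free_gen_def)
      ultimately show ?thesis by simp
    qed
  qed
qed

text \<open>Pulled back along the quotient map from the free space, the span of the pure tensors
  contains every \<open>free_gen\<close>, hence everything. With this equation, facts about
  \<open>tensor_sub\<close> specialise to the whole tensor product.\<close>

lemma tensor_sub_carrier:
  assumes "module K V" "module K W"
  shows "tensor_sub K V W (carrier V) (carrier W) = carrier (tensor K V W)"
proof
  note T = tensor_module[OF assms]
  note sub = tensor_sub_submodule[OF assms order_refl order_refl]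
  show "tensor_sub K V W (carrier V) (carrier W) \<subseteq> carrier (tensor K V W)"
    using submodule_closed(1)[OF T sub] by blast
  interpret V: module K V by fact
  let ?F = "free_space K (carrier V \<times> carrier W)" and ?N = "tensor_null K V W"
  note F = free_space_module[OF V.R.cring_axioms, of "carrier V \<times> carrier W"]
  note N = tensor_null_submodule[OF assms]
  have T_eq: "module K (quot_space K ?F ?N)" by (rule quot_space_module[OF F N])
  have pr: "(\<lambda>v. ?N +>\<^bsub>?F\<^esub> v) \<in> lin K ?F (tensor K V W)"
    using quot_space_proj[OF F N] by (simp add: lin_def tensor_sel tensor_space_def)
  show "carrier (tensor K V W) \<subseteq> tensor_sub K V W (carrier V) (carrier W)"
  proof
    fix t assume "t \<in> carrier (tensor K V W)"
    then obtain p where p: "p \<in> carrier ?F" "t = ?N +>\<^bsub>?F\<^esub> p"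
      by (auto simp: A_RCOSETS_def' tensor_space_def tensor_sel quot_space_simps)
    have "p \<in> {x \<in> carrier ?F. ?N +>\<^bsub>?F\<^esub> x \<in> tensor_sub K V W (carrier V) (carrier W)}"
    proof (rule free_space_span[OF V.R.cring_axioms preimage_submodule[OF F T pr sub] _ p(1)])
      fix z assume z: "z \<in> carrier V \<times> carrier W"
      then obtain v w where "z = (v, w)" "v \<in> carrier V" "w \<in> carrier W" by auto
      then show "free_gen K z \<in> {x \<in> carrier ?F. ?N +>\<^bsub>?F\<^esub> x \<in> tensor_sub K V W (carrier V) (carrier W)}"
        using tens_in_tensor_sub[of v "carrier V" w "carrier W" K V W] free_gen_closed[OF V.R.cring_axioms z]
        by (simp add: tens_def)
    qed
    then show "t \<in> tensor_sub K V W (carrier V) (carrier W)" using p by simp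
  qed
qed

lemma lin_eq_on_tensor:
  assumes "module K V" "module K W" "module K Z"
    and "f \<in> lin K (tensor K V W) Z" "g \<in> lin K (tensor K V W) Z"
    and "\<And>a b. a \<in> carrier V \<Longrightarrow> b \<in> carrier W \<Longrightarrow> f (tens K V W a b) = g (tens K V W a b)"
    and "t \<in> carrier (tensor K V W)"
  shows "f t = g t"
  using lin_eq_on_tensor_sub[OF assms(1-5) order_refl order_refl assms(6)] assms(7)
  by (simp add: tensor_sub_carrier[OF assms(1,2)])

lemma lin_tensor_into:
  assumes "module K V" "module K W" "module K Z" "f \<in> lin K (tensor K V W) Z" "submodule N K Z"
    "\<And>a b. a \<in> carrier V \<Longrightarrow> b \<in> carrier W \<Longrightarrow> f (tens K V W a b) \<in> N"
    "t \<in> carrier (tensor K V W)"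
  shows "f t \<in> N"
  using lin_tensor_sub[OF assms(1-5) order_refl order_refl assms(6)] assms(7)
  by (simp add: tensor_sub_carrier[OF assms(1,2)])

lemma lin_tensor_lift:
  assumes "module K V" "module K W" "module K Z" "bilin K V W Z f" "g \<in> lin K X (tensor K V W)"
  shows "(\<lambda>x. tensor_lift K Z f (g x)) \<in> lin K X Z"
  by (rule lin_comp[OF assms(5) tensor_lift_universal(1)[OF assms(1-4)]])

text \<open>Functions that agree on the carriers may differ elsewhere, so this is not plain
  congruence. On the carriers \<open>g\<close> inherits bilinearity from \<open>f\<close>, and then
  both lifts are linear and agree on pure tensors.\<close>

lemma tensor_lift_cong:
  assumes "module K V" "module K W" "module K Z" "bilin K V W Z f"
    "\<And>v w. v \<in> carrier V \<Longrightarrow> w \<in> carrier W \<Longrightarrow> f v w = g v w" "t \<in> carrier (tensor K V W)"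
  shows "tensor_lift K Z f t = tensor_lift K Z g t"
proof -
  have g: "bilin K V W Z g"
  proof (rule bilinI)
    show "(\<lambda>v. g v w) \<in> lin K V Z" if "w \<in> carrier W" for w
      by (rule lin_cong[of "\<lambda>v. f v w"]) (use assms that in \<open>auto simp: bilin_def\<close>)
    show "g v \<in> lin K W Z" if "v \<in> carrier V" for v
      by (rule lin_cong[of "f v"]) (use assms that in \<open>auto simp: bilin_def\<close>)
  qed
  show ?thesis
    by (rule lin_eq_on_tensor[OF assms(1-3) _ _ _ assms(6)])
      (use assms g in \<open>simp_all add: tensor_lift_universal\<close>)
qed

text \<open>For fixed parameters both sides of each equation are linear in the tensor, so pure
  tensors suffice. This is what makes iterated lifts bilinear: associativity, the product of H
  \<otimes> H, and nested Sweedler sums.\<close>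

lemma lin_tensor_lift_param:
  assumes "module K V" "module K W" "module K Z" "module K X"
    and bil: "\<And>x. x \<in> carrier X \<Longrightarrow> bilin K V W Z (F x)"
    and lin: "\<And>v w. v \<in> carrier V \<Longrightarrow> w \<in> carrier W \<Longrightarrow> (\<lambda>x. F x v w) \<in> lin K X Z"
    and t: "t \<in> carrier (tensor K V W)"
  shows "(\<lambda>x. tensor_lift K Z (F x) t) \<in> lin K X Z"
proof -
  interpret X: module K X by fact
  note L = tensor_lift_universal[OF assms(1-3)]
  show ?thesis
  proof (rule linI)
    fix x assume x: "x \<in> carrier X"
    show "tensor_lift K Z (F x) t \<in> carrier Z" by (rule linD(1)[OF L(1)[OF bil[OF x]] t])
    fix y assume y: "y \<in> carrier X"
    show "tensor_lift K Z (F (x \<oplus>\<^bsub>X\<^esub> y)) t = tensor_lift K Z (F x) t \<oplus>\<^bsub>Z\<^esub> tensor_lift K Z (F y) t"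
      by (rule lin_eq_on_tensor[OF assms(1-3) L(1) lin_add[OF assms(3) L(1) L(1)] _ t])
        (use bil x y linD(2)[OF lin] in \<open>simp_all add: L(2)\<close>)
  next
    fix a x assume ax: "a \<in> carrier K" "x \<in> carrier X"
    show "tensor_lift K Z (F (a \<odot>\<^bsub>X\<^esub> x)) t = a \<odot>\<^bsub>Z\<^esub> tensor_lift K Z (F x) t"
      by (rule lin_eq_on_tensor[OF assms(1-3) L(1) lin_smult[OF assms(3) _ L(1)] _ t])
        (use bil ax linD(3)[OF lin] in \<open>simp_all add: L(2)\<close>)
  qed
qed

section \<open>Maps between tensor products and the associativity isomorphism\<close>

lemma tensor_map_bilin:
  assumes "module K V'" "module K W'" "f \<in> lin K V V'" "g \<in> lin K W W'"
  shows "bilin K V W (tensor K V' W') (\<lambda>v w. tens K V' W' (f v) (g w))"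
  by (intro bilinI lin_tens_left lin_tens_right assms) (simp_all add: linD(1)[OF assms(3)] linD(1)[OF assms(4)])

lemma tensor_map_lin:
  assumes "module K V" "module K W" "module K V'" "module K W'" "f \<in> lin K V V'" "g \<in> lin K W W'"
  shows "tensor_map K V' W' f g \<in> lin K (tensor K V W) (tensor K V' W')"
  unfolding tensor_map_def
  by (rule tensor_lift_universal(1)[OF assms(1,2) tensor_module[OF assms(3,4)] tensor_map_bilin[OF assms(3-6)]])

lemma tensor_map_tens:
  assumes "module K V" "module K W" "module K V'" "module K W'" "f \<in> lin K V V'" "g \<in> lin K W W'"
    "v \<in> carrier V" "w \<in> carrier W"
  shows "tensor_map K V' W' f g (tens K V W v w) = tens K V' W' (f v) (g w)"
  unfolding tensor_map_def
  by (rule tensor_lift_universal(2)[OF assms(1,2) tensor_module[OF assms(3,4)] tensor_map_bilin[OF assms(3-6)] assms(7,8)])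

lemma lin_tensor_lift_eq:
  assumes "module K V" "module K W" "module K Z" "module K Z'" "f \<in> lin K Z Z'" "bilin K V W Z g"
    "t \<in> carrier (tensor K V W)"
  shows "f (tensor_lift K Z g t) = tensor_lift K Z' (\<lambda>a b. f (g a b)) t"
proof -
  have b: "bilin K V W Z' (\<lambda>a b. f (g a b))"
    by (rule bilinI) (auto intro!: lin_comp[OF _ assms(5)] bilin_left[OF assms(6) lin_ident] bilin_right[OF assms(6) _ lin_ident])
  show ?thesis
    by (rule lin_eq_on_tensor[OF assms(1,2,4) lin_comp[OF tensor_lift_universal(1)[OF assms(1-3,6)] assms(5)]
          tensor_lift_universal(1)[OF assms(1,2,4) b] _ assms(7)])
      (simp add: tensor_lift_universal(2)[OF assms(1-3,6)] tensor_lift_universal(2)[OF assms(1,2,4) b])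
qed

lemma tensor_lift_eqI:
  assumes "module K V" "module K W" "module K Z" "f \<in> lin K (tensor K V W) Z" "bilin K V W Z g"
    "\<And>v w. v \<in> carrier V \<Longrightarrow> w \<in> carrier W \<Longrightarrow> f (tens K V W v w) = g v w" "t \<in> carrier (tensor K V W)"
  shows "f t = tensor_lift K Z g t"
  by (rule lin_eq_on_tensor[OF assms(1-4) tensor_lift_universal(1)[OF assms(1-3,5)] _ assms(7)])
    (simp add: assms(6) tensor_lift_universal(2)[OF assms(1-3,5)])

lemma tensor_assoc_inner:
  assumes M: "module K U" "module K V" "module K W" and "w \<in> carrier W"
  shows "bilin K U V (tensor K U (tensor K V W)) (\<lambda>u v. tens K U (tensor K V W) u (tens K V W v w))"
  by (intro bilinI lin_tens_left lin_tens_right lin_ident tensor_module tens_closed assms)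

lemma tensor_assoc_outer:
  assumes M: "module K U" "module K V" "module K W"
  shows "bilin K (tensor K U V) W (tensor K U (tensor K V W))
    (\<lambda>s w. tensor_lift K (tensor K U (tensor K V W)) (\<lambda>u v. tens K U (tensor K V W) u (tens K V W v w)) s)"
proof (rule bilinI)
  fix w assume "w \<in> carrier W"
  then show "(\<lambda>s. tensor_lift K (tensor K U (tensor K V W)) (\<lambda>u v. tens K U (tensor K V W) u (tens K V W v w)) s)
      \<in> lin K (tensor K U V) (tensor K U (tensor K V W))"
    by (intro tensor_lift_universal(1) tensor_module M tensor_assoc_inner)
next
  fix s assume "s \<in> carrier (tensor K U V)"
  then show "(\<lambda>w. tensor_lift K (tensor K U (tensor K V W)) (\<lambda>u v. tens K U (tensor K V W) u (tens K V W v w)) s)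
      \<in> lin K W (tensor K U (tensor K V W))"
    by (intro lin_tensor_lift_param[OF M(1,2)] tensor_module M tensor_assoc_inner lin_tens_right lin_ident)
qed

lemma tensor_assoc_lin:
  assumes "module K U" "module K V" "module K W"
  shows "tensor_assoc K U V W \<in> lin K (tensor K (tensor K U V) W) (tensor K U (tensor K V W))"
  unfolding tensor_assoc_def Let_def
  by (intro tensor_lift_universal(1) tensor_module assms tensor_assoc_outer)

lemma tensor_assoc_tens2:
  assumes "module K U" "module K V" "module K W" "s \<in> carrier (tensor K U V)" "w \<in> carrier W"
  shows "tensor_assoc K U V W (tens K (tensor K U V) W s w) =
    tensor_lift K (tensor K U (tensor K V W)) (\<lambda>u v. tens K U (tensor K V W) u (tens K V W v w)) s"
  unfolding tensor_assoc_def Let_def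
  by (rule tensor_lift_universal(2)) (intro tensor_module assms tensor_assoc_outer)+

lemma tensor_assoc_tens:
  assumes "module K U" "module K V" "module K W" "u \<in> carrier U" "v \<in> carrier V" "w \<in> carrier W"
  shows "tensor_assoc K U V W (tens K (tensor K U V) W (tens K U V u v) w) =
    tens K U (tensor K V W) u (tens K V W v w)"
proof -
  have "tensor_lift K (tensor K U (tensor K V W)) (\<lambda>u v. tens K U (tensor K V W) u (tens K V W v w)) (tens K U V u v) =
      tens K U (tensor K V W) u (tens K V W v w)"
    by (rule tensor_lift_universal(2)) (intro tensor_module assms tensor_assoc_inner)+
  then show ?thesis by (simp add: tensor_assoc_tens2 assms tens_closed)
qed

lemma submodule_set_add:
  assumes V: "module K V" and "submodule M K V" "submodule N K V"
  shows "submodule (M <+>\<^bsub>V\<^esub> N) K V"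
proof -
  interpret V: module K V by fact
  note M = submodule_closed[OF V assms(2)] and N = submodule_closed[OF V assms(3)]
  have I: "m \<oplus>\<^bsub>V\<^esub> n \<in> M <+>\<^bsub>V\<^esub> N" if "m \<in> M" "n \<in> N" for m n
    using that by (auto simp: set_add_def')
  have E: "\<exists>m \<in> M. \<exists>n \<in> N. x = m \<oplus>\<^bsub>V\<^esub> n" if "x \<in> M <+>\<^bsub>V\<^esub> N" for x
    using that by (auto simp: set_add_def')
  show ?thesis
  proof (rule submodule_intro[OF V])
    show "M <+>\<^bsub>V\<^esub> N \<subseteq> carrier V" using E M(1) N(1) by fastforce
    show "\<zero>\<^bsub>V\<^esub> \<in> M <+>\<^bsub>V\<^esub> N" using I[OF M(2) N(2)] by simp
    show "x \<oplus>\<^bsub>V\<^esub> y \<in> M <+>\<^bsub>V\<^esub> N" if xy: "x \<in> M <+>\<^bsub>V\<^esub> N" "y \<in> M <+>\<^bsub>V\<^esub> N" for x y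
    proof -
      obtain m n m' n' where mn: "m \<in> M" "n \<in> N" "m' \<in> M" "n' \<in> N" "x = m \<oplus>\<^bsub>V\<^esub> n" "y = m' \<oplus>\<^bsub>V\<^esub> n'"
        using E[OF xy(1)] E[OF xy(2)] by blast
      then have "x \<oplus>\<^bsub>V\<^esub> y = (m \<oplus>\<^bsub>V\<^esub> m') \<oplus>\<^bsub>V\<^esub> (n \<oplus>\<^bsub>V\<^esub> n')" using M(1) N(1) by (simp add: V.M.a_ac)
      then show ?thesis using I[OF M(3) N(3)] mn by simp
    qed
    show "a \<odot>\<^bsub>V\<^esub> x \<in> M <+>\<^bsub>V\<^esub> N" if ax: "a \<in> carrier K" "x \<in> M <+>\<^bsub>V\<^esub> N" for a x
    proof -
      obtain m n where mn: "m \<in> M" "n \<in> N" "x = m \<oplus>\<^bsub>V\<^esub> n" using E[OF ax(2)] by blast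
      then have "a \<odot>\<^bsub>V\<^esub> x = a \<odot>\<^bsub>V\<^esub> m \<oplus>\<^bsub>V\<^esub> a \<odot>\<^bsub>V\<^esub> n" using M(1) N(1) ax(1) by (simp add: V.smult_r_distr)
      then show ?thesis using I[OF M(6) N(6)] mn ax(1) by simp
    qed
  qed
qed

section \<open>Splittings and kernels over a field\<close>

lemma module_diff_zero:
  assumes "module K V" "x \<in> carrier V"
  shows "x \<ominus>\<^bsub>V\<^esub> \<zero>\<^bsub>V\<^esub> = x"
proof -
  interpret V: module K V by fact
  have "\<ominus>\<^bsub>V\<^esub> \<zero>\<^bsub>V\<^esub> = \<zero>\<^bsub>V\<^esub>" by (rule V.M.minus_equality) simp_all
  then show ?thesis using assms(2) by (simp add: a_minus_def)
qed

text \<open>By Zorn there is a maximal submodule \<open>C\<close> meeting \<open>N\<close> only in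
  zero. If some v had no component in \<open>N\<close> relative to \<open>C\<close>, adding the line
  through v would give a larger such submodule.\<close>

lemma submodule_complement:
  assumes "field K" "module K V" "submodule N K V"
  obtains C where "submodule C K V" "C \<inter> N = {\<zero>\<^bsub>V\<^esub>}"
    "\<And>v. v \<in> carrier V \<Longrightarrow> \<exists>n \<in> N. v \<ominus>\<^bsub>V\<^esub> n \<in> C"
proof -
  interpret K: field K by fact
  interpret V: module K V by fact
  note N = submodule_closed[OF assms(2,3)]
  define \<A> where "\<A> = {C. submodule C K V \<and> C \<inter> N = {\<zero>\<^bsub>V\<^esub>}}"
  have "\<exists>M\<in>\<A>. \<forall>X\<in>\<A>. M \<subseteq> X \<longrightarrow> X = M"
  proof (rule subset_Zorn_nonempty)
    have "{\<zero>\<^bsub>V\<^esub>} \<in> \<A>" using N(2) by (auto simp: \<A>_def intro!: submodule_intro[OF assms(2)])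
    then show "\<A> \<noteq> {}" by blast
    fix \<C> assume ne: "\<C> \<noteq> {}" and ch: "subset.chain \<A> \<C>"
    have sm: "submodule C K V" "C \<inter> N = {\<zero>\<^bsub>V\<^esub>}" if "C \<in> \<C>" for C
      using ch that unfolding subset.chain_def \<A>_def by blast+
    have "submodule (\<Union>\<C>) K V"
    proof (rule submodule_intro[OF assms(2)])
      show "\<Union>\<C> \<subseteq> carrier V" using submodule_closed(1)[OF assms(2) sm(1)] by blast
      show "\<zero>\<^bsub>V\<^esub> \<in> \<Union>\<C>" using ne submodule_closed(2)[OF assms(2) sm(1)] by blast
      show "x \<oplus>\<^bsub>V\<^esub> y \<in> \<Union>\<C>" if xy: "x \<in> \<Union>\<C>" "y \<in> \<Union>\<C>" for x y
      proof -
        obtain C D where CD: "C \<in> \<C>" "D \<in> \<C>" "x \<in> C" "y \<in> D" using xy by blast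
        then have "C \<subseteq> D \<or> D \<subseteq> C" using ch unfolding subset.chain_def by blast
        then show ?thesis using CD submodule_closed(3)[OF assms(2) sm(1)] by blast
      qed
      show "a \<odot>\<^bsub>V\<^esub> x \<in> \<Union>\<C>" if "a \<in> carrier K" "x \<in> \<Union>\<C>" for a x
        using that submodule_closed(6)[OF assms(2) sm(1)] by blast
    qed
    moreover have "\<Union>\<C> \<inter> N = {\<zero>\<^bsub>V\<^esub>}" using ne sm(2) by blast
    ultimately show "\<Union>\<C> \<in> \<A>" by (simp add: \<A>_def)
  qed
  then obtain C where CA: "C \<in> \<A>" and max: "\<And>X. X \<in> \<A> \<Longrightarrow> C \<subseteq> X \<Longrightarrow> X = C" by blast
  have C0: "submodule C K V" "C \<inter> N = {\<zero>\<^bsub>V\<^esub>}" using CA by (simp_all add: \<A>_def)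
  note C = submodule_closed[OF assms(2) C0(1)]
  have "\<exists>n \<in> N. v \<ominus>\<^bsub>V\<^esub> n \<in> C" if v: "v \<in> carrier V" for v
  proof (rule ccontr)
    assume contra: "\<not> (\<exists>n \<in> N. v \<ominus>\<^bsub>V\<^esub> n \<in> C)"
    define D where "D = {c \<oplus>\<^bsub>V\<^esub> a \<odot>\<^bsub>V\<^esub> v | c a. c \<in> C \<and> a \<in> carrier K}"
    have DI: "c \<oplus>\<^bsub>V\<^esub> a \<odot>\<^bsub>V\<^esub> v \<in> D" if "c \<in> C" "a \<in> carrier K" for c a using that by (auto simp: D_def)
    have CD: "C \<subseteq> D"
    proof
      fix c assume c: "c \<in> C"
      then show "c \<in> D" using DI[OF c K.zero_closed] v C(1)[OF c] by simp
    qed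
    have vD: "v \<in> D" using DI[OF C(2) K.one_closed] v by simp
    have "submodule D K V"
    proof (rule submodule_intro[OF assms(2)])
      show "D \<subseteq> carrier V" using C(1) v by (auto simp: D_def)
      show "\<zero>\<^bsub>V\<^esub> \<in> D" using CD C(2) by blast
      show "x \<oplus>\<^bsub>V\<^esub> y \<in> D" if xy: "x \<in> D" "y \<in> D" for x y
      proof -
        obtain c a d b where x: "x = c \<oplus>\<^bsub>V\<^esub> a \<odot>\<^bsub>V\<^esub> v" "c \<in> C" "a \<in> carrier K"
          and y: "y = d \<oplus>\<^bsub>V\<^esub> b \<odot>\<^bsub>V\<^esub> v" "d \<in> C" "b \<in> carrier K" using xy by (auto simp: D_def)
        have "x \<oplus>\<^bsub>V\<^esub> y = (c \<oplus>\<^bsub>V\<^esub> d) \<oplus>\<^bsub>V\<^esub> (a \<oplus>\<^bsub>K\<^esub> b) \<odot>\<^bsub>V\<^esub> v"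
          using x y v C(1) by (simp add: V.smult_l_distr V.M.a_ac)
        then show ?thesis using DI[of "c \<oplus>\<^bsub>V\<^esub> d" "a \<oplus>\<^bsub>K\<^esub> b"] x y C(3) by simp
      qed
      show "b \<odot>\<^bsub>V\<^esub> x \<in> D" if bx: "b \<in> carrier K" "x \<in> D" for b x
      proof -
        obtain c a where x: "x = c \<oplus>\<^bsub>V\<^esub> a \<odot>\<^bsub>V\<^esub> v" "c \<in> C" "a \<in> carrier K" using bx by (auto simp: D_def)
        have "b \<odot>\<^bsub>V\<^esub> x = b \<odot>\<^bsub>V\<^esub> c \<oplus>\<^bsub>V\<^esub> (b \<otimes>\<^bsub>K\<^esub> a) \<odot>\<^bsub>V\<^esub> v"
          using x v C(1) bx by (simp add: V.smult_r_distr V.smult_assoc1)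
        then show ?thesis using DI[of "b \<odot>\<^bsub>V\<^esub> c" "b \<otimes>\<^bsub>K\<^esub> a"] x bx C(6) by simp
      qed
    qed
    moreover have "D \<inter> N = {\<zero>\<^bsub>V\<^esub>}"
    proof -
      have "x = \<zero>\<^bsub>V\<^esub>" if x: "x \<in> D" "x \<in> N" for x
      proof -
        obtain c a where ca: "x = c \<oplus>\<^bsub>V\<^esub> a \<odot>\<^bsub>V\<^esub> v" "c \<in> C" "a \<in> carrier K" using x by (auto simp: D_def)
        show ?thesis
        proof (cases "a = \<zero>\<^bsub>K\<^esub>")
          case True
          then have "x = c" using ca v C(1) by simp
          then show ?thesis using C0(2) ca(2) x(2) by blast
        next
          case False
          then have inv: "inv\<^bsub>K\<^esub> a \<in> carrier K" "inv\<^bsub>K\<^esub> a \<otimes>\<^bsub>K\<^esub> a = \<one>\<^bsub>K\<^esub>"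
            using ca(3) K.field_Units by auto
          \<comment> \<open>Dividing x = c + a v by the nonzero scalar a exhibits v as an element of
            \<open>N\<close> plus an element of \<open>C\<close>, contrary to the choice of
            v.\<close>
          have "inv\<^bsub>K\<^esub> a \<odot>\<^bsub>V\<^esub> x = inv\<^bsub>K\<^esub> a \<odot>\<^bsub>V\<^esub> c \<oplus>\<^bsub>V\<^esub> v"
            using ca v C(1) inv by (simp add: V.smult_r_distr flip: V.smult_assoc1)
          then have "v \<ominus>\<^bsub>V\<^esub> (inv\<^bsub>K\<^esub> a \<odot>\<^bsub>V\<^esub> x) = \<ominus>\<^bsub>V\<^esub> (inv\<^bsub>K\<^esub> a \<odot>\<^bsub>V\<^esub> c)"
            using v C(1)[OF C(6)[OF inv(1) ca(2)]]
            by (simp add: a_minus_def V.M.minus_add V.M.a_ac V.M.r_neg V.M.r_neg2 V.M.r_neg1)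
          then have "v \<ominus>\<^bsub>V\<^esub> (inv\<^bsub>K\<^esub> a \<odot>\<^bsub>V\<^esub> x) \<in> C" using C(4)[OF C(6)[OF inv(1) ca(2)]] by simp
          then show ?thesis using contra N(6)[OF inv(1) x(2)] by blast
        qed
      qed
      then show ?thesis using CD C(2) N(2) by blast
    qed
    ultimately have "D = C" using max[of D] CD by (simp add: \<A>_def)
    then have "v \<ominus>\<^bsub>V\<^esub> \<zero>\<^bsub>V\<^esub> \<in> C" using vD v module_diff_zero[OF assms(2)] by simp
    then show False using contra N(2) by blast
  qed
  then show thesis using that C0 by blast
qed

text \<open>Relative to a complement the component in \<open>N\<close> is unique, and uniqueness
  makes an arbitrary choice of it linear.\<close>

lemma submodule_projection:
  assumes "field K" "module K V" "submodule N K V"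
  obtains p where "p \<in> lin K V V" "\<And>v. v \<in> carrier V \<Longrightarrow> p v \<in> N" "\<And>v. v \<in> N \<Longrightarrow> p v = v"
proof -
  interpret V: module K V by fact
  note N = submodule_closed[OF assms(2,3)]
  obtain C where C0: "submodule C K V" "C \<inter> N = {\<zero>\<^bsub>V\<^esub>}"
    "\<And>v. v \<in> carrier V \<Longrightarrow> \<exists>n \<in> N. v \<ominus>\<^bsub>V\<^esub> n \<in> C"
    using submodule_complement[OF assms] by blast
  note C = submodule_closed[OF assms(2) C0(1)]
  define p where "p v = (SOME n. n \<in> N \<and> v \<ominus>\<^bsub>V\<^esub> n \<in> C)" for v
  have p: "p v \<in> N" "v \<ominus>\<^bsub>V\<^esub> p v \<in> C" if "v \<in> carrier V" for v
    using someI_ex[of "\<lambda>n. n \<in> N \<and> v \<ominus>\<^bsub>V\<^esub> n \<in> C"] C0(3)[OF that] unfolding p_def by blast+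
  have uniq: "p v = n" if v: "v \<in> carrier V" and n: "n \<in> N" "v \<ominus>\<^bsub>V\<^esub> n \<in> C" for v n
  proof -
    note pv = N(1)[OF p(1)[OF v]] and n' = N(1)[OF n(1)]
    have "(v \<ominus>\<^bsub>V\<^esub> n) \<ominus>\<^bsub>V\<^esub> (v \<ominus>\<^bsub>V\<^esub> p v) = (v \<oplus>\<^bsub>V\<^esub> \<ominus>\<^bsub>V\<^esub> v) \<oplus>\<^bsub>V\<^esub> (p v \<ominus>\<^bsub>V\<^esub> n)"
      using v n' pv by (simp add: a_minus_def V.M.minus_add V.M.a_ac)
    also have "\<dots> = p v \<ominus>\<^bsub>V\<^esub> n" using v n' pv by (simp add: V.M.r_neg)
    finally have "(v \<ominus>\<^bsub>V\<^esub> n) \<ominus>\<^bsub>V\<^esub> (v \<ominus>\<^bsub>V\<^esub> p v) = p v \<ominus>\<^bsub>V\<^esub> n" .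
    then have "p v \<ominus>\<^bsub>V\<^esub> n \<in> C \<inter> N" using C(5)[OF n(2) p(2)[OF v]] N(5)[OF p(1)[OF v] n(1)] by simp
    then show ?thesis using C0(2) module_diff_eq_zero_iff[OF assms(2)] N(1) n(1) p(1)[OF v] by auto
  qed
  have "p \<in> lin K V V"
  proof (rule linI)
    fix x assume x: "x \<in> carrier V"
    note px = p[OF x] N(1)[OF p(1)[OF x]]
    show "p x \<in> carrier V" by (rule px)
    { fix y assume y: "y \<in> carrier V"
      note py = p[OF y] N(1)[OF p(1)[OF y]]
      have "(x \<oplus>\<^bsub>V\<^esub> y) \<ominus>\<^bsub>V\<^esub> (p x \<oplus>\<^bsub>V\<^esub> p y) = (x \<ominus>\<^bsub>V\<^esub> p x) \<oplus>\<^bsub>V\<^esub> (y \<ominus>\<^bsub>V\<^esub> p y)"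
        using x y px py by (simp add: a_minus_def V.M.minus_add V.M.a_ac)
      then show "p (x \<oplus>\<^bsub>V\<^esub> y) = p x \<oplus>\<^bsub>V\<^esub> p y"
        using x y px py N(3) C(3) by (intro uniq) auto }
    fix a assume a: "a \<in> carrier K"
    have "(a \<odot>\<^bsub>V\<^esub> x) \<ominus>\<^bsub>V\<^esub> (a \<odot>\<^bsub>V\<^esub> p x) = a \<odot>\<^bsub>V\<^esub> (x \<ominus>\<^bsub>V\<^esub> p x)"
      using a x px by (simp add: a_minus_def V.smult_r_distr V.smult_r_minus)
    then show "p (a \<odot>\<^bsub>V\<^esub> x) = a \<odot>\<^bsub>V\<^esub> p x"
      using x px a N(6) C(6) by (intro uniq) auto
  qed
  moreover have "p v = v" if "v \<in> N" for v
    using that N(1)[OF that] C(2) by (intro uniq) (simp_all add: a_minus_def V.M.r_neg)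
  ultimately show thesis using that p(1) by blast
qed

text \<open>Since \<open>f r f = f\<close>, the identity \<open>t = ((1 - r f) \<otimes> id) t + (r f \<otimes> id) t\<close> computes the kernel of
  \<open>f \<otimes> id\<close>; this replaces flatness over the field.\<close>

lemma lin_generalized_inverse:
  assumes "field K" "module K V" "module K W" "f \<in> lin K V W"
  obtains r where "r \<in> lin K W V" "\<And>v. v \<in> carrier V \<Longrightarrow> f (r (f v)) = f v"
proof -
  interpret V: module K V by fact
  let ?N = "{v \<in> carrier V. f v = \<zero>\<^bsub>W\<^esub>}"
  note N = kernel_submodule[OF assms(2-4)]
  obtain p where p: "p \<in> lin K V V" "\<And>v. v \<in> carrier V \<Longrightarrow> p v \<in> ?N" "\<And>v. v \<in> ?N \<Longrightarrow> p v = v"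
    using submodule_projection[OF assms(1,2) N] by blast
  interpret W: module K W by fact
  have im: "submodule (f ` carrier V) K W"
    by (rule image_submodule[OF assms(2-4)]) (rule V.carrier_is_submodule)
  obtain q where q: "q \<in> lin K W W" "\<And>w. w \<in> carrier W \<Longrightarrow> q w \<in> f ` carrier V"
    "\<And>w. w \<in> f ` carrier V \<Longrightarrow> q w = w"
    using submodule_projection[OF assms(1,3) im] by blast
  define P where "P = W\<lparr>carrier := f ` carrier V\<rparr>"
  have fP: "f \<in> lin K V P" by (rule linI) (simp_all add: P_def linD[OF assms(4)])
  have qP: "q \<in> lin K W P" by (rule linI) (simp_all add: P_def q linD[OF q(1)])
  have e: "(\<lambda>v. v \<ominus>\<^bsub>V\<^esub> p v) \<in> lin K V V" by (intro lin_minus lin_ident p assms)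
  \<comment> \<open>As p is the identity on the kernel of f, the value v - p v depends only on f v;
    this allows it to be factored through the image of f.\<close>
  have eq: "x \<ominus>\<^bsub>V\<^esub> p x = y \<ominus>\<^bsub>V\<^esub> p y" if xy: "x \<in> carrier V" "y \<in> carrier V" "f x = f y" for x y
  proof -
    have px: "p x \<in> carrier V" "p y \<in> carrier V" using linD(1)[OF p(1)] xy by auto
    have "f (x \<ominus>\<^bsub>V\<^esub> y) = \<zero>\<^bsub>W\<^esub>"
      using xy lin_diff_eq[OF assms(2-4)] module_diff_eq_zero_iff[OF assms(3)] linD(1)[OF assms(4)] by simp
    then have "p (x \<ominus>\<^bsub>V\<^esub> y) = x \<ominus>\<^bsub>V\<^esub> y" using xy by (intro p(3)) simp
    then have h: "p x \<ominus>\<^bsub>V\<^esub> p y = x \<ominus>\<^bsub>V\<^esub> y" using lin_diff_eq[OF assms(2,2) p(1) xy(1,2)] by simp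
    have "(x \<ominus>\<^bsub>V\<^esub> p x) \<ominus>\<^bsub>V\<^esub> (y \<ominus>\<^bsub>V\<^esub> p y) = (x \<ominus>\<^bsub>V\<^esub> y) \<ominus>\<^bsub>V\<^esub> (p x \<ominus>\<^bsub>V\<^esub> p y)"
      using xy px by (simp add: a_minus_def V.M.minus_add V.M.a_ac)
    then have "(x \<ominus>\<^bsub>V\<^esub> p x) \<ominus>\<^bsub>V\<^esub> (y \<ominus>\<^bsub>V\<^esub> p y) = \<zero>\<^bsub>V\<^esub>"
      using xy(1,2) px module_diff_eq_zero_iff[OF assms(2), of "x \<ominus>\<^bsub>V\<^esub> y" "x \<ominus>\<^bsub>V\<^esub> y"] by (simp add: h)
    then show ?thesis
      using module_diff_eq_zero_iff[OF assms(2) V.M.minus_closed[OF xy(1) px(1)] V.M.minus_closed[OF xy(2) px(2)]]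
      by (rule iffD1[rotated])
  qed
  have imP: "f ` carrier V = carrier P" by (simp add: P_def)
  \<comment> \<open>On the image, f (u (f x)) = f (x - p x) = f x. Precomposing u with the
    projection q onto the image extends it to all of \<open>W\<close>.\<close>
  obtain u where u: "u \<in> lin K P V \<inter> extensional (carrier P)"
    "\<And>x. x \<in> carrier V \<Longrightarrow> u (f x) = x \<ominus>\<^bsub>V\<^esub> p x"
    by (rule lin_factor[OF assms(2) fP imP e eq]; (assumption | rule that))
  show thesis
  proof (rule that[of "\<lambda>w. u (q w)"])
    show "(\<lambda>w. u (q w)) \<in> lin K W V" using lin_comp[OF qP] u(1) by blast
    fix v assume v: "v \<in> carrier V"
    have "p v \<in> carrier V" "f (p v) = \<zero>\<^bsub>W\<^esub>" using p(2)[OF v] by auto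
    then show "f (u (q (f v))) = f v"
      using v q(3) u(2)[OF v] lin_diff_eq[OF assms(2-4) v] linD(1)[OF assms(4) v] module_diff_zero[OF assms(3)]
      by simp
  qed
qed

lemma tensor_map_left_kernel:
  assumes "field K" "module K V" "module K W" "module K U" "f \<in> lin K V W"
    and t: "t \<in> carrier (tensor K V U)" and 0: "tensor_map K W U f (\<lambda>u. u) t = \<zero>\<^bsub>tensor K W U\<^esub>"
  shows "t \<in> tensor_sub K V U {v \<in> carrier V. f v = \<zero>\<^bsub>W\<^esub>} (carrier U)"
proof -
  interpret V: module K V by fact
  interpret W: module K W by fact
  obtain r where r: "r \<in> lin K W V" "\<And>v. v \<in> carrier V \<Longrightarrow> f (r (f v)) = f v"
    using lin_generalized_inverse[OF assms(1-3,5)] by blast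
  note f = linD[OF assms(5)] and r' = linD[OF r(1)]
  define e where "e v = v \<ominus>\<^bsub>V\<^esub> r (f v)" for v
  have e: "e \<in> lin K V V" unfolding e_def by (intro lin_minus lin_ident lin_comp[OF assms(5)] r assms)
  note M = assms(2-4) tensor_module[OF assms(2,4)] tensor_module[OF assms(3,4)]
  have ek: "e v \<in> {v \<in> carrier V. f v = \<zero>\<^bsub>W\<^esub>}" if "v \<in> carrier V" for v
    using that f r' r(2) lin_diff_eq[OF assms(2,3,5)] module_diff_eq_zero_iff[OF assms(3)] by (simp add: e_def)
  note lin = tensor_map_lin[OF assms(2,4,2,4) e lin_ident] tensor_map_lin[OF assms(2,4,3,4,5) lin_ident]
    tensor_map_lin[OF assms(3,4,2,4) r(1) lin_ident]
  interpret T: module K "tensor K V U" by (rule M)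
  have "t = tensor_map K V U e (\<lambda>u. u) t \<oplus>\<^bsub>tensor K V U\<^esub>
      tensor_map K V U r (\<lambda>u. u) (tensor_map K W U f (\<lambda>u. u) t)"
  proof (rule lin_eq_on_tensor[OF assms(2,4) M(4) lin_ident lin_add[OF M(4) lin(1) lin_comp[OF lin(2,3)]] _ t])
    fix v u assume vu: "v \<in> carrier V" "u \<in> carrier U"
    have "tens K V U (e v) u \<oplus>\<^bsub>tensor K V U\<^esub> tens K V U (r (f v)) u = tens K V U (e v \<oplus>\<^bsub>V\<^esub> r (f v)) u"
      using linD(2)[OF lin_tens_left[OF assms(2,4) lin_ident vu(2)]] vu f r' ek by simp
    also have "e v \<oplus>\<^bsub>V\<^esub> r (f v) = v" using vu f r' by (simp add: e_def a_minus_def V.M.a_assoc V.M.l_neg)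
    finally show "tens K V U v u = tensor_map K V U e (\<lambda>u. u) (tens K V U v u) \<oplus>\<^bsub>tensor K V U\<^esub>
      tensor_map K V U r (\<lambda>u. u) (tensor_map K W U f (\<lambda>u. u) (tens K V U v u))"
      using vu f by (simp add: tensor_map_tens[OF _ _ _ _ _ lin_ident] assms r e)
  qed
  also have "\<dots> = tensor_map K V U e (\<lambda>u. u) t"
    using linD(1)[OF lin(1) t] lin_zero_neg(1)[OF M(5,4) lin(3)] by (simp add: 0)
  finally have t': "t = tensor_map K V U e (\<lambda>u. u) t" .
  have "tensor_map K V U e (\<lambda>u. u) t \<in> tensor_sub K V U {v \<in> carrier V. f v = \<zero>\<^bsub>W\<^esub>} (carrier U)"
  proof (rule lin_tensor_into[OF assms(2,4) M(4) lin(1) _ _ t])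
    show "submodule (tensor_sub K V U {v \<in> carrier V. f v = \<zero>\<^bsub>W\<^esub>} (carrier U)) K (tensor K V U)"
      by (rule tensor_sub_submodule[OF assms(2,4)]) auto
    show "tensor_map K V U e (\<lambda>u. u) (tens K V U v u) \<in> tensor_sub K V U {v \<in> carrier V. f v = \<zero>\<^bsub>W\<^esub>} (carrier U)"
      if "v \<in> carrier V" "u \<in> carrier U" for v u
      using that ek[OF that(1)] by (simp add: tensor_map_tens[OF _ _ _ _ _ lin_ident] assms e tens_in_tensor_sub)
  qed
  with t' show ?thesis by simp
qed

lemma tensor_map_right_kernel:
  assumes "field K" "module K V" "module K W" "module K U" "f \<in> lin K V W"
    and t: "t \<in> carrier (tensor K U V)" and 0: "tensor_map K U W (\<lambda>u. u) f t = \<zero>\<^bsub>tensor K U W\<^esub>"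
  shows "t \<in> tensor_sub K U V (carrier U) {v \<in> carrier V. f v = \<zero>\<^bsub>W\<^esub>}"
proof -
  interpret V: module K V by fact
  interpret W: module K W by fact
  obtain r where r: "r \<in> lin K W V" "\<And>v. v \<in> carrier V \<Longrightarrow> f (r (f v)) = f v"
    using lin_generalized_inverse[OF assms(1-3,5)] by blast
  note f = linD[OF assms(5)] and r' = linD[OF r(1)]
  define e where "e v = v \<ominus>\<^bsub>V\<^esub> r (f v)" for v
  have e: "e \<in> lin K V V" unfolding e_def by (intro lin_minus lin_ident lin_comp[OF assms(5)] r assms)
  note M = assms(2-4) tensor_module[OF assms(4,2)] tensor_module[OF assms(4,3)]
  have ek: "e v \<in> {v \<in> carrier V. f v = \<zero>\<^bsub>W\<^esub>}" if "v \<in> carrier V" for v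
    using that f r' r(2) lin_diff_eq[OF assms(2,3,5)] module_diff_eq_zero_iff[OF assms(3)] by (simp add: e_def)
  note lin = tensor_map_lin[OF assms(4,2,4,2) lin_ident e] tensor_map_lin[OF assms(4,2,4,3) lin_ident assms(5)]
    tensor_map_lin[OF assms(4,3,4,2) lin_ident r(1)]
  interpret T: module K "tensor K U V" by (rule M)
  have "t = tensor_map K U V (\<lambda>u. u) e t \<oplus>\<^bsub>tensor K U V\<^esub>
      tensor_map K U V (\<lambda>u. u) r (tensor_map K U W (\<lambda>u. u) f t)"
  proof (rule lin_eq_on_tensor[OF assms(4,2) M(4) lin_ident lin_add[OF M(4) lin(1) lin_comp[OF lin(2,3)]] _ t])
    fix u v assume vu: "u \<in> carrier U" "v \<in> carrier V"
    have "tens K U V u (e v) \<oplus>\<^bsub>tensor K U V\<^esub> tens K U V u (r (f v)) = tens K U V u (e v \<oplus>\<^bsub>V\<^esub> r (f v))"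
      using linD(2)[OF lin_tens_right[OF assms(4,2) vu(1) lin_ident]] vu f r' ek by simp
    also have "e v \<oplus>\<^bsub>V\<^esub> r (f v) = v" using vu f r' by (simp add: e_def a_minus_def V.M.a_assoc V.M.l_neg)
    finally show "tens K U V u v = tensor_map K U V (\<lambda>u. u) e (tens K U V u v) \<oplus>\<^bsub>tensor K U V\<^esub>
      tensor_map K U V (\<lambda>u. u) r (tensor_map K U W (\<lambda>u. u) f (tens K U V u v))"
      using vu f by (simp add: tensor_map_tens[OF _ _ _ _ lin_ident] assms r e)
  qed
  also have "\<dots> = tensor_map K U V (\<lambda>u. u) e t"
    using linD(1)[OF lin(1) t] lin_zero_neg(1)[OF M(5,4) lin(3)] by (simp add: 0)
  finally have t': "t = tensor_map K U V (\<lambda>u. u) e t" .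
  have "tensor_map K U V (\<lambda>u. u) e t \<in> tensor_sub K U V (carrier U) {v \<in> carrier V. f v = \<zero>\<^bsub>W\<^esub>}"
  proof (rule lin_tensor_into[OF assms(4,2) M(4) lin(1) _ _ t])
    show "submodule (tensor_sub K U V (carrier U) {v \<in> carrier V. f v = \<zero>\<^bsub>W\<^esub>}) K (tensor K U V)"
      by (rule tensor_sub_submodule[OF assms(4,2)]) auto
    show "tensor_map K U V (\<lambda>u. u) e (tens K U V u v) \<in> tensor_sub K U V (carrier U) {v \<in> carrier V. f v = \<zero>\<^bsub>W\<^esub>}"
      if "u \<in> carrier U" "v \<in> carrier V" for v u
      using that ek[OF that(2)] by (simp add: tensor_map_tens[OF _ _ _ _ lin_ident] assms e tens_in_tensor_sub)
  qed
  with t' show ?thesis by simp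
qed

lemma submodule_zero: "Module.module K V \<Longrightarrow> submodule {\<zero>\<^bsub>V\<^esub>} K V"
proof -
  assume V: "Module.module K V"
  then interpret V: Module.module K V .
  show ?thesis by (rule submodule_intro[OF V]) auto
qed

lemma tensor_map_left_kernel_iff:
  assumes "field K" "module K V" "module K W" "module K U" "f \<in> lin K V W"
    and t: "t \<in> carrier (tensor K V U)"
  shows "tensor_map K W U f (\<lambda>u. u) t = \<zero>\<^bsub>tensor K W U\<^esub> \<longleftrightarrow>
    t \<in> tensor_sub K V U {v \<in> carrier V. f v = \<zero>\<^bsub>W\<^esub>} (carrier U)"
proof
  assume *: "t \<in> tensor_sub K V U {v \<in> carrier V. f v = \<zero>\<^bsub>W\<^esub>} (carrier U)"
  note T = tensor_module[OF assms(3,4)]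
  have "tensor_map K W U f (\<lambda>u. u) t \<in> {\<zero>\<^bsub>tensor K W U\<^esub>}"
  proof (rule lin_tensor_sub[OF assms(2,4) T tensor_map_lin[OF assms(2,4,3,4,5) lin_ident] submodule_zero[OF T] _ _ _ *])
    fix v u assume vu: "v \<in> {v \<in> carrier V. f v = \<zero>\<^bsub>W\<^esub>}" "u \<in> carrier U"
    then show "tensor_map K W U f (\<lambda>u. u) (tens K V U v u) \<in> {\<zero>\<^bsub>tensor K W U\<^esub>}"
      using lin_zero_neg(1)[OF assms(3) T lin_tens_left[OF assms(3,4) lin_ident vu(2)]]
      by (simp add: tensor_map_tens[OF assms(2,4,3,4,5) lin_ident])
  qed auto
  then show "tensor_map K W U f (\<lambda>u. u) t = \<zero>\<^bsub>tensor K W U\<^esub>" by simp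
qed (rule tensor_map_left_kernel[OF assms])

lemma tensor_map_right_kernel_iff:
  assumes "field K" "module K V" "module K W" "module K U" "f \<in> lin K V W"
    and t: "t \<in> carrier (tensor K U V)"
  shows "tensor_map K U W (\<lambda>u. u) f t = \<zero>\<^bsub>tensor K U W\<^esub> \<longleftrightarrow>
    t \<in> tensor_sub K U V (carrier U) {v \<in> carrier V. f v = \<zero>\<^bsub>W\<^esub>}"
proof
  assume *: "t \<in> tensor_sub K U V (carrier U) {v \<in> carrier V. f v = \<zero>\<^bsub>W\<^esub>}"
  note T = tensor_module[OF assms(4,3)]
  have "tensor_map K U W (\<lambda>u. u) f t \<in> {\<zero>\<^bsub>tensor K U W\<^esub>}"
  proof (rule lin_tensor_sub[OF assms(4,2) T tensor_map_lin[OF assms(4,2,4,3) lin_ident assms(5)] submodule_zero[OF T] _ _ _ *])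
    fix u v assume vu: "u \<in> carrier U" "v \<in> {v \<in> carrier V. f v = \<zero>\<^bsub>W\<^esub>}"
    then show "tensor_map K U W (\<lambda>u. u) f (tens K U V u v) \<in> {\<zero>\<^bsub>tensor K U W\<^esub>}"
      using lin_zero_neg(1)[OF assms(3) T lin_tens_right[OF assms(4,3) vu(1) lin_ident]]
      by (simp add: tensor_map_tens[OF assms(4,2,4,3) lin_ident assms(5)])
  qed auto
  then show "tensor_map K U W (\<lambda>u. u) f t = \<zero>\<^bsub>tensor K U W\<^esub>" by simp
qed (rule tensor_map_right_kernel[OF assms])

lemma quot_space_proj_eq_zero_iff:
  assumes "module K V" "submodule N K V" "v \<in> carrier V"
  shows "N +>\<^bsub>V\<^esub> v = \<zero>\<^bsub>quot_space K V N\<^esub> \<longleftrightarrow> v \<in> N"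
proof -
  interpret N: abelian_subgroup N V by (rule submodule_abelian_subgroup) fact+
  show ?thesis using N.a_rcos_self[OF assms(3)] N.a_rcos_const by (auto simp: quot_space_simps)
qed

lemma quot_space_proj_eq_iff:
  fixes K :: "'k ring" and V :: "('k, 'a) module"
  assumes "module K V" "submodule N K V" "v \<in> carrier V" "w \<in> carrier V"
  shows "N +>\<^bsub>V\<^esub> v = N +>\<^bsub>V\<^esub> w \<longleftrightarrow> v \<ominus>\<^bsub>V\<^esub> w \<in> N"
proof -
  interpret V: module K V by fact
  note Q = quot_space_module[OF assms(1,2)] and pr = quot_space_proj[OF assms(1,2)]
  have "N +>\<^bsub>V\<^esub> v = N +>\<^bsub>V\<^esub> w \<longleftrightarrow> (N +>\<^bsub>V\<^esub> v) \<ominus>\<^bsub>quot_space K V N\<^esub> (N +>\<^bsub>V\<^esub> w) = \<zero>\<^bsub>quot_space K V N\<^esub>"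
    by (rule module_diff_eq_zero_iff[OF Q linD(1)[OF pr assms(3)] linD(1)[OF pr assms(4)], symmetric])
  also have "(N +>\<^bsub>V\<^esub> v) \<ominus>\<^bsub>quot_space K V N\<^esub> (N +>\<^bsub>V\<^esub> w) = N +>\<^bsub>V\<^esub> (v \<ominus>\<^bsub>V\<^esub> w)"
    by (rule lin_diff_eq[OF assms(1) Q pr assms(3,4), symmetric])
  also have "\<dots> = \<zero>\<^bsub>quot_space K V N\<^esub> \<longleftrightarrow> v \<ominus>\<^bsub>V\<^esub> w \<in> N"
    by (rule quot_space_proj_eq_zero_iff[OF assms(1,2)]) (use assms in simp)
  finally show ?thesis .
qed

section \<open>Equalizers and coequalizers in terms of subspaces\<close>

text \<open>The universal property pins down a subspace exactly, not only up to isomorphism, because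
  the map is the inclusion.\<close>

lemma is_equalizer_subspace_iff:
  fixes X :: "('k, 'a) module"
  assumes "module K X" "module K Y" "f \<in> lin K X Y" "g \<in> lin K X Y" "submodule B K X"
  shows "is_equalizer K (X\<lparr>carrier := B\<rparr>) X Y (\<lambda>b. b) f g \<longleftrightarrow> B = {x \<in> carrier X. f x = g x}"
    (is "?L \<longleftrightarrow> B = ?C")
proof
  interpret X: module K X by fact
  note B = submodule_closed[OF assms(1,5)]
  note f = linD[OF assms(3)] lin_zero_neg[OF assms(1-3)]
    and g = linD[OF assms(4)] lin_zero_neg[OF assms(1,2,4)]
  {
    assume L: ?L
    have sub: "submodule ?C K X"
      by (rule submodule_intro[OF assms(1)]) (use f g in auto)
    \<comment> \<open>The solution set is itself a test space of the type fixed in the definition.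
      Its inclusion must factor through \<open>B\<close>, and the factor u is again an
      inclusion.\<close>
    define XC where "XC = X\<lparr>carrier := ?C\<rparr>"
    have XC: "module K XC" unfolding XC_def by (rule submodule.submodule_is_module[OF sub assms(1)])
    have i: "(\<lambda>x. x) \<in> lin K XC X" by (rule linI) (auto simp: XC_def)
    have "\<forall>z \<in> carrier XC. f z = g z" by (simp add: XC_def)
    then have "\<exists>!u. u \<in> lin K XC (X\<lparr>carrier := B\<rparr>) \<inter> extensional (carrier XC) \<and>
        (\<forall>z\<in>carrier XC. u z = z)"
      using L[unfolded is_equalizer_def, THEN conjunct2, THEN conjunct2, rule_format, OF XC i] by simp
    then obtain u where u: "u \<in> lin K XC (X\<lparr>carrier := B\<rparr>)" "\<And>z. z \<in> carrier XC \<Longrightarrow> u z = z"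
      by blast
    have "?C \<subseteq> B" using linD(1)[OF u(1)] u(2) by (auto simp: XC_def)
    moreover have "B \<subseteq> ?C" using L B(1) by (auto simp: is_equalizer_def)
    ultimately show "B = ?C" by blast
  next
    assume BC: "B = ?C"
    show ?L unfolding is_equalizer_def
    proof (intro conjI allI impI)
      show "(\<lambda>b. b) \<in> lin K (X\<lparr>carrier := B\<rparr>) X" by (rule linI) (auto simp: B)
      show "\<forall>z\<in>carrier (X\<lparr>carrier := B\<rparr>). f z = g z" by (simp add: BC)
      fix T :: "('k, 'a) module" and t
      assume T: "module K T" "t \<in> lin K T X" "\<forall>z\<in>carrier T. f (t z) = g (t z)"
      show "\<exists>!u. u \<in> lin K T (X\<lparr>carrier := B\<rparr>) \<inter> extensional (carrier T) \<and> (\<forall>z\<in>carrier T. u z = t z)"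
      proof (rule ex1I[of _ "restrict t (carrier T)"])
        have "t \<in> lin K T (X\<lparr>carrier := B\<rparr>)"
          by (rule linI) (use linD[OF T(2)] T(3) in \<open>auto simp: BC\<close>)
        then show "restrict t (carrier T) \<in> lin K T (X\<lparr>carrier := B\<rparr>) \<inter> extensional (carrier T) \<and>
            (\<forall>z\<in>carrier T. restrict t (carrier T) z = t z)"
          using lin_cong[OF _ T(1), of t _ "restrict t (carrier T)"] by simp
        fix u assume "u \<in> lin K T (X\<lparr>carrier := B\<rparr>) \<inter> extensional (carrier T) \<and> (\<forall>z\<in>carrier T. u z = t z)"
        then show "u = restrict t (carrier T)"
          by (intro extensionalityI[of _ "carrier T"]) auto
      qed
    qed
  }
qed

text \<open>A coequalizer of linear maps is the cokernel of their difference, and a quotient map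
  determines its kernel.\<close>

lemma is_coequalizer_quot_iff:
  fixes Y :: "('k, 'a) module"
  assumes "module K X" "module K Y" "f \<in> lin K X Y" "g \<in> lin K X Y" "submodule I K Y"
  shows "is_coequalizer K X Y (quot_space K Y I) f g (\<lambda>y. I +>\<^bsub>Y\<^esub> y) \<longleftrightarrow>
    I = (\<lambda>x. f x \<ominus>\<^bsub>Y\<^esub> g x) ` carrier X" (is "?L \<longleftrightarrow> I = ?D")
proof
  interpret X: module K X by fact
  interpret Y: module K Y by fact
  note f = linD[OF assms(3)] and g = linD[OF assms(4)]
  note I = submodule_closed[OF assms(2,5)]
  note Q = quot_space_module[OF assms(2,5)] and pr = quot_space_proj[OF assms(2,5)]
  have D: "submodule ?D K Y"
    by (rule image_submodule[OF assms(1,2) lin_minus[OF assms(2-4)]]) (rule X.carrier_is_submodule)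
  have surj: "\<exists>y \<in> carrier Y. z = I +>\<^bsub>Y\<^esub> y" if "z \<in> carrier (quot_space K Y I)" for z
    using that by (auto simp: quot_space_simps A_RCOSETS_def')
  {
    assume L: ?L
    have DI: "?D \<subseteq> I"
      using L f(1) g(1) quot_space_proj_eq_iff[OF assms(2,5)] by (auto simp: is_coequalizer_def)
    \<comment> \<open>The quotient by the image \<open>?D\<close> is the test space. The induced map
      forces every element that dies modulo \<open>I\<close> to die modulo
      \<open>?D\<close>.\<close>
    have "\<forall>x\<in>carrier X. ?D +>\<^bsub>Y\<^esub> f x = ?D +>\<^bsub>Y\<^esub> g x"
      using f(1) g(1) quot_space_proj_eq_iff[OF assms(2) D] by auto
    then have "\<exists>!u. u \<in> lin K (quot_space K Y I) (quot_space K Y ?D) \<inter> extensional (carrier (quot_space K Y I)) \<and>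
        (\<forall>y\<in>carrier Y. u (I +>\<^bsub>Y\<^esub> y) = ?D +>\<^bsub>Y\<^esub> y)"
      using L[unfolded is_coequalizer_def, THEN conjunct2, THEN conjunct2, rule_format,
          OF quot_space_module[OF assms(2) D] quot_space_proj[OF assms(2) D]] by simp
    then obtain u where u: "\<And>y. y \<in> carrier Y \<Longrightarrow> u (I +>\<^bsub>Y\<^esub> y) = ?D +>\<^bsub>Y\<^esub> y" by blast
    have "I \<subseteq> ?D"
    proof
      fix y assume y: "y \<in> I"
      have y': "y \<in> carrier Y" by (rule I(1)[OF y])
      have "I +>\<^bsub>Y\<^esub> y = I +>\<^bsub>Y\<^esub> \<zero>\<^bsub>Y\<^esub>" using y y' by (subst quot_space_proj_eq_iff[OF assms(2,5)]) (simp_all add: module_diff_zero[OF assms(2)])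
      then have "?D +>\<^bsub>Y\<^esub> y = ?D +>\<^bsub>Y\<^esub> \<zero>\<^bsub>Y\<^esub>" using u[OF y'] u[of "\<zero>\<^bsub>Y\<^esub>"] by simp
      then have "y \<ominus>\<^bsub>Y\<^esub> \<zero>\<^bsub>Y\<^esub> \<in> ?D" by (subst quot_space_proj_eq_iff[OF assms(2) D, symmetric]) (use y' in auto)
      then show "y \<in> ?D" using y' module_diff_zero[OF assms(2)] by simp
    qed
    then show "I = ?D" using DI by blast
  next
    assume ID: "I = ?D"
    show ?L unfolding is_coequalizer_def
    proof (intro conjI allI impI ballI)
      show "(\<lambda>y. I +>\<^bsub>Y\<^esub> y) \<in> lin K Y (quot_space K Y I)" by (rule pr)
      show "I +>\<^bsub>Y\<^esub> f x = I +>\<^bsub>Y\<^esub> g x" if "x \<in> carrier X" for x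
        using that f(1) g(1) by (subst quot_space_proj_eq_iff[OF assms(2,5)]) (auto simp: ID)
      fix T :: "('k, 'a set) module" and t
      assume T: "module K T" "t \<in> lin K Y T" "\<forall>x\<in>carrier X. t (f x) = t (g x)"
      have tI: "t y = \<zero>\<^bsub>T\<^esub>" if "y \<in> I" for y
      proof -
        have "y \<in> ?D" using that by (simp only: ID)
        then obtain x where x: "x \<in> carrier X" "y = f x \<ominus>\<^bsub>Y\<^esub> g x" by (elim imageE)
        have "t y = t (f x) \<ominus>\<^bsub>T\<^esub> t (g x)" unfolding x(2) by (rule lin_diff_eq[OF assms(2) T(1,2) f(1) g(1)]) (rule x)+
        then show ?thesis using T(3) x(1) linD(1)[OF T(2) g(1)[OF x(1)]] module_diff_eq_zero_iff[OF T(1)] by simp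
      qed
      have "t x = t y" if xy: "x \<in> carrier Y" "y \<in> carrier Y" "I +>\<^bsub>Y\<^esub> x = I +>\<^bsub>Y\<^esub> y" for x y
      proof -
        have "x \<ominus>\<^bsub>Y\<^esub> y \<in> I" using xy(3) by (simp only: quot_space_proj_eq_iff[OF assms(2,5) xy(1,2)])
        then have "t (x \<ominus>\<^bsub>Y\<^esub> y) = \<zero>\<^bsub>T\<^esub>" by (rule tI)
        then show ?thesis
          using lin_diff_eq[OF assms(2) T(1,2) xy(1,2)] module_diff_eq_zero_iff[OF T(1)] linD(1)[OF T(2)] xy by simp
      qed
      moreover have "(\<lambda>y. I +>\<^bsub>Y\<^esub> y) ` carrier Y = carrier (quot_space K Y I)"
        using surj linD(1)[OF pr] by blast
      ultimately obtain u where u: "u \<in> lin K (quot_space K Y I) T \<inter> extensional (carrier (quot_space K Y I))"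
        "\<And>y. y \<in> carrier Y \<Longrightarrow> u (I +>\<^bsub>Y\<^esub> y) = t y"
        using lin_factor[OF assms(2) pr _ T(2)] by blast
      show "\<exists>!u. u \<in> lin K (quot_space K Y I) T \<inter> extensional (carrier (quot_space K Y I)) \<and>
          (\<forall>y\<in>carrier Y. u (I +>\<^bsub>Y\<^esub> y) = t y)"
      proof (rule ex1I[of _ u])
        fix w assume w: "w \<in> lin K (quot_space K Y I) T \<inter> extensional (carrier (quot_space K Y I)) \<and>
          (\<forall>y\<in>carrier Y. w (I +>\<^bsub>Y\<^esub> y) = t y)"
        show "w = u"
        proof (rule extensionalityI[of _ "carrier (quot_space K Y I)"])
          fix z assume "z \<in> carrier (quot_space K Y I)"
          then obtain y where "y \<in> carrier Y" "z = I +>\<^bsub>Y\<^esub> y" using surj by blast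
          then show "w z = u z" using u(2) w by simp
        qed (use u w in auto)
      qed (use u in auto)
    qed
  }
qed

section \<open>Sweedler notation\<close>

context hopf_algebra
begin

abbreviation "HH \<equiv> tensor K H H"

lemma HH_module: "Module.module K HH"
  by (rule tensor_module[OF module module])

interpretation K: field K by (rule field)
interpretation H: ring H by (rule ring)
interpretation Hm: Module.module K H by (rule module)
interpretation HHm: Module.module K HH by (rule HH_module)

lemma mult_bilin: "bilin K H H H (mult H)"
  by (intro bilinI linI) (simp_all add: H.l_distr H.r_distr smult_mult_left smult_mult_right)

text \<open>\<open>sweedler Z g x\<close> is \<open>\<Sum> g x\<^sub>1 x\<^sub>2\<close> for a bilinear map \<open>g\<close> into \<open>Z\<close>.\<close>

definition sweedler :: "('k, 'z) module \<Rightarrow> ('h \<Rightarrow> 'h \<Rightarrow> 'z) \<Rightarrow> 'h \<Rightarrow> 'z" where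
  "sweedler Z g x = tensor_lift K Z g (\<Delta> x)"

lemma comult_closed: "x \<in> carrier H \<Longrightarrow> \<Delta> x \<in> carrier HH"
  by (rule linD(1)[OF comult_lin])

lemma antipode_closed: "x \<in> carrier H \<Longrightarrow> S x \<in> carrier H"
  by (rule linD(1)[OF antipode_lin])

lemma counit_closed: "x \<in> carrier H \<Longrightarrow> \<epsilon> x \<in> carrier K"
  using linD(1)[OF counit_lin] by (simp add: ground_space_def)

lemma counit_one: "\<epsilon> \<one>\<^bsub>H\<^esub> = \<one>\<^bsub>K\<^esub>"
  by (rule ring_hom_one[OF counit_hom])

lemma counit_mult: "x \<in> carrier H \<Longrightarrow> y \<in> carrier H \<Longrightarrow> \<epsilon> (x \<otimes>\<^bsub>H\<^esub> y) = \<epsilon> x \<otimes>\<^bsub>K\<^esub> \<epsilon> y"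
  by (rule ring_hom_mult[OF counit_hom])

lemma comult_mult: "x \<in> carrier H \<Longrightarrow> y \<in> carrier H \<Longrightarrow> \<Delta> (x \<otimes>\<^bsub>H\<^esub> y) = \<Delta> x \<otimes>\<^bsub>HH\<^esub> \<Delta> y"
  by (rule ring_hom_mult[OF comult_hom])

lemma comult_one: "\<Delta> \<one>\<^bsub>H\<^esub> = tens K H H \<one>\<^bsub>H\<^esub> \<one>\<^bsub>H\<^esub>"
  using ring_hom_one[OF comult_hom] by (simp add: tensor_def Let_def)

lemmas lin_comult = lin_comp[OF _ comult_lin]
lemmas lin_antipode = lin_comp[OF _ antipode_lin]
lemmas lin_counit = lin_comp[OF _ counit_lin]
lemmas lin_mult_left = bilin_left[OF mult_bilin]
lemmas lin_mult_right = bilin_right[OF mult_bilin]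

lemma lin_sweedler_arg:
  "Module.module K Z \<Longrightarrow> bilin K H H Z g \<Longrightarrow> f \<in> lin K X H \<Longrightarrow> (\<lambda>x. sweedler Z g (f x)) \<in> lin K X Z"
  unfolding sweedler_def by (rule lin_tensor_lift[OF module module _ _ lin_comult])

lemma lin_sweedler_param:
  assumes "Module.module K Z" "Module.module K X"
    and "\<And>x. x \<in> carrier X \<Longrightarrow> bilin K H H Z (F x)"
    and "\<And>a b. a \<in> carrier H \<Longrightarrow> b \<in> carrier H \<Longrightarrow> (\<lambda>x. F x a b) \<in> lin K X Z"
    and "y \<in> carrier H"
  shows "(\<lambda>x. sweedler Z (F x) y) \<in> lin K X Z"
  unfolding sweedler_def by (rule lin_tensor_lift_param[OF module module]) (use assms comult_closed in auto)

lemma sweedler_cong: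
  assumes "Module.module K Z" "bilin K H H Z g"
    "\<And>a b. a \<in> carrier H \<Longrightarrow> b \<in> carrier H \<Longrightarrow> g a b = g' a b" "x \<in> carrier H"
  shows "sweedler Z g x = sweedler Z g' x"
  unfolding sweedler_def
  by (rule tensor_lift_cong[OF module module assms(1-3) comult_closed[OF assms(4)]])

lemma lin_of_sweedler:
  assumes "Module.module K Z" "Module.module K Z'" "f \<in> lin K Z Z'" "bilin K H H Z g" "x \<in> carrier H"
  shows "f (sweedler Z g x) = sweedler Z' (\<lambda>a b. f (g a b)) x"
  unfolding sweedler_def
  by (rule lin_tensor_lift_eq[OF module module assms(1-4) comult_closed[OF assms(5)]])

text \<open>The hypotheses say that \<open>g\<close> is trilinear, so it induces a linear map
  \<open>G\<close> on H \<otimes> (H \<otimes> H). Applying \<open>G\<close> to the two sides of the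
  axiom \<open>coassoc\<close> gives the two nested sums.\<close>

lemma sweedler_coassoc:
  assumes Z: "Module.module K Z"
    and b1: "\<And>a. a \<in> carrier H \<Longrightarrow> bilin K H H Z (g a)"
    and b2: "\<And>b c. b \<in> carrier H \<Longrightarrow> c \<in> carrier H \<Longrightarrow> (\<lambda>a. g a b c) \<in> lin K H Z"
    and x: "x \<in> carrier H"
  shows "sweedler Z (\<lambda>a b. sweedler Z (\<lambda>c d. g c d b) a) x = sweedler Z (\<lambda>a b. sweedler Z (g a) b) x"
proof -
  note M = module module
  define G where "G = tensor_lift K Z (\<lambda>u s. tensor_lift K Z (g u) s)"
  have bG: "bilin K H HH Z (\<lambda>u s. tensor_lift K Z (g u) s)"
    by (intro bilinI lin_tensor_lift_param[OF M] tensor_lift_universal(1) M Z b1 b2)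
  note G = tensor_lift_universal[OF module HH_module Z bG, folded G_def]
  have b3: "bilin K H H Z (\<lambda>c d. g c d b)" if "b \<in> carrier H" for b
    using that by (intro bilinI b2 bilin_left[OF b1 lin_ident])
  have bL: "bilin K H H Z (\<lambda>a b. sweedler Z (\<lambda>c d. g c d b) a)"
    by (intro bilinI lin_sweedler_arg lin_sweedler_param Z M b3 lin_ident bilin_right[OF b1])
  have bR: "bilin K H H Z (\<lambda>a b. sweedler Z (g a) b)"
    by (intro bilinI lin_sweedler_arg lin_sweedler_param Z M b1 lin_ident b2)
  have HHH: "Module.module K (tensor K H HH)" "Module.module K (tensor K HH H)" by (intro tensor_module M HH_module)+
  have "G (tensor_assoc K H H H (tensor_map K HH H \<Delta> (\<lambda>y. y) (\<Delta> x))) = tensor_lift K Z (\<lambda>a b. sweedler Z (\<lambda>c d. g c d b) a) (\<Delta> x)"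
  proof (rule tensor_lift_eqI[OF M Z _ bL _ comult_closed[OF x], where f = "\<lambda>t. G (tensor_assoc K H H H (tensor_map K HH H \<Delta> (\<lambda>y. y) t))"])
    show "(\<lambda>t. G (tensor_assoc K H H H (tensor_map K HH H \<Delta> (\<lambda>y. y) t))) \<in> lin K HH Z"
      by (intro lin_comp[OF _ G(1)] lin_comp[OF _ tensor_assoc_lin] tensor_map_lin M HH_module comult_lin lin_ident)
    fix a b assume ab: "a \<in> carrier H" "b \<in> carrier H"
    have "G (tensor_assoc K H H H (tens K HH H (\<Delta> a) b)) = sweedler Z (\<lambda>c d. G (tens K H HH c (tens K H H d b))) a"
      unfolding sweedler_def tensor_assoc_tens2[OF M module comult_closed[OF ab(1)] ab(2)]
      by (rule lin_tensor_lift_eq[OF M HHH(1) Z G(1) tensor_assoc_inner[OF M module ab(2)] comult_closed[OF ab(1)]])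
    also have "\<dots> = sweedler Z (\<lambda>c d. g c d b) a"
      by (rule sweedler_cong[OF Z _ _ ab(1), symmetric, OF b3[OF ab(2)]])
        (simp add: ab G tens_closed M tensor_lift_universal(2)[OF M Z b1])
    finally show "G (tensor_assoc K H H H (tensor_map K HH H \<Delta> (\<lambda>y. y) (tens K H H a b))) = sweedler Z (\<lambda>c d. g c d b) a"
      using ab by (simp add: tensor_map_tens[OF _ _ _ _ comult_lin lin_ident] M HH_module)
  qed
  moreover have "G (tensor_map K H HH (\<lambda>y. y) \<Delta> (\<Delta> x)) = tensor_lift K Z (\<lambda>a b. sweedler Z (g a) b) (\<Delta> x)"
  proof (rule tensor_lift_eqI[OF M Z _ bR _ comult_closed[OF x], where f = "\<lambda>t. G (tensor_map K H HH (\<lambda>y. y) \<Delta> t)"])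
    show "(\<lambda>t. G (tensor_map K H HH (\<lambda>y. y) \<Delta> t)) \<in> lin K HH Z"
      by (intro lin_comp[OF _ G(1)] tensor_map_lin M HH_module comult_lin lin_ident)
    fix a b assume ab: "a \<in> carrier H" "b \<in> carrier H"
    then show "G (tensor_map K H HH (\<lambda>y. y) \<Delta> (tens K H H a b)) = sweedler Z (g a) b"
      by (simp add: tensor_map_tens[OF _ _ _ _ lin_ident comult_lin] M HH_module G comult_closed sweedler_def)
  qed
  ultimately show ?thesis using coassoc[OF x] by (simp add: sweedler_def)
qed

text \<open>A linear \<open>f\<close> is pulled through the axiom for the identity. The general
  \<open>f\<close> is what lets an inner factor of a longer Sweedler sum collapse; the next three
  lemmas serve the same purpose.\<close>

lemma sweedler_counit_left:
  assumes "Module.module K Z" "f \<in> lin K H Z" "x \<in> carrier H"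
  shows "sweedler Z (\<lambda>a b. \<epsilon> a \<odot>\<^bsub>Z\<^esub> f b) x = f x"
proof -
  have b: "bilin K H H H (\<lambda>y z. \<epsilon> y \<odot>\<^bsub>H\<^esub> z)"
    by (intro bilinI lin_scalar lin_smult module lin_ident counit_lin counit_closed)
  have bZ: "bilin K H H Z (\<lambda>y z. \<epsilon> y \<odot>\<^bsub>Z\<^esub> f z)"
    by (intro bilinI lin_scalar lin_smult assms lin_ident counit_lin counit_closed linD(1)[OF assms(2)])
  have "f x = f (sweedler H (\<lambda>y z. \<epsilon> y \<odot>\<^bsub>H\<^esub> z) x)" using counit_left[OF assms(3)] by (simp add: sweedler_def)
  also have "\<dots> = sweedler Z (\<lambda>y z. f (\<epsilon> y \<odot>\<^bsub>H\<^esub> z)) x"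
    by (rule lin_of_sweedler[OF module assms(1,2) b assms(3)])
  also have "\<dots> = sweedler Z (\<lambda>a b. \<epsilon> a \<odot>\<^bsub>Z\<^esub> f b) x"
    by (rule sweedler_cong[symmetric, OF assms(1) bZ _ assms(3)]) (simp add: linD(3)[OF assms(2)] counit_closed)
  finally show ?thesis by simp
qed

lemma sweedler_counit_right:
  assumes "Module.module K Z" "f \<in> lin K H Z" "x \<in> carrier H"
  shows "sweedler Z (\<lambda>a b. \<epsilon> b \<odot>\<^bsub>Z\<^esub> f a) x = f x"
proof -
  have b: "bilin K H H H (\<lambda>y z. \<epsilon> z \<odot>\<^bsub>H\<^esub> y)"
    by (intro bilinI lin_scalar lin_smult module lin_ident counit_lin counit_closed)
  have bZ: "bilin K H H Z (\<lambda>y z. \<epsilon> z \<odot>\<^bsub>Z\<^esub> f y)"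
    by (intro bilinI lin_scalar lin_smult assms lin_ident counit_lin counit_closed linD(1)[OF assms(2)])
  have "f x = f (sweedler H (\<lambda>y z. \<epsilon> z \<odot>\<^bsub>H\<^esub> y) x)" using counit_right[OF assms(3)] by (simp add: sweedler_def)
  also have "\<dots> = sweedler Z (\<lambda>y z. f (\<epsilon> z \<odot>\<^bsub>H\<^esub> y)) x"
    by (rule lin_of_sweedler[OF module assms(1,2) b assms(3)])
  also have "\<dots> = sweedler Z (\<lambda>a b. \<epsilon> b \<odot>\<^bsub>Z\<^esub> f a) x"
    by (rule sweedler_cong[symmetric, OF assms(1) bZ _ assms(3)]) (simp add: linD(3)[OF assms(2)] counit_closed)
  finally show ?thesis by simp
qed

lemma sweedler_antipode_left:
  assumes "Module.module K Z" "f \<in> lin K H Z" "x \<in> carrier H"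
  shows "sweedler Z (\<lambda>a b. f (S a \<otimes>\<^bsub>H\<^esub> b)) x = \<epsilon> x \<odot>\<^bsub>Z\<^esub> f \<one>\<^bsub>H\<^esub>"
proof -
  have b: "bilin K H H H (\<lambda>y z. S y \<otimes>\<^bsub>H\<^esub> z)"
    by (intro bilinI lin_mult_left lin_mult_right lin_ident antipode_lin antipode_closed)
  have "f (sweedler H (\<lambda>y z. S y \<otimes>\<^bsub>H\<^esub> z) x) = \<epsilon> x \<odot>\<^bsub>Z\<^esub> f \<one>\<^bsub>H\<^esub>"
    using antipode_left[OF assms(3)] linD(3)[OF assms(2) counit_closed[OF assms(3)]] by (simp add: sweedler_def)
  then show ?thesis by (simp add: lin_of_sweedler[OF module assms(1,2) b assms(3)])
qed

lemma sweedler_antipode_right: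
  assumes "Module.module K Z" "f \<in> lin K H Z" "x \<in> carrier H"
  shows "sweedler Z (\<lambda>a b. f (a \<otimes>\<^bsub>H\<^esub> S b)) x = \<epsilon> x \<odot>\<^bsub>Z\<^esub> f \<one>\<^bsub>H\<^esub>"
proof -
  have b: "bilin K H H H (\<lambda>y z. y \<otimes>\<^bsub>H\<^esub> S z)"
    by (intro bilinI lin_mult_left lin_mult_right lin_ident antipode_lin antipode_closed)
  have "f (sweedler H (\<lambda>y z. y \<otimes>\<^bsub>H\<^esub> S z) x) = \<epsilon> x \<odot>\<^bsub>Z\<^esub> f \<one>\<^bsub>H\<^esub>"
    using antipode_right[OF assms(3)] linD(3)[OF assms(2) counit_closed[OF assms(3)]] by (simp add: sweedler_def)
  then show ?thesis by (simp add: lin_of_sweedler[OF module assms(1,2) b assms(3)])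
qed

section \<open>The algebra H \<otimes> H and further rules for Sweedler sums\<close>

lemma tens_mult_bilin:
  assumes "v \<in> carrier H" "w \<in> carrier H"
  shows "bilin K H H HH (\<lambda>v' w'. tens K H H (v \<otimes>\<^bsub>H\<^esub> v') (w \<otimes>\<^bsub>H\<^esub> w'))"
  using assms by (intro bilinI lin_tens_left lin_tens_right lin_mult_right lin_ident module) auto

lemma HH_mult_eq:
  "X \<otimes>\<^bsub>HH\<^esub> Y = tensor_lift K HH (\<lambda>v w. tensor_lift K HH (\<lambda>v' w'. tens K H H (v \<otimes>\<^bsub>H\<^esub> v') (w \<otimes>\<^bsub>H\<^esub> w')) Y) X"
proof -
  \<comment> \<open>The product was defined by lifts into \<open>tensor_space\<close>. A lift sees
    only the linear structure of its target, and that is shared by \<open>tensor\<close>.\<close>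
  have "tensor_lift K (tensor_space K H H) = (tensor_lift K HH :: ('h \<Rightarrow> 'h \<Rightarrow> _) \<Rightarrow> _)"
    by (intro ext) (simp add: tensor_lift_def finsum_def tensor_sel)
  then show ?thesis by (simp add: tensor_def Let_def)
qed

lemma HH_mult_outer_bilin:
  assumes "Y \<in> carrier HH"
  shows "bilin K H H HH (\<lambda>v w. tensor_lift K HH (\<lambda>v' w'. tens K H H (v \<otimes>\<^bsub>H\<^esub> v') (w \<otimes>\<^bsub>H\<^esub> w')) Y)"
  by (intro bilinI lin_tensor_lift_param[OF module module] HH_module module tens_mult_bilin assms)
    (auto intro!: lin_tens_left lin_tens_right lin_mult_left lin_ident module)

lemma HH_mult_bilin: "bilin K HH HH HH (mult HH)"
proof (rule bilinI)
  show "(\<lambda>X. X \<otimes>\<^bsub>HH\<^esub> Y) \<in> lin K HH HH" if "Y \<in> carrier HH" for Y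
    unfolding HH_mult_eq using that by (intro tensor_lift_universal(1) HH_module module HH_mult_outer_bilin)
  show "(\<lambda>Y. X \<otimes>\<^bsub>HH\<^esub> Y) \<in> lin K HH HH" if "X \<in> carrier HH" for X
    unfolding HH_mult_eq
    by (intro lin_tensor_lift_param[OF module module] HH_module HH_mult_outer_bilin that
        tensor_lift_universal(1) module tens_mult_bilin)
qed

lemma tens_mult:
  assumes "a \<in> carrier H" "b \<in> carrier H" "c \<in> carrier H" "d \<in> carrier H"
  shows "tens K H H a b \<otimes>\<^bsub>HH\<^esub> tens K H H c d = tens K H H (a \<otimes>\<^bsub>H\<^esub> c) (b \<otimes>\<^bsub>H\<^esub> d)"
proof -
  have cd: "tens K H H c d \<in> carrier HH" by (intro tens_closed module assms)
  show ?thesis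
    unfolding HH_mult_eq
    by (simp add: tensor_lift_universal(2)[OF module module HH_module HH_mult_outer_bilin[OF cd]] assms
        tensor_lift_universal(2)[OF module module HH_module tens_mult_bilin])
qed

lemmas lin_HH_mult_left = bilin_left[OF HH_mult_bilin]
lemmas lin_HH_mult_right = bilin_right[OF HH_mult_bilin]
lemmas HH_mult_closed = bilin_closed[OF HH_mult_bilin]

text \<open>Both sides are linear in each factor. The factors are replaced by pure tensors one at a
  time, where associativity in \<open>H\<close> applies.\<close>

lemma HH_mult_assoc:
  assumes "X \<in> carrier HH" "Y \<in> carrier HH" "Z \<in> carrier HH"
  shows "(X \<otimes>\<^bsub>HH\<^esub> Y) \<otimes>\<^bsub>HH\<^esub> Z = X \<otimes>\<^bsub>HH\<^esub> (Y \<otimes>\<^bsub>HH\<^esub> Z)"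
proof -
  note M = module module HH_module
  have t: "tens K H H a b \<in> carrier HH" if "a \<in> carrier H" "b \<in> carrier H" for a b
    using that by (intro tens_closed module)
  note li = lin_HH_mult_left lin_HH_mult_right lin_ident HH_mult_closed t
  have 1: "(tens K H H a b \<otimes>\<^bsub>HH\<^esub> tens K H H c d) \<otimes>\<^bsub>HH\<^esub> Z = tens K H H a b \<otimes>\<^bsub>HH\<^esub> (tens K H H c d \<otimes>\<^bsub>HH\<^esub> Z)"
    if abcd: "a \<in> carrier H" "b \<in> carrier H" "c \<in> carrier H" "d \<in> carrier H" for a b c d
    by (rule lin_eq_on_tensor[where f = "\<lambda>Z. (tens K H H a b \<otimes>\<^bsub>HH\<^esub> tens K H H c d) \<otimes>\<^bsub>HH\<^esub> Z"
            and g = "\<lambda>Z. tens K H H a b \<otimes>\<^bsub>HH\<^esub> (tens K H H c d \<otimes>\<^bsub>HH\<^esub> Z)", OF M _ _ _ assms(3)])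
      ((intro li abcd)+, simp add: abcd tens_mult H.m_assoc)
  have 2: "(tens K H H a b \<otimes>\<^bsub>HH\<^esub> Y) \<otimes>\<^bsub>HH\<^esub> Z = tens K H H a b \<otimes>\<^bsub>HH\<^esub> (Y \<otimes>\<^bsub>HH\<^esub> Z)"
    if ab: "a \<in> carrier H" "b \<in> carrier H" for a b
    by (rule lin_eq_on_tensor[where f = "\<lambda>Y. (tens K H H a b \<otimes>\<^bsub>HH\<^esub> Y) \<otimes>\<^bsub>HH\<^esub> Z"
            and g = "\<lambda>Y. tens K H H a b \<otimes>\<^bsub>HH\<^esub> (Y \<otimes>\<^bsub>HH\<^esub> Z)", OF M _ _ 1 assms(2)])
      (intro li ab assms | assumption)+
  show ?thesis
    by (rule lin_eq_on_tensor[where f = "\<lambda>X. (X \<otimes>\<^bsub>HH\<^esub> Y) \<otimes>\<^bsub>HH\<^esub> Z"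
            and g = "\<lambda>X. X \<otimes>\<^bsub>HH\<^esub> (Y \<otimes>\<^bsub>HH\<^esub> Z)", OF M _ _ 2 assms(1)])
      (intro li assms | assumption)+
qed

text \<open>With the ring laws the \<open>algebra\<close> method can rearrange products in H
  \<otimes> H. They are also what makes left multiplication by \<Delta> x an action of
  \<open>H\<close>.\<close>

lemma HH_ring: "Ring.ring HH"
proof (rule ringI)
  show "abelian_group HH" by (rule HHm.M.abelian_group_axioms)
  have one: "\<one>\<^bsub>HH\<^esub> = tens K H H \<one>\<^bsub>H\<^esub> \<one>\<^bsub>H\<^esub>" by (simp add: tensor_def Let_def)
  have 1: "tens K H H \<one>\<^bsub>H\<^esub> \<one>\<^bsub>H\<^esub> \<in> carrier HH" by (intro tens_closed module H.one_closed)
  show "Group.monoid HH"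
  proof (rule monoidI)
    show "\<one>\<^bsub>HH\<^esub> \<in> carrier HH" unfolding one by (rule 1)
    fix X assume X: "X \<in> carrier HH"
    show "\<one>\<^bsub>HH\<^esub> \<otimes>\<^bsub>HH\<^esub> X = X" unfolding one
      by (rule lin_eq_on_tensor[OF module module HH_module lin_HH_mult_right[OF 1 lin_ident] lin_ident _ X]) (simp add: tens_mult)
    show "X \<otimes>\<^bsub>HH\<^esub> \<one>\<^bsub>HH\<^esub> = X" unfolding one
      by (rule lin_eq_on_tensor[OF module module HH_module lin_HH_mult_left[OF lin_ident 1] lin_ident _ X]) (simp add: tens_mult)
  qed (simp_all add: HH_mult_closed HH_mult_assoc)
qed (simp_all add: linD(2)[OF lin_HH_mult_left[OF lin_ident]] linD(2)[OF lin_HH_mult_right[OF _ lin_ident]])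

interpretation HH: ring HH by (rule HH_ring)

lemmas lin_intros = lin_ident lin_tens_left lin_tens_right lin_mult_left lin_mult_right
  lin_HH_mult_left lin_HH_mult_right lin_comult lin_antipode lin_counit
  lin_sweedler_arg lin_sweedler_param bilinI module HH_module tensor_module

lemmas structure_closed = module HH_module tensor_module tens_closed HH_mult_closed comult_closed antipode_closed
  counit_closed

lemma sweedler_in:
  assumes "Module.module K Z" "bilin K H H Z g" "submodule N K Z"
    "\<And>a b. a \<in> carrier H \<Longrightarrow> b \<in> carrier H \<Longrightarrow> g a b \<in> N" "x \<in> carrier H"
  shows "sweedler Z g x \<in> N"
  unfolding sweedler_def
  by (rule lin_tensor_into[OF module module assms(1) tensor_lift_universal(1)[OF module module assms(1,2)] assms(3) _
        comult_closed[OF assms(5)]])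
    (simp add: tensor_lift_universal(2)[OF module module assms(1,2)] assms(4))

lemma lin_comult_eq_sweedler:
  assumes "Module.module K Z" "f \<in> lin K HH Z" "x \<in> carrier H"
  shows "f (\<Delta> x) = sweedler Z (\<lambda>a b. f (tens K H H a b)) x"
  unfolding sweedler_def
  by (rule tensor_lift_eqI[OF module module assms(1,2) _ _ comult_closed[OF assms(3)]])
    (auto intro!: bilinI lin_comp[OF _ assms(2)] lin_intros)

section \<open>The bijection \<open>\<kappa>\<close> and its module analogue\<close>

text \<open>For a left action \<beta> this is x \<otimes> m \<mapsto>
  \<open>\<Sum> x\<^sub>1 \<otimes> x\<^sub>2 m\<close>, an automorphism of H \<otimes> M. The basic
  lemmas ask only for bilinearity of \<beta>, so that they also cover b \<mapsto> \<beta> (S b),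
  which in general is no left action.\<close>

definition theta :: "('k, 'm) module \<Rightarrow> ('h \<Rightarrow> 'm \<Rightarrow> 'm) \<Rightarrow> ('h \<times> 'm \<Rightarrow> 'k) set \<Rightarrow> ('h \<times> 'm \<Rightarrow> 'k) set" where
  "theta M \<beta> = tensor_lift K (tensor K H M) (\<lambda>x m. sweedler (tensor K H M) (\<lambda>a b. tens K H M a (\<beta> b m)) x)"

lemma theta_inner_bilin:
  assumes "Module.module K M" "bilin K H M M \<beta>" "m \<in> carrier M"
  shows "bilin K H H (tensor K H M) (\<lambda>a b. tens K H M a (\<beta> b m))"
  by (intro lin_intros bilin_left[OF assms(2)]) (simp_all add: assms bilin_closed[OF assms(2)])

lemma theta_outer_bilin:
  assumes "Module.module K M" "bilin K H M M \<beta>"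
  shows "bilin K H M (tensor K H M) (\<lambda>x m. sweedler (tensor K H M) (\<lambda>a b. tens K H M a (\<beta> b m)) x)"
  by (intro lin_intros theta_inner_bilin bilin_left[OF assms(2)] bilin_right[OF assms(2)])
    (simp_all add: assms bilin_closed[OF assms(2)])

lemma theta_lin:
  assumes "Module.module K M" "bilin K H M M \<beta>"
  shows "theta M \<beta> \<in> lin K (tensor K H M) (tensor K H M)"
  unfolding theta_def
  by (intro tensor_lift_universal(1) theta_outer_bilin tensor_module module assms)

lemma theta_tens:
  assumes "Module.module K M" "bilin K H M M \<beta>" "x \<in> carrier H" "m \<in> carrier M"
  shows "theta M \<beta> (tens K H M x m) = sweedler (tensor K H M) (\<lambda>a b. tens K H M a (\<beta> b m)) x"
  unfolding theta_def
  by (rule tensor_lift_universal(2)) (intro theta_outer_bilin tensor_module module assms)+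

text \<open>Only the second Sweedler component acts, and it does so on the second factor, where
  \<open>N\<close> is stable.\<close>

lemma theta_in:
  assumes M: "Module.module K M" and \<beta>: "bilin K H M M \<beta>" and N: "N \<subseteq> carrier M"
    and st: "\<And>b m. b \<in> carrier H \<Longrightarrow> m \<in> N \<Longrightarrow> \<beta> b m \<in> N"
    and t: "t \<in> tensor_sub K H M (carrier H) N"
  shows "theta M \<beta> t \<in> tensor_sub K H M (carrier H) N"
proof (rule lin_tensor_sub[OF module M _ theta_lin[OF M \<beta>] _ order_refl N _ t])
  show T: "Module.module K (tensor K H M)" by (intro tensor_module module M)
  show sub: "submodule (tensor_sub K H M (carrier H) N) K (tensor K H M)"
    by (intro tensor_sub_submodule module M N order_refl)
  fix x m assume xm: "x \<in> carrier H" "m \<in> N"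
  have m: "m \<in> carrier M" using xm N by blast
  show "theta M \<beta> (tens K H M x m) \<in> tensor_sub K H M (carrier H) N"
    unfolding theta_tens[OF M \<beta> xm(1) m]
    by (rule sweedler_in[OF T theta_inner_bilin[OF M \<beta> m] sub _ xm(1)])
      (intro tens_in_tensor_sub st xm)
qed

text \<open>By coassociativity the composite is \<open>\<Sum> x\<^sub>1 \<otimes> \<beta> x\<^sub>2
  (\<gamma> x\<^sub>3 m)\<close>. The hypothesis \<open>inv\<close> is one half of \<beta> and
  \<gamma> being convolution inverse as maps from \<open>H\<close> to endomorphisms of
  \<open>M\<close>; it collapses the last two components, and the counit removes what
  remains.\<close>

lemma theta_inverse:
  assumes M: "Module.module K M" and \<beta>: "bilin K H M M \<beta>" and \<gamma>: "bilin K H M M \<gamma>"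
    and inv: "\<And>b m. b \<in> carrier H \<Longrightarrow> m \<in> carrier M \<Longrightarrow> sweedler M (\<lambda>c d. \<beta> c (\<gamma> d m)) b = \<epsilon> b \<odot>\<^bsub>M\<^esub> m"
    and t: "t \<in> carrier (tensor K H M)"
  shows "theta M \<beta> (theta M \<gamma> t) = t"
proof (rule lin_eq_on_tensor[OF module M _ lin_comp[OF theta_lin[OF M \<gamma>] theta_lin[OF M \<beta>]] lin_ident _ t])
  let ?T = "tensor K H M"
  show T: "Module.module K ?T" by (intro tensor_module module M)
  note cl = bilin_closed[OF \<beta>] bilin_closed[OF \<gamma>]
  fix x m assume x: "x \<in> carrier H" and m: "m \<in> carrier M"
  have b1: "bilin K H H ?T (\<lambda>b c. tens K H M a (\<beta> b (\<gamma> c m)))" if "a \<in> carrier H" for a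
    by (intro lin_intros bilin_left[OF \<beta>] bilin_right[OF \<beta>] bilin_left[OF \<gamma>]) (simp_all add: M cl m that)
  have b2: "(\<lambda>a. tens K H M a (\<beta> b (\<gamma> c m))) \<in> lin K H ?T" if "b \<in> carrier H" "c \<in> carrier H" for b c
    by (intro lin_intros) (simp_all add: M cl m that)
  have bM: "bilin K H H M (\<lambda>c d. \<beta> c (\<gamma> d m))"
    by (intro lin_intros bilin_left[OF \<beta>] bilin_right[OF \<beta>] bilin_left[OF \<gamma>]) (simp_all add: M cl m)
  have b3: "bilin K H H ?T (\<lambda>a b. theta M \<beta> (tens K H M a (\<gamma> b m)))"
    by (intro bilinI lin_comp[OF _ theta_lin[OF M \<beta>]] lin_intros bilin_left[OF \<gamma>]) (simp_all add: M cl m)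
  have b4: "bilin K H H ?T (\<lambda>a b. sweedler ?T (\<lambda>c d. tens K H M a (\<beta> c (\<gamma> d m))) b)"
    by (intro bilinI lin_sweedler_arg lin_sweedler_param b1 b2 T module lin_ident)
  have "theta M \<beta> (theta M \<gamma> (tens K H M x m)) = sweedler ?T (\<lambda>a b. theta M \<beta> (tens K H M a (\<gamma> b m))) x"
    unfolding theta_tens[OF M \<gamma> x m]
    by (rule lin_of_sweedler[OF T T theta_lin[OF M \<beta>] theta_inner_bilin[OF M \<gamma> m] x])
  also have "\<dots> = sweedler ?T (\<lambda>a b. sweedler ?T (\<lambda>c d. tens K H M c (\<beta> d (\<gamma> b m))) a) x"
    by (rule sweedler_cong[OF T b3 _ x]) (simp add: theta_tens[OF M \<beta>] cl m)
  also have "\<dots> = sweedler ?T (\<lambda>a b. sweedler ?T (\<lambda>c d. tens K H M a (\<beta> c (\<gamma> d m))) b) x"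
    by (rule sweedler_coassoc[OF T b1 b2 x])
  also have "\<dots> = sweedler ?T (\<lambda>a b. \<epsilon> b \<odot>\<^bsub>?T\<^esub> tens K H M a m) x"
  proof (rule sweedler_cong[OF T b4 _ x])
    fix a b assume ab: "a \<in> carrier H" "b \<in> carrier H"
    note l = lin_tens_right[OF module M ab(1) lin_ident]
    have "sweedler ?T (\<lambda>c d. tens K H M a (\<beta> c (\<gamma> d m))) b = tens K H M a (sweedler M (\<lambda>c d. \<beta> c (\<gamma> d m)) b)"
      by (rule lin_of_sweedler[OF M T l bM ab(2), symmetric])
    also have "\<dots> = \<epsilon> b \<odot>\<^bsub>?T\<^esub> tens K H M a m"
      using ab m by (simp add: inv linD(3)[OF l] counit_closed)
    finally show "sweedler ?T (\<lambda>c d. tens K H M a (\<beta> c (\<gamma> d m))) b = \<epsilon> b \<odot>\<^bsub>?T\<^esub> tens K H M a m" .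
  qed
  also have "\<dots> = tens K H M x m"
    by (rule sweedler_counit_right[OF T lin_tens_left[OF module M lin_ident m] x])
  finally show "theta M \<beta> (theta M \<gamma> (tens K H M x m)) = tens K H M x m" .
qed

text \<open>The action law merges \<beta> c (\<beta> (S d) m) into \<beta> (c S d) m, so the
  antipode axioms are precisely the two convolution identities required by
  \<open>theta_inverse\<close>.\<close>

lemma theta_antipode_inverse:
  assumes M: "Module.module K M" and \<beta>: "bilin K H M M \<beta>"
    and mult: "\<And>x y m. x \<in> carrier H \<Longrightarrow> y \<in> carrier H \<Longrightarrow> m \<in> carrier M \<Longrightarrow> \<beta> x (\<beta> y m) = \<beta> (x \<otimes>\<^bsub>H\<^esub> y) m"
    and one: "\<And>m. m \<in> carrier M \<Longrightarrow> \<beta> \<one>\<^bsub>H\<^esub> m = m"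
  shows "bilin K H M M (\<lambda>b. \<beta> (S b))"
    and "t \<in> carrier (tensor K H M) \<Longrightarrow> theta M \<beta> (theta M (\<lambda>b. \<beta> (S b)) t) = t"
    and "t \<in> carrier (tensor K H M) \<Longrightarrow> theta M (\<lambda>b. \<beta> (S b)) (theta M \<beta> t) = t"
proof -
  note cl = bilin_closed[OF \<beta>] antipode_closed
  show \<gamma>: "bilin K H M M (\<lambda>b. \<beta> (S b))"
    by (intro bilinI bilin_left[OF \<beta>] bilin_right[OF \<beta>] antipode_lin antipode_closed lin_ident)
  have lm: "(\<lambda>h. \<beta> h m) \<in> lin K H M" if "m \<in> carrier M" for m by (rule bilin_left[OF \<beta> lin_ident that])
  have bl: "bilin K H H M (\<lambda>c d. \<beta> c (\<beta> (S d) m))" "bilin K H H M (\<lambda>c d. \<beta> (S c) (\<beta> d m))" if "m \<in> carrier M" for m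
    by (intro bilinI bilin_left[OF \<beta>] bilin_right[OF \<beta>] lin_intros; simp add: cl that)+
  have r: "sweedler M (\<lambda>c d. \<beta> c (\<beta> (S d) m)) b = \<epsilon> b \<odot>\<^bsub>M\<^esub> m" if bm: "b \<in> carrier H" "m \<in> carrier M" for b m
  proof -
    have "sweedler M (\<lambda>c d. \<beta> c (\<beta> (S d) m)) b = sweedler M (\<lambda>c d. \<beta> (c \<otimes>\<^bsub>H\<^esub> S d) m) b"
      by (rule sweedler_cong[OF M bl(1)[OF bm(2)] _ bm(1)]) (simp add: mult cl bm)
    also have "\<dots> = \<epsilon> b \<odot>\<^bsub>M\<^esub> m"
      using sweedler_antipode_right[OF M lm[OF bm(2)] bm(1)] by (simp add: one bm)
    finally show ?thesis .
  qed
  have l: "sweedler M (\<lambda>c d. \<beta> (S c) (\<beta> d m)) b = \<epsilon> b \<odot>\<^bsub>M\<^esub> m" if bm: "b \<in> carrier H" "m \<in> carrier M" for b m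
  proof -
    have "sweedler M (\<lambda>c d. \<beta> (S c) (\<beta> d m)) b = sweedler M (\<lambda>c d. \<beta> (S c \<otimes>\<^bsub>H\<^esub> d) m) b"
      by (rule sweedler_cong[OF M bl(2)[OF bm(2)] _ bm(1)]) (simp add: mult cl bm)
    also have "\<dots> = \<epsilon> b \<odot>\<^bsub>M\<^esub> m"
      using sweedler_antipode_left[OF M lm[OF bm(2)] bm(1)] by (simp add: one bm)
    finally show ?thesis .
  qed
  show "t \<in> carrier (tensor K H M) \<Longrightarrow> theta M \<beta> (theta M (\<lambda>b. \<beta> (S b)) t) = t"
    by (rule theta_inverse[OF M \<beta> \<gamma> r])
  show "t \<in> carrier (tensor K H M) \<Longrightarrow> theta M (\<lambda>b. \<beta> (S b)) (theta M \<beta> t) = t"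
    by (rule theta_inverse[OF M \<gamma> \<beta> l])
qed

abbreviation "kappa \<equiv> theta H (mult H)"
abbreviation "kappa_inv \<equiv> theta H (\<lambda>b. mult H (S b))"

lemma kappa_inverse:
  shows mult_antipode_bilin: "bilin K H H H (\<lambda>b. mult H (S b))"
    and "t \<in> carrier HH \<Longrightarrow> kappa (kappa_inv t) = t"
    and "t \<in> carrier HH \<Longrightarrow> kappa_inv (kappa t) = t"
  by (rule theta_antipode_inverse[OF module mult_bilin], simp_all add: H.m_assoc)+

text \<open>This is an action because \<Delta> is multiplicative and unital. It preserves I
  \<otimes> H for every left ideal \<open>I\<close>, which is what the cotensor computation relies
  on.\<close>

definition comult_act :: "'h \<Rightarrow> ('h \<times> 'h \<Rightarrow> 'k) set \<Rightarrow> ('h \<times> 'h \<Rightarrow> 'k) set" where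
  "comult_act x s = \<Delta> x \<otimes>\<^bsub>HH\<^esub> s"

lemma comult_act_bilin: "bilin K H HH HH comult_act"
  unfolding comult_act_def by (intro lin_intros) (simp_all add: structure_closed)

lemma one_HH: "\<one>\<^bsub>HH\<^esub> = tens K H H \<one>\<^bsub>H\<^esub> \<one>\<^bsub>H\<^esub>"
  by (simp add: tensor_def Let_def)

lemma comult_act_inverse:
  shows comult_act_antipode_bilin: "bilin K H HH HH (\<lambda>b. comult_act (S b))"
    and "t \<in> carrier (tensor K H HH) \<Longrightarrow> theta HH comult_act (theta HH (\<lambda>b. comult_act (S b)) t) = t"
    and "t \<in> carrier (tensor K H HH) \<Longrightarrow> theta HH (\<lambda>b. comult_act (S b)) (theta HH comult_act t) = t"
  by (rule theta_antipode_inverse[OF HH_module comult_act_bilin],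
      simp_all add: comult_act_def comult_mult comult_closed HH.m_assoc comult_one flip: one_HH)+

section \<open>Coinvariants of left ideals\<close>

text \<open>Scaling by a is left multiplication by a 1.\<close>

lemma left_ideal_submodule:
  assumes "left_ideal I H"
  shows "submodule I K H"
proof -
  interpret I: additive_subgroup I H using assms by (simp add: left_ideal_def)
  show ?thesis
  proof (rule submodule_intro[OF module I.a_subset])
    fix a x assume ax: "a \<in> carrier K" "x \<in> I"
    then have x: "x \<in> carrier H" by (simp add: I.a_Hcarr)
    have "(a \<odot>\<^bsub>H\<^esub> \<one>\<^bsub>H\<^esub>) \<otimes>\<^bsub>H\<^esub> x \<in> I" using assms ax by (simp add: left_ideal_def)
    then show "a \<odot>\<^bsub>H\<^esub> x \<in> I" using ax x by (simp add: smult_mult_left)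
  qed auto
qed

text \<open>The products already span a left ideal. Hence linear statements about the generated left
  ideal need only be checked on single products.\<close>

lemma left_ideal_gen_eq:
  assumes "A \<subseteq> carrier H"
  shows "left_ideal_gen H A = subspace_gen K H {x \<otimes>\<^bsub>H\<^esub> a | x a. x \<in> carrier H \<and> a \<in> A}" (is "_ = ?G")
    and "left_ideal (left_ideal_gen H A) H"
proof -
  have gc: "{x \<otimes>\<^bsub>H\<^esub> a | x a. x \<in> carrier H \<and> a \<in> A} \<subseteq> carrier H" using assms by auto
  note G = subspace_gen_submodule[OF module gc]
  have "left_ideal ?G H"
    unfolding left_ideal_def
  proof (intro conjI ballI)
    show "additive_subgroup ?G H"
      using submodule_abelian_subgroup[OF module G] by (simp add: abelian_subgroup_def)
    fix h x assume h: "h \<in> carrier H" and x: "x \<in> ?G"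
    show "h \<otimes>\<^bsub>H\<^esub> x \<in> ?G"
    proof (rule lin_subspace_gen[OF module module lin_mult_right[OF h lin_ident] G gc _ x])
      fix y assume "y \<in> {x \<otimes>\<^bsub>H\<^esub> a | x a. x \<in> carrier H \<and> a \<in> A}"
      then obtain z a where "y = z \<otimes>\<^bsub>H\<^esub> a" "z \<in> carrier H" "a \<in> A" by blast
      then have "h \<otimes>\<^bsub>H\<^esub> y = (h \<otimes>\<^bsub>H\<^esub> z) \<otimes>\<^bsub>H\<^esub> a" "h \<otimes>\<^bsub>H\<^esub> z \<in> carrier H" "a \<in> A"
        using h assms by (auto simp: H.m_assoc)
      then show "h \<otimes>\<^bsub>H\<^esub> y \<in> ?G" by (intro subsetD[OF subspace_gen_incl]) blast
    qed
  qed
  moreover have "A \<subseteq> ?G"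
  proof
    fix a assume a: "a \<in> A"
    then have "a = \<one>\<^bsub>H\<^esub> \<otimes>\<^bsub>H\<^esub> a" using assms by auto
    then show "a \<in> ?G" using a by (intro subsetD[OF subspace_gen_incl]) blast
  qed
  ultimately have "left_ideal_gen H A \<subseteq> ?G" by (auto simp: left_ideal_gen_def)
  moreover have "?G \<subseteq> left_ideal_gen H A"
    unfolding left_ideal_gen_def
  proof (rule Inter_greatest)
    fix I assume "I \<in> {I. left_ideal I H \<and> A \<subseteq> I}"
    then have I: "left_ideal I H" "A \<subseteq> I" by auto
    show "?G \<subseteq> I"
      by (rule subspace_gen_least[OF left_ideal_submodule[OF I(1)]]) (use I in \<open>auto simp: left_ideal_def\<close>)
  qed
  ultimately show "left_ideal_gen H A = ?G" by blast
  then show "left_ideal (left_ideal_gen H A) H" using \<open>left_ideal ?G H\<close> by simp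
qed

lemma HH_mult_tensor_sub:
  assumes A: "A \<subseteq> carrier H" "\<And>h a. h \<in> carrier H \<Longrightarrow> a \<in> A \<Longrightarrow> h \<otimes>\<^bsub>H\<^esub> a \<in> A"
    and B: "B \<subseteq> carrier H" "\<And>h b. h \<in> carrier H \<Longrightarrow> b \<in> B \<Longrightarrow> h \<otimes>\<^bsub>H\<^esub> b \<in> B"
    and X: "X \<in> carrier HH" and s: "s \<in> tensor_sub K H H A B"
  shows "X \<otimes>\<^bsub>HH\<^esub> s \<in> tensor_sub K H H A B"
proof (rule lin_tensor_sub[OF module module HH_module lin_HH_mult_right[OF X lin_ident] _ A(1) B(1) _ s])
  show N: "submodule (tensor_sub K H H A B) K HH" by (intro tensor_sub_submodule module A B)
  fix a b assume ab: "a \<in> A" "b \<in> B"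
  then have ab': "a \<in> carrier H" "b \<in> carrier H" using A B by auto
  have t: "tens K H H a b \<in> carrier HH" using ab' by (simp add: structure_closed)
  show "X \<otimes>\<^bsub>HH\<^esub> tens K H H a b \<in> tensor_sub K H H A B"
    by (rule lin_tensor_into[OF module module HH_module lin_HH_mult_left[OF lin_ident t] N _ X])
      (use ab ab' A B in \<open>simp add: tens_mult tens_in_tensor_sub\<close>)
qed

lemma left_ideal_tensor_mult_left:
  assumes I: "left_ideal I H" and X: "X \<in> carrier HH" and s: "s \<in> tensor_sub K H H I (carrier H)"
  shows "X \<otimes>\<^bsub>HH\<^esub> s \<in> tensor_sub K H H I (carrier H)"
  by (rule HH_mult_tensor_sub[OF _ _ _ _ X s])
    (use I submodule_closed(1)[OF module left_ideal_submodule[OF I]] in \<open>auto simp: left_ideal_def\<close>)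

lemma left_ideal_tensor_mult_right:
  assumes I: "left_ideal I H" and y: "y \<in> carrier H" and s: "s \<in> tensor_sub K H H I (carrier H)"
  shows "s \<otimes>\<^bsub>HH\<^esub> tens K H H \<one>\<^bsub>H\<^esub> y \<in> tensor_sub K H H I (carrier H)"
proof -
  have Ic: "I \<subseteq> carrier H" using submodule_closed(1)[OF module left_ideal_submodule[OF I]] by blast
  have t: "tens K H H \<one>\<^bsub>H\<^esub> y \<in> carrier HH" using y by (simp add: structure_closed)
  show ?thesis
    by (rule lin_tensor_sub[OF module module HH_module lin_HH_mult_left[OF lin_ident t] _ Ic order_refl _ s])
      (use Ic y in \<open>auto simp: tens_mult subset_iff intro!: tensor_sub_submodule module tens_in_tensor_sub\<close>)
qed

lemma proj_lin:
  assumes "left_ideal I H"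
  shows "proj H I \<in> lin K H (quot_space K H I)"
  using quot_space_proj[OF module left_ideal_submodule[OF assms]] by (simp add: proj_def[abs_def])

lemma quot_module: "left_ideal I H \<Longrightarrow> Module.module K (quot_space K H I)"
  by (rule quot_space_module[OF module left_ideal_submodule])

lemma proj_kernel:
  assumes "left_ideal I H"
  shows "{x \<in> carrier H. proj H I x = \<zero>\<^bsub>quot_space K H I\<^esub>} = I"
  using quot_space_proj_eq_zero_iff[OF module left_ideal_submodule[OF assms]]
    submodule_closed(1)[OF module left_ideal_submodule[OF assms]] by (auto simp: proj_def)

abbreviation "proj_left I \<equiv> tensor_map K (quot_space K H I) H (proj H I) (\<lambda>y. y)"

lemma proj_left_lin:
  assumes "left_ideal I H"
  shows "proj_left I \<in> lin K HH (tensor K (quot_space K H I) H)"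
  by (intro tensor_map_lin module quot_module proj_lin lin_ident assms)

lemma proj_left_tens:
  assumes "left_ideal I H" "x \<in> carrier H" "y \<in> carrier H"
  shows "proj_left I (tens K H H x y) = tens K (quot_space K H I) H (proj H I x) y"
  by (intro tensor_map_tens module quot_module proj_lin lin_ident assms)

lemma proj_left_kernel:
  assumes "left_ideal I H"
  shows "t \<in> carrier HH \<Longrightarrow>
    proj_left I t = \<zero>\<^bsub>tensor K (quot_space K H I) H\<^esub> \<longleftrightarrow> t \<in> tensor_sub K H H I (carrier H)"
  by (subst tensor_map_left_kernel_iff[OF field module quot_module[OF assms] module proj_lin[OF assms]])
    (simp_all add: proj_kernel[OF assms])

lemma one_tens_lin: "tens K H H \<one>\<^bsub>H\<^esub> \<in> lin K H HH"
  using lin_tens_right[OF module module H.one_closed lin_ident] by simp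

text \<open>The kernel of \<pi> \<otimes> id is I \<otimes> H. In this form coinvariance is a
  congruence modulo a left ideal of H \<otimes> H, to which multiplication and \<kappa> apply
  directly.\<close>

lemma coinvariants_iff:
  assumes I: "left_ideal I H"
  shows "x \<in> coinvariants K H \<Delta> I \<longleftrightarrow>
    x \<in> carrier H \<and> \<Delta> x \<ominus>\<^bsub>HH\<^esub> tens K H H \<one>\<^bsub>H\<^esub> x \<in> tensor_sub K H H I (carrier H)"
proof (cases "x \<in> carrier H")
  case x: True
  let ?T = "tensor K (quot_space K H I) H"
  note P = proj_left_lin[OF I]
  note T = tensor_module[OF quot_module[OF I] module]
  have c: "\<Delta> x \<in> carrier HH" "tens K H H \<one>\<^bsub>H\<^esub> x \<in> carrier HH" using x by (simp_all add: structure_closed)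
  have "x \<in> coinvariants K H \<Delta> I \<longleftrightarrow> proj_left I (\<Delta> x) = proj_left I (tens K H H \<one>\<^bsub>H\<^esub> x)"
    using x by (simp add: coinvariants_def left_coaction_def proj_left_tens[OF I])
  also have "\<dots> \<longleftrightarrow> proj_left I (\<Delta> x \<ominus>\<^bsub>HH\<^esub> tens K H H \<one>\<^bsub>H\<^esub> x) = \<zero>\<^bsub>?T\<^esub>"
    using module_diff_eq_zero_iff[OF T linD(1)[OF P c(1)] linD(1)[OF P c(2)]]
    by (simp add: lin_diff_eq[OF HH_module T P c])
  also have "\<dots> \<longleftrightarrow> \<Delta> x \<ominus>\<^bsub>HH\<^esub> tens K H H \<one>\<^bsub>H\<^esub> x \<in> tensor_sub K H H I (carrier H)"
    by (rule proj_left_kernel[OF I]) (use c in simp)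
  finally show ?thesis using x by simp
qed (simp add: coinvariants_def)

lemma coinvariants_submodule:
  assumes I: "left_ideal I H"
  shows "submodule (coinvariants K H \<Delta> I) K H"
proof -
  have "submodule {x \<in> carrier H. \<Delta> x \<ominus>\<^bsub>HH\<^esub> tens K H H \<one>\<^bsub>H\<^esub> x \<in> tensor_sub K H H I (carrier H)} K H"
    by (rule preimage_submodule[OF module HH_module])
      (intro lin_minus HH_module comult_lin one_tens_lin tensor_sub_submodule module order_refl subsetI
        submodule_closed(1)[OF module left_ideal_submodule[OF I]] | assumption)+
  moreover have "{x \<in> carrier H. \<Delta> x \<ominus>\<^bsub>HH\<^esub> tens K H H \<one>\<^bsub>H\<^esub> x \<in> tensor_sub K H H I (carrier H)} =
      coinvariants K H \<Delta> I"
    using coinvariants_iff[OF I] by blast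
  ultimately show ?thesis by simp
qed

lemma coinvariants_one:
  assumes I: "left_ideal I H"
  shows "\<one>\<^bsub>H\<^esub> \<in> coinvariants K H \<Delta> I"
proof -
  have "submodule (tensor_sub K H H I (carrier H)) K HH"
    using submodule_closed(1)[OF module left_ideal_submodule[OF I]] by (intro tensor_sub_submodule module) auto
  from submodule_closed(2)[OF HH_module this] show ?thesis
    unfolding coinvariants_iff[OF I] comult_one
    by (simp add: module_diff_eq_zero_iff[OF HH_module, THEN iffD2] structure_closed)
qed

lemma tensor_sub_left_submodule: "left_ideal I H \<Longrightarrow> submodule (tensor_sub K H H I (carrier H)) K HH"
  using submodule_closed(1)[OF module left_ideal_submodule] by (intro tensor_sub_submodule module) auto

lemma coinvariants_mult:
  assumes I: "left_ideal I H" and x: "x \<in> coinvariants K H \<Delta> I" and y: "y \<in> coinvariants K H \<Delta> I"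
  shows "x \<otimes>\<^bsub>H\<^esub> y \<in> coinvariants K H \<Delta> I"
proof -
  let ?N = "tensor_sub K H H I (carrier H)" and ?o = "\<lambda>x. tens K H H \<one>\<^bsub>H\<^esub> x"
  note N = submodule_closed[OF HH_module tensor_sub_left_submodule[OF I]]
  note x = x[unfolded coinvariants_iff[OF I]] and y = y[unfolded coinvariants_iff[OF I]]
  have c: "\<Delta> x \<in> carrier HH" "\<Delta> y \<in> carrier HH" "?o x \<in> carrier HH" "?o y \<in> carrier HH"
    using x y by (auto simp: structure_closed)
  have "\<Delta> (x \<otimes>\<^bsub>H\<^esub> y) \<ominus>\<^bsub>HH\<^esub> ?o (x \<otimes>\<^bsub>H\<^esub> y) = \<Delta> x \<otimes>\<^bsub>HH\<^esub> \<Delta> y \<ominus>\<^bsub>HH\<^esub> ?o x \<otimes>\<^bsub>HH\<^esub> ?o y"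
    using x y by (simp add: comult_mult tens_mult)
  \<comment> \<open>The first summand lies in I \<otimes> H because that is a left ideal of H
    \<otimes> H. In the second the multiplication is from the right, but by 1 \<otimes> y, which
    leaves the factor in \<open>I\<close> alone.\<close>
  also have "\<dots> = \<Delta> x \<otimes>\<^bsub>HH\<^esub> (\<Delta> y \<ominus>\<^bsub>HH\<^esub> ?o y) \<oplus>\<^bsub>HH\<^esub> (\<Delta> x \<ominus>\<^bsub>HH\<^esub> ?o x) \<otimes>\<^bsub>HH\<^esub> ?o y"
    using c by algebra
  also have "\<dots> \<in> ?N"
    by (intro N(3) left_ideal_tensor_mult_left[OF I] left_ideal_tensor_mult_right[OF I]) (use x y c in auto)
  finally show ?thesis using x y by (simp add: coinvariants_iff[OF I])
qed

text \<open>\<open>\<Psi> I\<close> is the kernel of \<open>\<lambda> x = (\<pi> \<otimes> id) (\<Delta> x - 1 \<otimes> x)\<close>, and up to associativity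
  \<open>(\<lambda> \<otimes> id) \<Delta> = (id \<otimes> \<Delta>) \<lambda>\<close>. Below, \<open>r - s\<close> is \<open>\<lambda>\<close> and \<open>G\<close> is \<open>id \<otimes> \<Delta>\<close> followed by reassociation.\<close>

lemma coinvariants_comult:
  assumes I: "left_ideal I H" and x: "x \<in> coinvariants K H \<Delta> I"
  shows "\<Delta> x \<in> tensor_sub K H H (coinvariants K H \<Delta> I) (carrier H)"
proof -
  let ?Q = "quot_space K H I" let ?T = "tensor K ?Q H" let ?Z = "tensor K ?T H"
  let ?o = "\<lambda>x. tens K H H \<one>\<^bsub>H\<^esub> x"
  note Q = quot_module[OF I] and P = proj_left_lin[OF I] and pr = proj_lin[OF I]
  note prc = linD(1)[OF pr]
  note T = tensor_module[OF Q module]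
  note Z = tensor_module[OF T module]
  have x': "x \<in> carrier H" and px: "proj_left I (\<Delta> x) = proj_left I (?o x)"
    using x by (auto simp: coinvariants_def left_coaction_def proj_left_tens[OF I])
  define r where "r y = proj_left I (\<Delta> y)" for y
  define s where "s y = proj_left I (?o y)" for y
  have r: "r \<in> lin K H ?T" and s: "s \<in> lin K H ?T"
    unfolding r_def s_def by (intro lin_comp[OF comult_lin P] lin_comp[OF one_tens_lin P])+
  have k: "{y \<in> carrier H. r y \<ominus>\<^bsub>?T\<^esub> s y = \<zero>\<^bsub>?T\<^esub>} = coinvariants K H \<Delta> I"
  proof -
    have "r y \<ominus>\<^bsub>?T\<^esub> s y = \<zero>\<^bsub>?T\<^esub> \<longleftrightarrow> y \<in> coinvariants K H \<Delta> I" if y: "y \<in> carrier H" for y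
      unfolding module_diff_eq_zero_iff[OF T linD(1)[OF r y] linD(1)[OF s y]]
      using y by (simp add: r_def s_def coinvariants_def left_coaction_def proj_left_tens[OF I])
    then show ?thesis by (auto simp: coinvariants_def)
  qed
  note rs = lin_minus[OF T r s]
  note l = tensor_map_lin[OF module module T module _ lin_ident]
  have b: "bilin K H H ?Z (\<lambda>c d. tens K ?T H (tens K ?Q H q c) d)" if "q \<in> carrier ?Q" for q
    using that by (intro lin_intros Q) (simp_all add: structure_closed Q T)
  have bo: "bilin K ?Q H ?Z (\<lambda>q h. sweedler ?Z (\<lambda>c d. tens K ?T H (tens K ?Q H q c) d) h)"
    by (intro lin_intros b Q T Z) (simp_all add: structure_closed Q T)
  define G where "G = tensor_lift K ?Z (\<lambda>q h. sweedler ?Z (\<lambda>c d. tens K ?T H (tens K ?Q H q c) d) h)"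
  note G = tensor_lift_universal[OF Q module Z bo, folded G_def]
  have "tensor_map K ?T H r (\<lambda>u. u) (\<Delta> x) = G (proj_left I (\<Delta> x))"
  proof -
    have b1: "bilin K H H ?Z (\<lambda>c d. tens K ?T H (tens K ?Q H (proj H I a) c) d)" if "a \<in> carrier H" for a
      by (intro b prc that)
    have b2: "(\<lambda>a. tens K ?T H (tens K ?Q H (proj H I a) c) d) \<in> lin K H ?Z" if "c \<in> carrier H" "d \<in> carrier H" for c d
      using that by (intro lin_intros Q pr) simp_all
    have "tensor_map K ?T H r (\<lambda>u. u) (\<Delta> x) = sweedler ?Z (\<lambda>a b. tens K ?T H (r a) b) x"
      unfolding sweedler_def tensor_map_def ..
    also have "\<dots> = sweedler ?Z (\<lambda>a b. sweedler ?Z (\<lambda>c d. tens K ?T H (tens K ?Q H (proj H I c) d) b) a) x"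
    proof (rule sweedler_cong[OF Z tensor_map_bilin[OF T module r lin_ident] _ x'])
      fix a b assume ab: "a \<in> carrier H" "b \<in> carrier H"
      show "tens K ?T H (r a) b = sweedler ?Z (\<lambda>c d. tens K ?T H (tens K ?Q H (proj H I c) d) b) a"
        unfolding r_def sweedler_def tensor_map_def
        by (rule lin_tensor_lift_eq[OF module module T Z lin_tens_left[OF T module lin_ident ab(2)]
              tensor_map_bilin[OF Q module pr lin_ident] comult_closed[OF ab(1)]])
    qed
    also have "\<dots> = sweedler ?Z (\<lambda>a b. sweedler ?Z (\<lambda>c d. tens K ?T H (tens K ?Q H (proj H I a) c) d) b) x"
      by (rule sweedler_coassoc[OF Z b1 b2 x'])
    also have "\<dots> = sweedler ?Z (\<lambda>a b. G (tens K ?Q H (proj H I a) b)) x"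
      by (rule sweedler_cong[OF Z _ _ x']) (auto intro!: bilin_left[OF bo pr] bilin_right[OF bo] bilinI lin_ident prc simp: G(2) prc)
    also have "\<dots> = G (proj_left I (\<Delta> x))"
      unfolding sweedler_def tensor_map_def
      by (rule lin_tensor_lift_eq[OF module module T Z G(1) tensor_map_bilin[OF Q module pr lin_ident] comult_closed[OF x'], symmetric])
    finally show ?thesis .
  qed
  moreover have "tensor_map K ?T H s (\<lambda>u. u) (\<Delta> x) = G (proj_left I (?o x))"
  proof -
    have "tensor_map K ?T H s (\<lambda>u. u) (\<Delta> x) = sweedler ?Z (\<lambda>a b. tens K ?T H (s a) b) x"
      unfolding sweedler_def tensor_map_def ..
    also have "\<dots> = sweedler ?Z (\<lambda>a b. tens K ?T H (tens K ?Q H (proj H I \<one>\<^bsub>H\<^esub>) a) b) x"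
      by (rule sweedler_cong[OF Z tensor_map_bilin[OF T module s lin_ident] _ x']) (simp add: s_def proj_left_tens[OF I])
    also have "\<dots> = G (proj_left I (?o x))"
      using x' by (simp add: proj_left_tens[OF I] G(2) prc)
    finally show ?thesis .
  qed
  moreover have "tensor_map K ?T H (\<lambda>y. r y \<ominus>\<^bsub>?T\<^esub> s y) (\<lambda>u. u) (\<Delta> x) =
      tensor_map K ?T H r (\<lambda>u. u) (\<Delta> x) \<ominus>\<^bsub>?Z\<^esub> tensor_map K ?T H s (\<lambda>u. u) (\<Delta> x)"
  proof (rule lin_eq_on_tensor[OF module module Z l[OF rs] lin_minus[OF Z l[OF r] l[OF s]] _ comult_closed[OF x']])
    fix a b assume ab: "a \<in> carrier H" "b \<in> carrier H"
    then show "tensor_map K ?T H (\<lambda>y. r y \<ominus>\<^bsub>?T\<^esub> s y) (\<lambda>u. u) (tens K H H a b) =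
      tensor_map K ?T H r (\<lambda>u. u) (tens K H H a b) \<ominus>\<^bsub>?Z\<^esub> tensor_map K ?T H s (\<lambda>u. u) (tens K H H a b)"
      by (simp add: tensor_map_tens[OF module module T module _ lin_ident] r s rs
          lin_diff_eq[OF T Z lin_tens_left[OF T module lin_ident ab(2)]] linD(1)[OF r] linD(1)[OF s])
  qed
  \<comment> \<open>By \<open>px\<close> both terms of the difference are \<open>G\<close> of the
    same element. So (r - s) \<otimes> id kills \<Delta> x, and over a field its kernel is the
    coinvariants tensored with \<open>H\<close>.\<close>
  ultimately have "tensor_map K ?T H (\<lambda>y. r y \<ominus>\<^bsub>?T\<^esub> s y) (\<lambda>u. u) (\<Delta> x) = \<zero>\<^bsub>?Z\<^esub>"
    using px linD(1)[OF G(1) linD(1)[OF P comult_closed[OF x']]] by (simp add: module_diff_eq_zero_iff[OF Z])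
  then show ?thesis
    using tensor_map_left_kernel[OF field module T module rs comult_closed[OF x']] by (simp add: k)
qed

lemma coinvariants_right_coideal_subalgebra:
  assumes I: "left_ideal I H"
  shows "right_coideal_subalgebra K H \<Delta> (coinvariants K H \<Delta> I)"
  unfolding right_coideal_subalgebra_def
proof (intro conjI)
  note B = submodule_closed[OF module coinvariants_submodule[OF I]]
  show "submodule (coinvariants K H \<Delta> I) K H" by (rule coinvariants_submodule[OF I])
  show "subring (coinvariants K H \<Delta> I) H"
    by (rule H.subringI) (use B coinvariants_one[OF I] coinvariants_mult[OF I] in auto)
  show "\<Delta> ` coinvariants K H \<Delta> I \<subseteq> tensor_sub K H H (coinvariants K H \<Delta> I) (carrier H)"
    using coinvariants_comult[OF I] by blast
qed

lemma ground_module: "Module.module K (ground_space K)"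
  by (rule moduleI, rule K.cring_axioms, rule abelian_groupI)
    (auto simp: ground_space_def K.a_ac K.l_distr K.r_distr K.m_assoc intro: K.l_neg)

text \<open>Written as a product in H \<otimes> H, \<kappa> can exploit that \<Delta> is
  multiplicative.\<close>

lemma kappa_tens:
  assumes x: "x \<in> carrier H" and y: "y \<in> carrier H"
  shows "kappa (tens K H H x y) = \<Delta> x \<otimes>\<^bsub>HH\<^esub> tens K H H \<one>\<^bsub>H\<^esub> y"
proof -
  have t: "tens K H H \<one>\<^bsub>H\<^esub> y \<in> carrier HH" using y by (simp add: structure_closed)
  have "\<Delta> x \<otimes>\<^bsub>HH\<^esub> tens K H H \<one>\<^bsub>H\<^esub> y = sweedler HH (\<lambda>a b. tens K H H a b \<otimes>\<^bsub>HH\<^esub> tens K H H \<one>\<^bsub>H\<^esub> y) x"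
    by (rule lin_comult_eq_sweedler[OF HH_module lin_HH_mult_left[OF lin_ident t] x])
  also have "\<dots> = sweedler HH (\<lambda>a b. tens K H H a (b \<otimes>\<^bsub>H\<^esub> y)) x"
    by (rule sweedler_cong[OF HH_module _ _ x]) (use y in \<open>auto intro!: lin_intros simp: tens_mult structure_closed\<close>)
  finally show ?thesis by (simp add: theta_tens[OF module mult_bilin x y])
qed

lemma kappa_lin: "kappa \<in> lin K HH HH"
  by (rule theta_lin[OF module mult_bilin])

lemma kappa_inv_lin: "kappa_inv \<in> lin K HH HH"
  by (rule theta_lin[OF module mult_antipode_bilin])

section \<open>Right coideal subalgebras\<close>

context
  fixes B
  assumes B: "right_coideal_subalgebra K H \<Delta> B"
begin

lemma coideal_subalgebra_submodule: "submodule B K H" and coideal_subalgebra_one: "\<one>\<^bsub>H\<^esub> \<in> B"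
  and coideal_subalgebra_comult: "b \<in> B \<Longrightarrow> \<Delta> b \<in> tensor_sub K H H B (carrier H)"
  using B by (auto simp: right_coideal_subalgebra_def dest: subringE(3))

lemmas coideal_subalgebra_closed = submodule_closed[OF module coideal_subalgebra_submodule]

lemma coideal_subalgebra_subset: "B \<subseteq> carrier H"
  using coideal_subalgebra_closed(1) by blast

abbreviation "Bplus \<equiv> augmentation_part K \<epsilon> B"
abbreviation "HBplus \<equiv> left_ideal_gen H Bplus"

lemma Bplus_subset: "Bplus \<subseteq> carrier H"
  using coideal_subalgebra_closed(1) by (auto simp: augmentation_part_def)

lemma HBplus_left_ideal: "left_ideal HBplus H"
  by (rule left_ideal_gen_eq(2)[OF Bplus_subset])

lemma Bplus_in: "b \<in> Bplus \<Longrightarrow> b \<in> HBplus"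
  by (auto simp: left_ideal_gen_def)

lemma minus_counit_Bplus:
  assumes b: "b \<in> B"
  shows "b \<ominus>\<^bsub>H\<^esub> \<epsilon> b \<odot>\<^bsub>H\<^esub> \<one>\<^bsub>H\<^esub> \<in> Bplus"
proof -
  have b': "b \<in> carrier H" by (rule coideal_subalgebra_closed(1)[OF b])
  have "\<epsilon> (b \<ominus>\<^bsub>H\<^esub> \<epsilon> b \<odot>\<^bsub>H\<^esub> \<one>\<^bsub>H\<^esub>) = \<epsilon> b \<ominus>\<^bsub>ground_space K\<^esub> \<epsilon> (\<epsilon> b \<odot>\<^bsub>H\<^esub> \<one>\<^bsub>H\<^esub>)"
    by (rule lin_diff_eq[OF module ground_module counit_lin b']) (simp add: b' counit_closed)
  also have "\<epsilon> (\<epsilon> b \<odot>\<^bsub>H\<^esub> \<one>\<^bsub>H\<^esub>) = \<epsilon> b"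
    using linD(3)[OF counit_lin counit_closed[OF b'] H.one_closed] b'
    by (simp add: ground_space_def counit_one counit_closed)
  also have "\<epsilon> b \<ominus>\<^bsub>ground_space K\<^esub> \<epsilon> b = \<zero>\<^bsub>ground_space K\<^esub>"
    by (rule module_diff_eq_zero_iff[OF ground_module, THEN iffD2]) (simp_all add: ground_space_def counit_closed b')
  finally show ?thesis
    using b b' coideal_subalgebra_closed(5)[OF b coideal_subalgebra_closed(6)[OF counit_closed[OF b'] coideal_subalgebra_one]]
    by (simp add: augmentation_part_def ground_space_def)
qed

text \<open>By the counit axiom the difference is \<open>\<Sum> (b\<^sub>1 - \<epsilon>(b\<^sub>1)
  1) \<otimes> b\<^sub>2 y\<close>, and \<open>b\<^sub>1\<close> may be taken in
  \<open>B\<close>.\<close>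

lemma comult_diff_mem:
  assumes b: "b \<in> B" and y: "y \<in> carrier H"
  shows "\<Delta> b \<otimes>\<^bsub>HH\<^esub> tens K H H \<one>\<^bsub>H\<^esub> y \<ominus>\<^bsub>HH\<^esub> tens K H H \<one>\<^bsub>H\<^esub> (b \<otimes>\<^bsub>H\<^esub> y)
    \<in> tensor_sub K H H HBplus (carrier H)"
proof -
  let ?L = "tensor_lift K H (\<lambda>y z. \<epsilon> y \<odot>\<^bsub>H\<^esub> z)"
  have bil: "bilin K H H H (\<lambda>y z. \<epsilon> y \<odot>\<^bsub>H\<^esub> z)"
    by (intro bilinI lin_scalar lin_smult module lin_ident counit_lin counit_closed)
  note L = tensor_lift_universal[OF module module module bil]
  have t: "tens K H H \<one>\<^bsub>H\<^esub> y \<in> carrier HH" using y by (simp add: structure_closed)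
  \<comment> \<open>Here b is replaced by (\<epsilon> \<otimes> id) (\<Delta> b). The whole
    expression becomes a linear function of \<Delta> b, which lies in B \<otimes> H, so it can be
    tested on c \<otimes> h with c in \<open>B\<close>.\<close>
  define f where "f u = u \<otimes>\<^bsub>HH\<^esub> tens K H H \<one>\<^bsub>H\<^esub> y \<ominus>\<^bsub>HH\<^esub> tens K H H \<one>\<^bsub>H\<^esub> (?L u \<otimes>\<^bsub>H\<^esub> y)" for u
  have f: "f \<in> lin K HH HH"
    unfolding f_def using y t by (intro lin_minus lin_intros L(1)) auto
  have "f (\<Delta> b) \<in> tensor_sub K H H HBplus (carrier H)"
  proof (rule lin_tensor_sub[OF module module HH_module f _ coideal_subalgebra_subset order_refl _ coideal_subalgebra_comult[OF b]])
    show "submodule (tensor_sub K H H HBplus (carrier H)) K HH"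
      by (rule tensor_sub_left_submodule[OF HBplus_left_ideal])
    fix c h assume c: "c \<in> B" and h: "h \<in> carrier H"
    have c': "c \<in> carrier H" by (rule coideal_subalgebra_closed(1)[OF c])
    have hy: "h \<otimes>\<^bsub>H\<^esub> y \<in> carrier H" using h y by simp
    note l = lin_tens_left[OF module module lin_ident hy] and r = lin_tens_right[OF module module H.one_closed lin_ident]
    have "f (tens K H H c h) = tens K H H c (h \<otimes>\<^bsub>H\<^esub> y) \<ominus>\<^bsub>HH\<^esub> tens K H H \<one>\<^bsub>H\<^esub> (\<epsilon> c \<odot>\<^bsub>H\<^esub> (h \<otimes>\<^bsub>H\<^esub> y))"
      using c' h y by (simp add: f_def L(2) tens_mult smult_mult_left counit_closed)
    also have "tens K H H \<one>\<^bsub>H\<^esub> (\<epsilon> c \<odot>\<^bsub>H\<^esub> (h \<otimes>\<^bsub>H\<^esub> y)) = tens K H H (\<epsilon> c \<odot>\<^bsub>H\<^esub> \<one>\<^bsub>H\<^esub>) (h \<otimes>\<^bsub>H\<^esub> y)"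
      using linD(3)[OF l counit_closed[OF c'] H.one_closed] linD(3)[OF r counit_closed[OF c'] hy] by simp
    also have "tens K H H c (h \<otimes>\<^bsub>H\<^esub> y) \<ominus>\<^bsub>HH\<^esub> tens K H H (\<epsilon> c \<odot>\<^bsub>H\<^esub> \<one>\<^bsub>H\<^esub>) (h \<otimes>\<^bsub>H\<^esub> y) =
        tens K H H (c \<ominus>\<^bsub>H\<^esub> \<epsilon> c \<odot>\<^bsub>H\<^esub> \<one>\<^bsub>H\<^esub>) (h \<otimes>\<^bsub>H\<^esub> y)"
      by (rule lin_diff_eq[OF module HH_module l c', symmetric]) (simp add: counit_closed c')
    finally show "f (tens K H H c h) \<in> tensor_sub K H H HBplus (carrier H)"
      using tens_in_tensor_sub[OF Bplus_in[OF minus_counit_Bplus[OF c]] hy] by simp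
  qed
  then show ?thesis using counit_left[OF coideal_subalgebra_closed(1)[OF b]] by (simp add: f_def)
qed

lemma HBplus_coideal: "left_ideal_coideal K H \<Delta> \<epsilon> HBplus"
  unfolding left_ideal_coideal_def
proof (intro conjI)
  let ?N1 = "tensor_sub K H H HBplus (carrier H)" and ?N2 = "tensor_sub K H H (carrier H) HBplus"
  let ?o = "\<lambda>x. tens K H H \<one>\<^bsub>H\<^esub> x"
  show LI: "left_ideal HBplus H" by (rule HBplus_left_ideal)
  have Ic: "HBplus \<subseteq> carrier H" using submodule_closed(1)[OF module left_ideal_submodule[OF LI]] by blast
  have N: "submodule (?N1 <+>\<^bsub>HH\<^esub> ?N2) K HH"
    by (intro submodule_set_add HH_module tensor_sub_submodule module order_refl Ic)
  note G = left_ideal_gen_eq(1)[OF Bplus_subset]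
  have gc: "{x \<otimes>\<^bsub>H\<^esub> a | x a. x \<in> carrier H \<and> a \<in> Bplus} \<subseteq> carrier H" using Bplus_subset by auto
  show "\<Delta> ` HBplus \<subseteq> ?N1 <+>\<^bsub>HH\<^esub> ?N2"
  proof
    fix t assume "t \<in> \<Delta> ` HBplus"
    then obtain z where z: "t = \<Delta> z" "z \<in> HBplus" by blast
    have "\<Delta> z \<in> ?N1 <+>\<^bsub>HH\<^esub> ?N2"
    proof (rule lin_subspace_gen[OF module HH_module comult_lin N gc _ z(2)[unfolded G]])
      fix w assume "w \<in> {x \<otimes>\<^bsub>H\<^esub> a | x a. x \<in> carrier H \<and> a \<in> Bplus}"
      then obtain x a where w: "w = x \<otimes>\<^bsub>H\<^esub> a" "x \<in> carrier H" "a \<in> Bplus" by blast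
      have a: "a \<in> B" "a \<in> carrier H" using w(3) Bplus_subset by (auto simp: augmentation_part_def)
      have c: "\<Delta> x \<in> carrier HH" "\<Delta> a \<in> carrier HH" "?o a \<in> carrier HH" using w a by (simp_all add: structure_closed)
      \<comment> \<open>The bracket is in \<open>HBplus\<close> \<otimes> H, which is stable under
        left multiplication. The last term is in H \<otimes> \<open>HBplus\<close>, because a itself
        lies in that left ideal.\<close>
      have "\<Delta> w = \<Delta> x \<otimes>\<^bsub>HH\<^esub> (\<Delta> a \<ominus>\<^bsub>HH\<^esub> ?o a) \<oplus>\<^bsub>HH\<^esub> \<Delta> x \<otimes>\<^bsub>HH\<^esub> ?o a"
        unfolding w(1) comult_mult[OF w(2) a(2)] using c by algebra
      moreover have "\<Delta> x \<otimes>\<^bsub>HH\<^esub> (\<Delta> a \<ominus>\<^bsub>HH\<^esub> ?o a) \<in> ?N1"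
        using comult_diff_mem[OF a(1) H.one_closed] a c
        by (intro left_ideal_tensor_mult_left[OF LI]) (simp_all flip: one_HH)
      moreover have "\<Delta> x \<otimes>\<^bsub>HH\<^esub> ?o a \<in> ?N2"
        by (rule HH_mult_tensor_sub[OF order_refl _ Ic _ c(1)])
          (use LI w Bplus_in in \<open>auto simp: left_ideal_def intro!: tens_in_tensor_sub\<close>)
      ultimately show "\<Delta> w \<in> ?N1 <+>\<^bsub>HH\<^esub> ?N2" unfolding set_add_def' by blast
    qed
    then show "t \<in> ?N1 <+>\<^bsub>HH\<^esub> ?N2" by (simp add: z)
  qed
  show "\<forall>x\<in>HBplus. \<epsilon> x = \<zero>\<^bsub>K\<^esub>"
  proof
    fix z assume z: "z \<in> HBplus"
    have "\<epsilon> z \<in> {\<zero>\<^bsub>ground_space K\<^esub>}"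
      by (rule lin_subspace_gen[OF module ground_module counit_lin submodule_zero[OF ground_module] gc _ z[unfolded G]])
        (use Bplus_subset in \<open>auto simp: counit_mult counit_closed augmentation_part_def ground_space_def subset_iff\<close>)
    then show "\<epsilon> z = \<zero>\<^bsub>K\<^esub>" by (simp add: ground_space_def)
  qed
qed

section \<open>The balanced tensor product over \<open>B\<close> and the equalizer condition\<close>

abbreviation "balanced_gens \<equiv> {tens K H H (x \<otimes>\<^bsub>H\<^esub> b) y \<ominus>\<^bsub>HH\<^esub> tens K H H x (b \<otimes>\<^bsub>H\<^esub> y) | x b y.
  x \<in> carrier H \<and> b \<in> B \<and> y \<in> carrier H}"

lemma balanced_gens_subset: "balanced_gens \<subseteq> carrier HH"
  using coideal_subalgebra_closed(1) by (auto simp: structure_closed)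

lemma balanced_null_submodule: "submodule (balanced_null K H B) K HH"
  unfolding balanced_null_def by (rule subspace_gen_submodule[OF HH_module balanced_gens_subset])

lemma balanced_gen_mem:
  "x \<in> carrier H \<Longrightarrow> b \<in> B \<Longrightarrow> y \<in> carrier H \<Longrightarrow>
    tens K H H (x \<otimes>\<^bsub>H\<^esub> b) y \<ominus>\<^bsub>HH\<^esub> tens K H H x (b \<otimes>\<^bsub>H\<^esub> y) \<in> balanced_null K H B"
  unfolding balanced_null_def by (rule subsetD[OF subspace_gen_incl]) blast

text \<open>Multiplicativity of \<Delta> gives \<kappa> (x b \<otimes> y - x \<otimes> b y) =
  \<Delta> x (\<Delta> b (1 \<otimes> y) - 1 \<otimes> b y), and \<open>comult_diff_mem\<close>
  handles the second factor.\<close>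

lemma kappa_balanced_null:
  assumes u: "u \<in> balanced_null K H B"
  shows "kappa u \<in> tensor_sub K H H HBplus (carrier H)"
proof (rule lin_subspace_gen[OF HH_module HH_module kappa_lin _ balanced_gens_subset _ u[unfolded balanced_null_def]])
  show "submodule (tensor_sub K H H HBplus (carrier H)) K HH"
    by (rule tensor_sub_left_submodule[OF HBplus_left_ideal])
  let ?o = "\<lambda>x. tens K H H \<one>\<^bsub>H\<^esub> x"
  fix w assume "w \<in> balanced_gens"
  then obtain x b y where w: "w = tens K H H (x \<otimes>\<^bsub>H\<^esub> b) y \<ominus>\<^bsub>HH\<^esub> tens K H H x (b \<otimes>\<^bsub>H\<^esub> y)"
    "x \<in> carrier H" "b \<in> B" "y \<in> carrier H" by blast
  have b: "b \<in> carrier H" by (rule coideal_subalgebra_closed(1)[OF w(3)])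
  have c: "\<Delta> x \<in> carrier HH" "\<Delta> b \<in> carrier HH" "?o y \<in> carrier HH" "?o (b \<otimes>\<^bsub>H\<^esub> y) \<in> carrier HH"
    using w b by (simp_all add: structure_closed)
  have "kappa w = kappa (tens K H H (x \<otimes>\<^bsub>H\<^esub> b) y) \<ominus>\<^bsub>HH\<^esub> kappa (tens K H H x (b \<otimes>\<^bsub>H\<^esub> y))"
    unfolding w(1) by (rule lin_diff_eq[OF HH_module HH_module kappa_lin]) (use w b in \<open>simp_all add: structure_closed\<close>)
  also have "\<dots> = (\<Delta> x \<otimes>\<^bsub>HH\<^esub> \<Delta> b) \<otimes>\<^bsub>HH\<^esub> ?o y \<ominus>\<^bsub>HH\<^esub> \<Delta> x \<otimes>\<^bsub>HH\<^esub> ?o (b \<otimes>\<^bsub>H\<^esub> y)"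
    using w b by (simp add: kappa_tens comult_mult)
  also have "\<dots> = \<Delta> x \<otimes>\<^bsub>HH\<^esub> (\<Delta> b \<otimes>\<^bsub>HH\<^esub> ?o y \<ominus>\<^bsub>HH\<^esub> ?o (b \<otimes>\<^bsub>H\<^esub> y))"
    using c by algebra
  also have "\<dots> \<in> tensor_sub K H H HBplus (carrier H)"
    by (intro left_ideal_tensor_mult_left[OF HBplus_left_ideal] comult_diff_mem c w)
  finally show "kappa w \<in> tensor_sub K H H HBplus (carrier H)" .
qed

lemma balanced_null_mult_left:
  assumes x: "x \<in> carrier H" and u: "u \<in> balanced_null K H B"
  shows "tens K H H x \<one>\<^bsub>H\<^esub> \<otimes>\<^bsub>HH\<^esub> u \<in> balanced_null K H B"
proof -
  have t: "tens K H H x \<one>\<^bsub>H\<^esub> \<in> carrier HH" using x by (simp add: structure_closed)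
  note l = lin_HH_mult_right[OF t lin_ident]
  show ?thesis
  proof (rule lin_subspace_gen[OF HH_module HH_module l balanced_null_submodule balanced_gens_subset _ u[unfolded balanced_null_def]])
    fix w assume "w \<in> balanced_gens"
    then obtain z b y where w: "w = tens K H H (z \<otimes>\<^bsub>H\<^esub> b) y \<ominus>\<^bsub>HH\<^esub> tens K H H z (b \<otimes>\<^bsub>H\<^esub> y)"
      "z \<in> carrier H" "b \<in> B" "y \<in> carrier H" by blast
    have b: "b \<in> carrier H" by (rule coideal_subalgebra_closed(1)[OF w(3)])
    have "tens K H H x \<one>\<^bsub>H\<^esub> \<otimes>\<^bsub>HH\<^esub> w = tens K H H x \<one>\<^bsub>H\<^esub> \<otimes>\<^bsub>HH\<^esub> tens K H H (z \<otimes>\<^bsub>H\<^esub> b) y \<ominus>\<^bsub>HH\<^esub>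
        tens K H H x \<one>\<^bsub>H\<^esub> \<otimes>\<^bsub>HH\<^esub> tens K H H z (b \<otimes>\<^bsub>H\<^esub> y)"
      unfolding w(1) by (rule lin_diff_eq[OF HH_module HH_module l]) (use w b in \<open>simp_all add: structure_closed\<close>)
    also have "\<dots> = tens K H H ((x \<otimes>\<^bsub>H\<^esub> z) \<otimes>\<^bsub>H\<^esub> b) y \<ominus>\<^bsub>HH\<^esub> tens K H H (x \<otimes>\<^bsub>H\<^esub> z) (b \<otimes>\<^bsub>H\<^esub> y)"
      using w b x by (simp add: tens_mult H.m_assoc)
    also have "\<dots> \<in> balanced_null K H B" by (rule balanced_gen_mem) (use w x in auto)
    finally show "tens K H H x \<one>\<^bsub>H\<^esub> \<otimes>\<^bsub>HH\<^esub> w \<in> balanced_null K H B" .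
  qed
qed

text \<open>\<kappa> turns left multiplication by x \<otimes> 1 into left multiplication by \<Delta>
  x, again by multiplicativity of \<Delta>; the inverse translates back.\<close>

lemma kappa_inv_comult:
  assumes x: "x \<in> carrier H" and u: "u \<in> carrier HH"
  shows "kappa_inv (\<Delta> x \<otimes>\<^bsub>HH\<^esub> u) = tens K H H x \<one>\<^bsub>H\<^esub> \<otimes>\<^bsub>HH\<^esub> kappa_inv u"
proof -
  have t: "tens K H H x \<one>\<^bsub>H\<^esub> \<in> carrier HH" using x by (simp add: structure_closed)
  have k: "kappa (tens K H H x \<one>\<^bsub>H\<^esub> \<otimes>\<^bsub>HH\<^esub> v) = \<Delta> x \<otimes>\<^bsub>HH\<^esub> kappa v" if v: "v \<in> carrier HH" for v
  proof (rule lin_eq_on_tensor[OF module module HH_module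
        lin_comp[OF lin_HH_mult_right[OF t lin_ident] kappa_lin] lin_HH_mult_right[OF comult_closed[OF x] kappa_lin] _ v])
    fix a b assume ab: "a \<in> carrier H" "b \<in> carrier H"
    then show "kappa (tens K H H x \<one>\<^bsub>H\<^esub> \<otimes>\<^bsub>HH\<^esub> tens K H H a b) = \<Delta> x \<otimes>\<^bsub>HH\<^esub> kappa (tens K H H a b)"
      using x by (simp add: tens_mult kappa_tens comult_mult HH_mult_assoc structure_closed)
  qed
  have v: "kappa_inv u \<in> carrier HH" by (rule linD(1)[OF kappa_inv_lin u])
  have "kappa (tens K H H x \<one>\<^bsub>H\<^esub> \<otimes>\<^bsub>HH\<^esub> kappa_inv u) = \<Delta> x \<otimes>\<^bsub>HH\<^esub> u"
    using k[OF v] by (simp add: kappa_inverse(2) u)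
  then show ?thesis using kappa_inverse(3)[OF HH_mult_closed[OF t v]] by simp
qed

text \<open>Since \<Delta> b lies in B \<otimes> H, the factor \<open>b\<^sub>1\<close> in
  \<open>\<Sum> b\<^sub>1 \<otimes> S b\<^sub>2 y\<close> may be moved across the balanced tensor
  sign. This leaves \<open>1 \<otimes> \<Sum> b\<^sub>1 S b\<^sub>2 y\<close>, which is \<epsilon> b
  (1 \<otimes> y) = 0.\<close>

lemma kappa_inv_Bplus:
  assumes b: "b \<in> Bplus" and y: "y \<in> carrier H"
  shows "kappa_inv (tens K H H b y) \<in> balanced_null K H B"
proof -
  have bB: "b \<in> B" and b': "b \<in> carrier H" and eb: "\<epsilon> b = \<zero>\<^bsub>K\<^esub>"
    using b Bplus_subset by (auto simp: augmentation_part_def)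
  have bf: "bilin K H H HH (\<lambda>a c. tens K H H a (S c \<otimes>\<^bsub>H\<^esub> y))"
    by (rule theta_inner_bilin[OF module mult_antipode_bilin y])
  have bg: "bilin K H H H (\<lambda>a c. a \<otimes>\<^bsub>H\<^esub> (S c \<otimes>\<^bsub>H\<^esub> y))"
    using y by (intro lin_intros) (simp_all add: structure_closed)
  note f = tensor_lift_universal[OF module module HH_module bf]
  note g = tensor_lift_universal[OF module module module bg]
  \<comment> \<open>The element before moving minus the element after moving, as a linear function
    of \<Delta> b. On c \<otimes> h with c in \<open>B\<close> it is the defining relation with x =
    1.\<close>
  define F where "F u = tensor_lift K HH (\<lambda>a c. tens K H H a (S c \<otimes>\<^bsub>H\<^esub> y)) u \<ominus>\<^bsub>HH\<^esub>
      tens K H H \<one>\<^bsub>H\<^esub> (tensor_lift K H (\<lambda>a c. a \<otimes>\<^bsub>H\<^esub> (S c \<otimes>\<^bsub>H\<^esub> y)) u)" for u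
  have F: "F \<in> lin K HH HH" unfolding F_def by (intro lin_minus HH_module f g lin_tens_right module H.one_closed)
  have "F (\<Delta> b) \<in> balanced_null K H B"
  proof (rule lin_tensor_sub[OF module module HH_module F balanced_null_submodule coideal_subalgebra_subset order_refl _ coideal_subalgebra_comult[OF bB]])
    fix c h assume c: "c \<in> B" and h: "h \<in> carrier H"
    then show "F (tens K H H c h) \<in> balanced_null K H B"
      using balanced_gen_mem[OF H.one_closed c, of "S h \<otimes>\<^bsub>H\<^esub> y"] y coideal_subalgebra_closed(1)[OF c]
      by (simp add: F_def f(2) g(2) antipode_closed)
  qed
  moreover have "F (\<Delta> b) = kappa_inv (tens K H H b y) \<ominus>\<^bsub>HH\<^esub> tens K H H \<one>\<^bsub>H\<^esub> (sweedler H (\<lambda>a c. a \<otimes>\<^bsub>H\<^esub> (S c \<otimes>\<^bsub>H\<^esub> y)) b)"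
    by (simp add: F_def theta_tens[OF module mult_antipode_bilin b' y]) (simp add: sweedler_def)
  moreover have "sweedler H (\<lambda>a c. a \<otimes>\<^bsub>H\<^esub> (S c \<otimes>\<^bsub>H\<^esub> y)) b = \<zero>\<^bsub>H\<^esub>"
  proof -
    have "sweedler H (\<lambda>a c. a \<otimes>\<^bsub>H\<^esub> (S c \<otimes>\<^bsub>H\<^esub> y)) b = sweedler H (\<lambda>a c. (a \<otimes>\<^bsub>H\<^esub> S c) \<otimes>\<^bsub>H\<^esub> y) b"
      by (rule sweedler_cong[OF module bg _ b']) (simp add: H.m_assoc antipode_closed y)
    also have "\<dots> = \<zero>\<^bsub>H\<^esub>"
      using sweedler_antipode_right[OF module lin_mult_left[OF lin_ident y] b'] y by (simp add: eb)
    finally show ?thesis .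
  qed
  moreover have "tens K H H \<one>\<^bsub>H\<^esub> \<zero>\<^bsub>H\<^esub> = \<zero>\<^bsub>HH\<^esub>"
    by (rule lin_zero_neg(1)[OF module HH_module one_tens_lin])
  moreover have "kappa_inv (tens K H H b y) \<in> carrier HH"
    by (rule linD(1)[OF kappa_inv_lin]) (simp add: structure_closed b' y)
  ultimately show ?thesis by (simp add: module_diff_zero[OF HH_module])
qed

text \<open>The identity \<open>x b \<otimes> y = \<Sum> \<Delta> x\<^sub>1 (b \<otimes> S x\<^sub>2 y)\<close> reduces the claim to \<open>kappa_inv_Bplus\<close> without
  using that \<open>S\<close> is antimultiplicative.\<close>

lemma kappa_inv_HBplus:
  assumes u: "u \<in> tensor_sub K H H HBplus (carrier H)"
  shows "kappa_inv u \<in> balanced_null K H B"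
proof -
  have Ic: "HBplus \<subseteq> carrier H"
    using submodule_closed(1)[OF module left_ideal_submodule[OF HBplus_left_ideal]] by blast
  have gc: "{x \<otimes>\<^bsub>H\<^esub> a | x a. x \<in> carrier H \<and> a \<in> Bplus} \<subseteq> carrier H" using Bplus_subset by auto
  show ?thesis
  proof (rule lin_tensor_sub[OF module module HH_module kappa_inv_lin balanced_null_submodule Ic order_refl _ u])
    fix w y assume w: "w \<in> HBplus" and y: "y \<in> carrier H"
    show "kappa_inv (tens K H H w y) \<in> balanced_null K H B"
    proof (rule lin_subspace_gen[OF module HH_module lin_comp[OF lin_tens_left[OF module module lin_ident y] kappa_inv_lin]
          balanced_null_submodule gc _ w[unfolded left_ideal_gen_eq(1)[OF Bplus_subset]]])
      fix v assume "v \<in> {x \<otimes>\<^bsub>H\<^esub> a | x a. x \<in> carrier H \<and> a \<in> Bplus}"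
      then obtain x b where v: "v = x \<otimes>\<^bsub>H\<^esub> b" and x: "x \<in> carrier H" and b: "b \<in> Bplus" by blast
      have b': "b \<in> carrier H" using b Bplus_subset by blast
      have tb: "tens K H H b \<one>\<^bsub>H\<^esub> \<in> carrier HH" using b' by (simp add: structure_closed)
      note l = lin_HH_mult_left[OF kappa_lin tb]
      have txy: "tens K H H x y \<in> carrier HH" using x y by (simp add: structure_closed)
      have bl: "bilin K H H HH (\<lambda>a c. \<Delta> a \<otimes>\<^bsub>HH\<^esub> tens K H H b (S c \<otimes>\<^bsub>H\<^esub> y))"
        using b' y by (intro lin_intros) (simp_all add: structure_closed)
      \<comment> \<open>Expanding x \<otimes> y as \<kappa> of its preimage and multiplying on the
        right by b \<otimes> 1 moves b next to \<Delta> of the first Sweedler component. Then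
        \<open>kappa_inv_comult\<close> extracts that component, and \<open>kappa_inv_Bplus\<close>
        applies to what is left.\<close>
      have "tens K H H v y = kappa (kappa_inv (tens K H H x y)) \<otimes>\<^bsub>HH\<^esub> tens K H H b \<one>\<^bsub>H\<^esub>"
        using x y b' by (simp add: kappa_inverse txy tens_mult v)
      also have "\<dots> = sweedler HH (\<lambda>a c. kappa (tens K H H a (S c \<otimes>\<^bsub>H\<^esub> y)) \<otimes>\<^bsub>HH\<^esub> tens K H H b \<one>\<^bsub>H\<^esub>) x"
        unfolding theta_tens[OF module mult_antipode_bilin x y]
        by (rule lin_of_sweedler[OF HH_module HH_module l theta_inner_bilin[OF module mult_antipode_bilin y] x])
      also have "\<dots> = sweedler HH (\<lambda>a c. \<Delta> a \<otimes>\<^bsub>HH\<^esub> tens K H H b (S c \<otimes>\<^bsub>H\<^esub> y)) x"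
        by (rule sweedler_cong[OF HH_module bl _ x, symmetric])
          (use y b' in \<open>simp add: kappa_tens antipode_closed HH_mult_assoc structure_closed tens_mult\<close>)
      finally have "kappa_inv (tens K H H v y) = sweedler HH (\<lambda>a c. kappa_inv (\<Delta> a \<otimes>\<^bsub>HH\<^esub> tens K H H b (S c \<otimes>\<^bsub>H\<^esub> y))) x"
        by (simp add: lin_of_sweedler[OF HH_module HH_module kappa_inv_lin bl x])
      also have "\<dots> \<in> balanced_null K H B"
      proof (rule sweedler_in[OF HH_module _ balanced_null_submodule _ x])
        show "bilin K H H HH (\<lambda>a c. kappa_inv (\<Delta> a \<otimes>\<^bsub>HH\<^esub> tens K H H b (S c \<otimes>\<^bsub>H\<^esub> y)))"
          by (rule bilinI) (intro lin_comp[OF _ kappa_inv_lin] bilin_left[OF bl lin_ident] bilin_right[OF bl _ lin_ident]; assumption)+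
        fix a c assume ac: "a \<in> carrier H" "c \<in> carrier H"
        then show "kappa_inv (\<Delta> a \<otimes>\<^bsub>HH\<^esub> tens K H H b (S c \<otimes>\<^bsub>H\<^esub> y)) \<in> balanced_null K H B"
          using y b b' by (subst kappa_inv_comult) (auto intro!: balanced_null_mult_left kappa_inv_Bplus simp: structure_closed)
      qed
      finally show "kappa_inv (tens K H H v y) \<in> balanced_null K H B" .
    qed
  qed
qed

lemma equalizer_iff:
  "is_equalizer K (H\<lparr>carrier := B\<rparr>) H (balanced_tensor K H B) (\<lambda>b. b)
     (\<lambda>x. balanced_tens K H B x \<one>\<^bsub>H\<^esub>) (\<lambda>x. balanced_tens K H B \<one>\<^bsub>H\<^esub> x) \<longleftrightarrow>
   B = coinvariants K H \<Delta> HBplus"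
proof -
  note pr = quot_space_proj[OF HH_module balanced_null_submodule]
  have Y: "Module.module K (balanced_tensor K H B)"
    unfolding balanced_tensor_def by (rule quot_space_module[OF HH_module balanced_null_submodule])
  have f: "(\<lambda>x. balanced_tens K H B x \<one>\<^bsub>H\<^esub>) \<in> lin K H (balanced_tensor K H B)"
    "(\<lambda>x. balanced_tens K H B \<one>\<^bsub>H\<^esub> x) \<in> lin K H (balanced_tensor K H B)"
    unfolding balanced_tens_def balanced_tensor_def
    by (intro lin_comp[OF _ pr] lin_tens_left lin_tens_right module lin_ident H.one_closed)+
  have "balanced_tens K H B x \<one>\<^bsub>H\<^esub> = balanced_tens K H B \<one>\<^bsub>H\<^esub> x \<longleftrightarrow> x \<in> coinvariants K H \<Delta> HBplus"
    if x: "x \<in> carrier H" for x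
  proof -
    let ?u = "tens K H H x \<one>\<^bsub>H\<^esub> \<ominus>\<^bsub>HH\<^esub> tens K H H \<one>\<^bsub>H\<^esub> x"
    have c: "tens K H H x \<one>\<^bsub>H\<^esub> \<in> carrier HH" "tens K H H \<one>\<^bsub>H\<^esub> x \<in> carrier HH" using x by (simp_all add: structure_closed)
    have u: "?u \<in> carrier HH" using c by simp
    have "balanced_tens K H B x \<one>\<^bsub>H\<^esub> = balanced_tens K H B \<one>\<^bsub>H\<^esub> x \<longleftrightarrow> ?u \<in> balanced_null K H B"
      unfolding balanced_tens_def by (rule quot_space_proj_eq_iff[OF HH_module balanced_null_submodule c])
    also have "\<dots> \<longleftrightarrow> kappa ?u \<in> tensor_sub K H H HBplus (carrier H)"
      using kappa_balanced_null kappa_inv_HBplus[of "kappa ?u"] kappa_inverse(3)[OF u] by metis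
    also have "kappa ?u = \<Delta> x \<ominus>\<^bsub>HH\<^esub> tens K H H \<one>\<^bsub>H\<^esub> x"
      using x c by (simp add: lin_diff_eq[OF HH_module HH_module kappa_lin] kappa_tens comult_one comult_closed tens_mult flip: one_HH)
    finally show ?thesis using x by (simp add: coinvariants_iff[OF HBplus_left_ideal])
  qed
  moreover have "coinvariants K H \<Delta> HBplus \<subseteq> carrier H" by (auto simp: coinvariants_def)
  ultimately have "{x \<in> carrier H. balanced_tens K H B x \<one>\<^bsub>H\<^esub> = balanced_tens K H B \<one>\<^bsub>H\<^esub> x} = coinvariants K H \<Delta> HBplus"
    by blast
  then show ?thesis by (simp only: is_equalizer_subspace_iff[OF module Y f coideal_subalgebra_submodule])
qed

end

section \<open>The cotensor product\<close>

context
  fixes I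
  assumes I: "left_ideal I H"
begin

abbreviation "QH \<equiv> tensor K (quot_space K H I) H"
abbreviation "proj_mid \<equiv> tensor_map K H QH (\<lambda>y. y) (proj_left I)"
abbreviation "theta_HH \<equiv> theta HH comult_act"

lemma tensor_sub_left_subset: "tensor_sub K H H I (carrier H) \<subseteq> carrier HH"
  using submodule_closed(1)[OF HH_module tensor_sub_left_submodule[OF I]] by blast

lemma QH_module: "Module.module K QH"
  by (intro tensor_module quot_module I module)

lemma H_HH_module: "Module.module K (tensor K H HH)"
  and H_QH_module: "Module.module K (tensor K H QH)"
  by (intro tensor_module module HH_module QH_module)+

lemma theta_HH_lin: "theta_HH \<in> lin K (tensor K H HH) (tensor K H HH)"
  by (rule theta_lin[OF HH_module comult_act_bilin])

lemma proj_mid_lin: "proj_mid \<in> lin K (tensor K H HH) (tensor K H QH)"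
  by (intro tensor_map_lin module HH_module QH_module lin_ident proj_left_lin I)

lemma proj_mid_kernel:
  assumes "t \<in> carrier (tensor K H HH)"
  shows "proj_mid t = \<zero>\<^bsub>tensor K H QH\<^esub> \<longleftrightarrow> t \<in> tensor_sub K H HH (carrier H) (tensor_sub K H H I (carrier H))"
proof -
  have "{v \<in> carrier HH. proj_left I v = \<zero>\<^bsub>QH\<^esub>} = tensor_sub K H H I (carrier H)"
    using proj_left_kernel[OF I] tensor_sub_left_subset by blast
  then show ?thesis
    using tensor_map_right_kernel_iff[OF field HH_module QH_module module proj_left_lin[OF I] assms] by simp
qed

text \<open>Left multiplication by \<Delta> b and by \<Delta> (S b) preserves I \<otimes> H, so both
  the twist and its inverse preserve H \<otimes> (I \<otimes> H).\<close>

lemma theta_HH_mem_iff: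
  assumes t: "t \<in> carrier (tensor K H HH)"
  shows "theta_HH t \<in> tensor_sub K H HH (carrier H) (tensor_sub K H H I (carrier H)) \<longleftrightarrow>
    t \<in> tensor_sub K H HH (carrier H) (tensor_sub K H H I (carrier H))"
proof
  let ?N = "tensor_sub K H H I (carrier H)"
  have st: "comult_act b m \<in> ?N" if "b \<in> carrier H" "m \<in> ?N" for b m
    unfolding comult_act_def by (rule left_ideal_tensor_mult_left[OF I comult_closed[OF that(1)] that(2)])
  show "t \<in> tensor_sub K H HH (carrier H) ?N \<Longrightarrow> theta_HH t \<in> tensor_sub K H HH (carrier H) ?N"
    by (rule theta_in[OF HH_module comult_act_bilin tensor_sub_left_subset st])
  assume "theta_HH t \<in> tensor_sub K H HH (carrier H) ?N"
  then have "theta HH (\<lambda>b. comult_act (S b)) (theta_HH t) \<in> tensor_sub K H HH (carrier H) ?N"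
    by (intro theta_in[OF HH_module comult_act_antipode_bilin tensor_sub_left_subset st] antipode_closed)
  then show "t \<in> tensor_sub K H HH (carrier H) ?N" by (simp add: comult_act_inverse(3) t)
qed

text \<open>On x \<otimes> z both sides are
  \<open>\<Sum> x\<^sub>1 \<otimes> x\<^sub>2 \<otimes> x\<^sub>3 z\<close>: coassociativity shifts
  the second comultiplication to \<open>x\<^sub>2\<close>, where it appears as
  \<open>\<Delta> x\<^sub>2 (1 \<otimes> z)\<close>.\<close>

lemma assoc_kappa:
  assumes s: "s \<in> carrier HH"
  shows "tensor_assoc K H H H (tensor_map K HH H \<Delta> (\<lambda>y. y) (kappa s)) =
    theta_HH (tensor_map K H HH (\<lambda>y. y) (tens K H H \<one>\<^bsub>H\<^esub>) s)"
proof (rule lin_eq_on_tensor[OF module module H_HH_module _ _ _ s,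
      where f = "\<lambda>s. tensor_assoc K H H H (tensor_map K HH H \<Delta> (\<lambda>y. y) (kappa s))"])
  let ?Z = "tensor K H HH"
  let ?A = "\<lambda>t. tensor_assoc K H H H (tensor_map K HH H \<Delta> (\<lambda>y. y) t)"
  have A: "?A \<in> lin K HH ?Z"
    by (intro lin_comp[OF _ tensor_assoc_lin] tensor_map_lin module HH_module comult_lin lin_ident)
  show "(\<lambda>s. ?A (kappa s)) \<in> lin K HH ?Z" by (rule lin_comp[OF kappa_lin A])
  show "(\<lambda>s. theta_HH (tensor_map K H HH (\<lambda>y. y) (tens K H H \<one>\<^bsub>H\<^esub>) s)) \<in> lin K HH ?Z"
    by (intro lin_comp[OF _ theta_HH_lin] tensor_map_lin module HH_module lin_ident one_tens_lin)
  fix x z assume x: "x \<in> carrier H" and z: "z \<in> carrier H"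
  have b1: "bilin K H H ?Z (\<lambda>c d. tens K H HH a (tens K H H c (d \<otimes>\<^bsub>H\<^esub> z)))" if "a \<in> carrier H" for a
    using z that by (intro lin_intros) (simp_all add: structure_closed)
  have b2: "(\<lambda>a. tens K H HH a (tens K H H c (d \<otimes>\<^bsub>H\<^esub> z))) \<in> lin K H ?Z" if "c \<in> carrier H" "d \<in> carrier H" for c d
    using z that by (intro lin_intros) (simp_all add: structure_closed)
  have bz: "bilin K H H HH (\<lambda>c d. tens K H H c (d \<otimes>\<^bsub>H\<^esub> z))"
    by (rule theta_inner_bilin[OF module mult_bilin z])
  have oz: "tens K H H \<one>\<^bsub>H\<^esub> z \<in> carrier HH" using z by (simp add: structure_closed)
  have "?A (kappa (tens K H H x z)) = sweedler ?Z (\<lambda>a b. ?A (tens K H H a (b \<otimes>\<^bsub>H\<^esub> z))) x"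
    unfolding theta_tens[OF module mult_bilin x z]
    by (rule lin_of_sweedler[OF HH_module H_HH_module A bz x])
  also have "\<dots> = sweedler ?Z (\<lambda>a b. sweedler ?Z (\<lambda>c d. tens K H HH c (tens K H H d (b \<otimes>\<^bsub>H\<^esub> z))) a) x"
  proof (rule sweedler_cong[OF H_HH_module _ _ x])
    show "bilin K H H ?Z (\<lambda>a b. ?A (tens K H H a (b \<otimes>\<^bsub>H\<^esub> z)))"
      by (rule bilinI) (intro lin_comp[OF _ A] bilin_left[OF bz lin_ident] bilin_right[OF bz _ lin_ident]; assumption)+
    fix a b assume ab: "a \<in> carrier H" "b \<in> carrier H"
    then show "?A (tens K H H a (b \<otimes>\<^bsub>H\<^esub> z)) = sweedler ?Z (\<lambda>c d. tens K H HH c (tens K H H d (b \<otimes>\<^bsub>H\<^esub> z))) a"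
      using z by (simp add: tensor_map_tens[OF _ _ _ _ comult_lin lin_ident] structure_closed tensor_assoc_tens2 sweedler_def)
  qed
  also have "\<dots> = sweedler ?Z (\<lambda>a b. sweedler ?Z (\<lambda>c d. tens K H HH a (tens K H H c (d \<otimes>\<^bsub>H\<^esub> z))) b) x"
    by (rule sweedler_coassoc[OF H_HH_module b1 b2 x])
  also have "\<dots> = sweedler ?Z (\<lambda>a b. tens K H HH a (comult_act b (tens K H H \<one>\<^bsub>H\<^esub> z))) x"
  proof (rule sweedler_cong[OF H_HH_module theta_inner_bilin[OF HH_module comult_act_bilin oz] _ x, symmetric])
    fix a b assume ab: "a \<in> carrier H" "b \<in> carrier H"
    have "comult_act b (tens K H H \<one>\<^bsub>H\<^esub> z) = sweedler HH (\<lambda>c d. tens K H H c (d \<otimes>\<^bsub>H\<^esub> z)) b"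
      using kappa_tens[OF ab(2) z] by (simp add: comult_act_def theta_tens[OF module mult_bilin ab(2) z])
    then show "tens K H HH a (comult_act b (tens K H H \<one>\<^bsub>H\<^esub> z)) =
        sweedler ?Z (\<lambda>c d. tens K H HH a (tens K H H c (d \<otimes>\<^bsub>H\<^esub> z))) b"
      using lin_of_sweedler[OF HH_module H_HH_module lin_tens_right[OF module HH_module ab(1) lin_ident] bz ab(2)] by simp
  qed
  also have "\<dots> = theta_HH (tensor_map K H HH (\<lambda>y. y) (tens K H H \<one>\<^bsub>H\<^esub>) (tens K H H x z))"
    by (simp add: tensor_map_tens[OF module module module HH_module lin_ident one_tens_lin x z]
        theta_tens[OF HH_module comult_act_bilin x oz])
  finally show "?A (kappa (tens K H H x z)) = theta_HH (tensor_map K H HH (\<lambda>y. y) (tens K H H \<one>\<^bsub>H\<^esub>) (tens K H H x z))" .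
qed

text \<open>Here the twist comes from
  \<open>\<Delta> (x\<^sub>2 z) = \<Delta> x\<^sub>2 \<Delta> z\<close>. It is the same twist as in
  \<open>assoc_kappa\<close>, which makes the two sides of the cotensor equation comparable.\<close>

lemma comult_kappa:
  assumes s: "s \<in> carrier HH"
  shows "tensor_map K H HH (\<lambda>y. y) \<Delta> (kappa s) = theta_HH (tensor_map K H HH (\<lambda>y. y) \<Delta> s)"
proof (rule lin_eq_on_tensor[OF module module H_HH_module _ _ _ s])
  let ?Z = "tensor K H HH"
  let ?A = "tensor_map K H HH (\<lambda>y. y) \<Delta>"
  have A: "?A \<in> lin K HH ?Z" by (intro tensor_map_lin module HH_module comult_lin lin_ident)
  show "(\<lambda>s. ?A (kappa s)) \<in> lin K HH ?Z" by (rule lin_comp[OF kappa_lin A])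
  show "(\<lambda>s. theta_HH (?A s)) \<in> lin K HH ?Z" by (rule lin_comp[OF A theta_HH_lin])
  fix x z assume x: "x \<in> carrier H" and z: "z \<in> carrier H"
  have bz: "bilin K H H HH (\<lambda>c d. tens K H H c (d \<otimes>\<^bsub>H\<^esub> z))"
    by (rule theta_inner_bilin[OF module mult_bilin z])
  have "?A (kappa (tens K H H x z)) = sweedler ?Z (\<lambda>a b. ?A (tens K H H a (b \<otimes>\<^bsub>H\<^esub> z))) x"
    unfolding theta_tens[OF module mult_bilin x z]
    by (rule lin_of_sweedler[OF HH_module H_HH_module A bz x])
  also have "\<dots> = sweedler ?Z (\<lambda>a b. tens K H HH a (comult_act b (\<Delta> z))) x"
    by (rule sweedler_cong[OF H_HH_module theta_inner_bilin[OF HH_module comult_act_bilin comult_closed[OF z]] _ x, symmetric])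
      (use z in \<open>simp add: tensor_map_tens[OF module module module HH_module lin_ident comult_lin] comult_act_def comult_mult\<close>)
  also have "\<dots> = theta_HH (?A (tens K H H x z))"
    by (simp add: tensor_map_tens[OF module module module HH_module lin_ident comult_lin x z]
        theta_tens[OF HH_module comult_act_bilin x comult_closed[OF z]])
  finally show "?A (kappa (tens K H H x z)) = theta_HH (?A (tens K H H x z))" .
qed

lemma right_coaction_lin: "right_coaction K H \<Delta> I \<in> lin K H (tensor K H (quot_space K H I))"
  unfolding right_coaction_def[abs_def]
  by (intro lin_comp[OF comult_lin] tensor_map_lin module quot_module I lin_ident proj_lin)

lemma left_coaction_lin: "left_coaction K H \<Delta> I \<in> lin K H QH"
  unfolding left_coaction_def[abs_def] by (rule lin_comp[OF comult_lin proj_left_lin[OF I]])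

lemma cotensor_left:
  assumes t: "t \<in> carrier HH"
  shows "tensor_assoc K H (quot_space K H I) H
      (tensor_map K (tensor K H (quot_space K H I)) H (right_coaction K H \<Delta> I) (\<lambda>y. y) t) =
    proj_mid (tensor_assoc K H H H (tensor_map K HH H \<Delta> (\<lambda>y. y) t))"
proof -
  let ?Q = "quot_space K H I"
  let ?as = "tensor_assoc K H ?Q H" and ?m = "tensor_map K (tensor K H ?Q) H (right_coaction K H \<Delta> I) (\<lambda>y. y)"
  note Q = quot_module[OF I] and pr = proj_lin[OF I]
  have HQ: "Module.module K (tensor K H ?Q)" by (intro tensor_module module Q)
  note as = tensor_assoc_lin[OF module Q module] and aH = tensor_assoc_lin[OF module module module]
  note m = tensor_map_lin[OF module module HQ module right_coaction_lin lin_ident]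
  have mH: "tensor_map K HH H \<Delta> (\<lambda>y. y) \<in> lin K HH (tensor K HH H)"
    by (intro tensor_map_lin module HH_module comult_lin lin_ident)
  note p = tensor_map_lin[OF module module module Q lin_ident pr]
  show ?thesis
  proof (rule lin_eq_on_tensor[OF module module H_QH_module lin_comp[OF m as] lin_comp[OF lin_comp[OF mH aH] proj_mid_lin] _ t])
    fix x b assume x: "x \<in> carrier H" and b: "b \<in> carrier H"
    \<comment> \<open>Naturality of associativity is stated for an arbitrary tensor s in place of
      \<Delta> x, so that s can be reduced to a pure tensor.\<close>
    have "?as (tens K (tensor K H ?Q) H (tensor_map K H ?Q (\<lambda>y. y) (proj H I) s) b) =
        proj_mid (tensor_assoc K H H H (tens K HH H s b))" if s: "s \<in> carrier HH" for s
    proof (rule lin_eq_on_tensor[OF module module H_QH_module _ _ _ s,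
          where f = "\<lambda>s. ?as (tens K (tensor K H ?Q) H (tensor_map K H ?Q (\<lambda>y. y) (proj H I) s) b)"])
      show "(\<lambda>s. ?as (tens K (tensor K H ?Q) H (tensor_map K H ?Q (\<lambda>y. y) (proj H I) s) b)) \<in> lin K HH (tensor K H QH)"
        by (intro lin_comp[OF _ as] lin_tens_left HQ module p b)
      show "(\<lambda>s. proj_mid (tensor_assoc K H H H (tens K HH H s b))) \<in> lin K HH (tensor K H QH)"
        by (intro lin_comp[OF _ proj_mid_lin] lin_comp[OF _ aH] lin_tens_left HH_module module lin_ident b)
      fix u v assume "u \<in> carrier H" "v \<in> carrier H"
      then show "?as (tens K (tensor K H ?Q) H (tensor_map K H ?Q (\<lambda>y. y) (proj H I) (tens K H H u v)) b) =
          proj_mid (tensor_assoc K H H H (tens K HH H (tens K H H u v) b))"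
        using b by (simp add: tensor_map_tens[OF _ _ _ _ lin_ident pr] tensor_map_tens[OF _ _ _ _ lin_ident proj_left_lin[OF I]]
            structure_closed Q QH_module tensor_assoc_tens linD(1)[OF pr] proj_left_tens[OF I])
    qed
    from this[OF comult_closed[OF x]] show "?as (?m (tens K H H x b)) =
        proj_mid (tensor_assoc K H H H (tensor_map K HH H \<Delta> (\<lambda>y. y) (tens K H H x b)))"
      using x b by (simp add: tensor_map_tens[OF _ _ _ _ right_coaction_lin lin_ident] HQ structure_closed
          tensor_map_tens[OF _ _ _ _ comult_lin lin_ident] right_coaction_def)
  qed
qed

lemma cotensor_right:
  assumes t: "t \<in> carrier HH"
  shows "tensor_map K H QH (\<lambda>y. y) (left_coaction K H \<Delta> I) t = proj_mid (tensor_map K H HH (\<lambda>y. y) \<Delta> t)"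
proof -
  note l = tensor_map_lin[OF module module module QH_module lin_ident left_coaction_lin]
  note d = tensor_map_lin[OF module module module HH_module lin_ident comult_lin]
  show ?thesis
    by (rule lin_eq_on_tensor[OF module module H_QH_module l lin_comp[OF d proj_mid_lin] _ t])
      (simp add: tensor_map_tens[OF _ _ _ _ lin_ident left_coaction_lin] tensor_map_tens[OF _ _ _ _ lin_ident comult_lin]
        tensor_map_tens[OF _ _ _ _ lin_ident proj_left_lin[OF I]] structure_closed QH_module left_coaction_def)
qed

text \<open>Once the twist is gone the condition reads (id \<otimes> E) s = 0 with E z = (\<pi>
  \<otimes> id) (\<Delta> z - 1 \<otimes> z). The kernel of E is the space of coinvariants, and over
  a field the kernel of id \<otimes> E is H \<otimes> ker E.\<close>

lemma kappa_cotensor_iff: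
  assumes s: "s \<in> carrier HH"
  shows "kappa s \<in> cotensor K H \<Delta> I \<longleftrightarrow> s \<in> tensor_sub K H H (carrier H) (coinvariants K H \<Delta> I)"
proof -
  let ?o = "tensor_map K H HH (\<lambda>y. y) (tens K H H \<one>\<^bsub>H\<^esub>)" and ?d = "tensor_map K H HH (\<lambda>y. y) \<Delta>"
  let ?N = "tensor_sub K H HH (carrier H) (tensor_sub K H H I (carrier H))"
  let ?D = "\<lambda>z. \<Delta> z \<ominus>\<^bsub>HH\<^esub> tens K H H \<one>\<^bsub>H\<^esub> z"
  let ?E = "\<lambda>z. proj_left I (?D z)"
  note d = tensor_map_lin[OF module module module HH_module lin_ident comult_lin]
    and o = tensor_map_lin[OF module module module HH_module lin_ident one_tens_lin]
  have D: "?D \<in> lin K H HH" by (intro lin_minus HH_module comult_lin one_tens_lin)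
  note E = lin_comp[OF D proj_left_lin[OF I]]
  note e = tensor_map_lin[OF module module module QH_module lin_ident E]
  have c: "?d s \<in> carrier (tensor K H HH)" "?o s \<in> carrier (tensor K H HH)"
    using linD(1)[OF d s] linD(1)[OF o s] .
  have tc: "theta_HH (?d s) \<in> carrier (tensor K H HH)" "theta_HH (?o s) \<in> carrier (tensor K H HH)"
    using c linD(1)[OF theta_HH_lin] by auto
  interpret HHH: Module.module K "tensor K H HH" by (rule H_HH_module)
  have ks: "kappa s \<in> carrier HH" by (rule linD(1)[OF kappa_lin s])
  have "kappa s \<in> cotensor K H \<Delta> I \<longleftrightarrow> proj_mid (theta_HH (?d s)) = proj_mid (theta_HH (?o s))"
    unfolding cotensor_def Let_def
    by (simp add: ks cotensor_left cotensor_right assoc_kappa comult_kappa s) (rule eq_commute)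
  also have "\<dots> \<longleftrightarrow> proj_mid (theta_HH (?d s \<ominus>\<^bsub>tensor K H HH\<^esub> ?o s)) = \<zero>\<^bsub>tensor K H QH\<^esub>"
    using module_diff_eq_zero_iff[OF H_QH_module linD(1)[OF proj_mid_lin tc(1)] linD(1)[OF proj_mid_lin tc(2)]]
    by (simp add: lin_diff_eq[OF H_HH_module H_HH_module theta_HH_lin c]
        lin_diff_eq[OF H_HH_module H_QH_module proj_mid_lin tc])
  \<comment> \<open>The twist is defined before the projection to H/I. The equation is therefore
    traded for membership in \<open>?N\<close>, where the twist can be cancelled, and then traded
    back.\<close>
  also have "\<dots> \<longleftrightarrow> theta_HH (?d s \<ominus>\<^bsub>tensor K H HH\<^esub> ?o s) \<in> ?N"
    by (rule proj_mid_kernel) (rule linD(1)[OF theta_HH_lin HHH.M.minus_closed[OF c]])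
  also have "\<dots> \<longleftrightarrow> ?d s \<ominus>\<^bsub>tensor K H HH\<^esub> ?o s \<in> ?N"
    by (rule theta_HH_mem_iff[OF HHH.M.minus_closed[OF c]])
  also have "\<dots> \<longleftrightarrow> proj_mid (?d s \<ominus>\<^bsub>tensor K H HH\<^esub> ?o s) = \<zero>\<^bsub>tensor K H QH\<^esub>"
    by (rule proj_mid_kernel[OF HHH.M.minus_closed[OF c], symmetric])
  also have "proj_mid (?d s \<ominus>\<^bsub>tensor K H HH\<^esub> ?o s) = tensor_map K H QH (\<lambda>y. y) ?E s"
  proof (rule lin_eq_on_tensor[OF module module H_QH_module lin_comp[OF lin_minus[OF H_HH_module d o] proj_mid_lin] e _ s])
    fix x z assume x: "x \<in> carrier H" and z: "z \<in> carrier H"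
    have oz: "tens K H H \<one>\<^bsub>H\<^esub> z \<in> carrier HH" using z by (simp add: structure_closed)
    have "?d (tens K H H x z) \<ominus>\<^bsub>tensor K H HH\<^esub> ?o (tens K H H x z) = tens K H HH x (?D z)"
      using x z by (simp add: tensor_map_tens[OF module module module HH_module lin_ident comult_lin]
          tensor_map_tens[OF module module module HH_module lin_ident one_tens_lin]
          lin_diff_eq[OF HH_module H_HH_module lin_tens_right[OF module HH_module x lin_ident] comult_closed[OF z] oz])
    then show "proj_mid (?d (tens K H H x z) \<ominus>\<^bsub>tensor K H HH\<^esub> ?o (tens K H H x z)) =
        tensor_map K H QH (\<lambda>y. y) ?E (tens K H H x z)"
      using x z linD(1)[OF D z]
      by (simp add: tensor_map_tens[OF module module module QH_module lin_ident E]
          tensor_map_tens[OF module HH_module module QH_module lin_ident proj_left_lin[OF I]])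
  qed
  also have "\<dots> = \<zero>\<^bsub>tensor K H QH\<^esub> \<longleftrightarrow> s \<in> tensor_sub K H H (carrier H) {z \<in> carrier H. ?E z = \<zero>\<^bsub>QH\<^esub>}"
    by (rule tensor_map_right_kernel_iff[OF field module QH_module module E s])
  also have "{z \<in> carrier H. ?E z = \<zero>\<^bsub>QH\<^esub>} = coinvariants K H \<Delta> I"
    using proj_left_kernel[OF I linD(1)[OF D]] coinvariants_iff[OF I] by blast
  finally show ?thesis .
qed

lemma cotensor_eq: "cotensor K H \<Delta> I = kappa ` tensor_sub K H H (carrier H) (coinvariants K H \<Delta> I)"
proof -
  have c: "cotensor K H \<Delta> I \<subseteq> carrier HH" by (auto simp: cotensor_def Let_def)
  have sub: "tensor_sub K H H (carrier H) (coinvariants K H \<Delta> I) \<subseteq> carrier HH"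
    using tensor_sub_mono[of "carrier H" "carrier H" "coinvariants K H \<Delta> I" "carrier H" K H H]
      tensor_sub_carrier[OF module module] by (auto simp: coinvariants_def)
  show ?thesis
  proof
    show "kappa ` tensor_sub K H H (carrier H) (coinvariants K H \<Delta> I) \<subseteq> cotensor K H \<Delta> I"
      using sub kappa_cotensor_iff by blast
    show "cotensor K H \<Delta> I \<subseteq> kappa ` tensor_sub K H H (carrier H) (coinvariants K H \<Delta> I)"
    proof
      fix t assume t: "t \<in> cotensor K H \<Delta> I"
      have k: "kappa (kappa_inv t) = t" using t c by (intro kappa_inverse(2)) blast
      have "kappa_inv t \<in> carrier HH" using t c linD(1)[OF kappa_inv_lin] by blast
      then have "kappa_inv t \<in> tensor_sub K H H (carrier H) (coinvariants K H \<Delta> I)"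
        using kappa_cotensor_iff[of "kappa_inv t"] t k by simp
      then show "t \<in> kappa ` tensor_sub K H H (carrier H) (coinvariants K H \<Delta> I)"
        using k by (metis imageI)
    qed
  qed
qed

lemma coequalizer_iff:
  "is_coequalizer K (HH\<lparr>carrier := cotensor K H \<Delta> I\<rparr>) H (quot_space K H I)
     (tensor_lift K H (\<lambda>x y. \<epsilon> x \<odot>\<^bsub>H\<^esub> y)) (tensor_lift K H (\<lambda>x y. \<epsilon> y \<odot>\<^bsub>H\<^esub> x)) (proj H I) \<longleftrightarrow>
   I = left_ideal_gen H (augmentation_part K \<epsilon> (coinvariants K H \<Delta> I))"
proof -
  let ?B = "coinvariants K H \<Delta> I"
  note rc = coinvariants_right_coideal_subalgebra[OF I]
  note B = coideal_subalgebra_closed[OF rc]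
  let ?HB = "tensor_sub K H H (carrier H) ?B"
  let ?f = "tensor_lift K H (\<lambda>x y. \<epsilon> x \<odot>\<^bsub>H\<^esub> y)" and ?g = "tensor_lift K H (\<lambda>x y. \<epsilon> y \<odot>\<^bsub>H\<^esub> x)"
  have bf: "bilin K H H H (\<lambda>x y. \<epsilon> x \<odot>\<^bsub>H\<^esub> y)"
    by (intro bilinI lin_scalar lin_smult module lin_ident counit_lin counit_closed)
  have bg: "bilin K H H H (\<lambda>x y. \<epsilon> y \<odot>\<^bsub>H\<^esub> x)"
    by (intro bilinI lin_scalar lin_smult module lin_ident counit_lin counit_closed)
  note f = tensor_lift_universal[OF module module module bf] and g = tensor_lift_universal[OF module module module bg]
  have HB: "submodule ?HB K HH"
    by (intro tensor_sub_submodule module order_refl coideal_subalgebra_subset[OF rc])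
  have ct: "submodule (cotensor K H \<Delta> I) K HH"
    unfolding cotensor_eq by (rule image_submodule[OF HH_module HH_module kappa_lin HB])
  have X: "Module.module K (HH\<lparr>carrier := cotensor K H \<Delta> I\<rparr>)"
    by (rule submodule.submodule_is_module[OF ct HH_module])
  have restr: "h \<in> lin K (HH\<lparr>carrier := cotensor K H \<Delta> I\<rparr>) H" if "h \<in> lin K HH H" for h
    by (rule linI) (use linD[OF that] submodule_closed(1)[OF HH_module ct] in auto)
  \<comment> \<open>The difference of the parallel maps, pulled back along \<kappa>. By
    \<open>cotensor_eq\<close> its image on H \<otimes> B is the image of the difference on the
    cotensor product.\<close>
  define d where "d s = ?f (kappa s) \<ominus>\<^bsub>H\<^esub> ?g (kappa s)" for s
  have d: "d \<in> lin K HH H" unfolding d_def by (intro lin_minus module lin_comp[OF kappa_lin] f(1) g(1))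
  \<comment> \<open>The counit axiom applies on either side:
    \<open>\<Sum> \<epsilon>(x\<^sub>1) x\<^sub>2 z = x z\<close>, and
    \<open>\<Sum> \<epsilon>(x\<^sub>2 z) x\<^sub>1 = \<epsilon>(z) x\<close> by multiplicativity of
    \<epsilon>.\<close>
  have d_tens: "d (tens K H H x z) = x \<otimes>\<^bsub>H\<^esub> (z \<ominus>\<^bsub>H\<^esub> \<epsilon> z \<odot>\<^bsub>H\<^esub> \<one>\<^bsub>H\<^esub>)" if x: "x \<in> carrier H" and z: "z \<in> carrier H" for x z
  proof -
    note kt = theta_tens[OF module mult_bilin x z]
    note bz = theta_inner_bilin[OF module mult_bilin z]
    have "?f (kappa (tens K H H x z)) = sweedler H (\<lambda>a b. ?f (tens K H H a (b \<otimes>\<^bsub>H\<^esub> z))) x"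
      unfolding kt by (rule lin_of_sweedler[OF HH_module module f(1) bz x])
    also have "\<dots> = sweedler H (\<lambda>a b. \<epsilon> a \<odot>\<^bsub>H\<^esub> (b \<otimes>\<^bsub>H\<^esub> z)) x"
      by (rule sweedler_cong[OF module _ _ x, symmetric])
        (use z in \<open>auto intro!: bilinI lin_scalar lin_smult lin_mult_left module lin_ident counit_lin simp: f(2) counit_closed\<close>)
    also have "\<dots> = x \<otimes>\<^bsub>H\<^esub> z" by (rule sweedler_counit_left[OF module lin_mult_left[OF lin_ident z] x])
    finally have 1: "?f (kappa (tens K H H x z)) = x \<otimes>\<^bsub>H\<^esub> z" .
    have "?g (kappa (tens K H H x z)) = sweedler H (\<lambda>a b. ?g (tens K H H a (b \<otimes>\<^bsub>H\<^esub> z))) x"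
      unfolding kt by (rule lin_of_sweedler[OF HH_module module g(1) bz x])
    also have "\<dots> = sweedler H (\<lambda>a b. \<epsilon> b \<odot>\<^bsub>H\<^esub> (\<epsilon> z \<odot>\<^bsub>H\<^esub> a)) x"
      by (rule sweedler_cong[OF module _ _ x, symmetric])
        (use z in \<open>auto intro!: bilinI lin_scalar lin_smult module lin_ident counit_lin
            simp: g(2) counit_closed counit_mult Hm.smult_assoc1\<close>)
    also have "\<dots> = \<epsilon> z \<odot>\<^bsub>H\<^esub> x"
      by (rule sweedler_counit_right[OF module lin_smult[OF module counit_closed[OF z] lin_ident] x])
    finally have 2: "?g (kappa (tens K H H x z)) = x \<otimes>\<^bsub>H\<^esub> (\<epsilon> z \<odot>\<^bsub>H\<^esub> \<one>\<^bsub>H\<^esub>)"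
      using x z by (simp add: smult_mult_right counit_closed)
    show ?thesis unfolding d_def 1 2
      by (rule lin_diff_eq[OF module module lin_mult_right[OF x lin_ident] z, symmetric])
        (simp add: z counit_closed)
  qed
  note G = left_ideal_gen_eq[OF Bplus_subset[OF rc]]
  have "is_coequalizer K (HH\<lparr>carrier := cotensor K H \<Delta> I\<rparr>) H (quot_space K H I) ?f ?g (\<lambda>y. I +>\<^bsub>H\<^esub> y) \<longleftrightarrow>
      I = (\<lambda>t. ?f t \<ominus>\<^bsub>H\<^esub> ?g t) ` carrier (HH\<lparr>carrier := cotensor K H \<Delta> I\<rparr>)"
    by (rule is_coequalizer_quot_iff[OF X module restr[OF f(1)] restr[OF g(1)] left_ideal_submodule[OF I]])
  also have "(\<lambda>t. ?f t \<ominus>\<^bsub>H\<^esub> ?g t) ` carrier (HH\<lparr>carrier := cotensor K H \<Delta> I\<rparr>) = d ` ?HB"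
    by (simp add: cotensor_eq image_image d_def)
  also have "d ` ?HB = left_ideal_gen H (augmentation_part K \<epsilon> ?B)"
  proof
    show "d ` ?HB \<subseteq> left_ideal_gen H (augmentation_part K \<epsilon> ?B)"
    proof
      fix y assume "y \<in> d ` ?HB"
      then obtain s where s: "y = d s" "s \<in> ?HB" by blast
      have "d s \<in> left_ideal_gen H (augmentation_part K \<epsilon> ?B)"
      proof (rule lin_tensor_sub[OF module module module d left_ideal_submodule[OF G(2)] order_refl coideal_subalgebra_subset[OF rc] _ s(2)])
        fix x b assume xb: "x \<in> carrier H" "b \<in> ?B"
        show "d (tens K H H x b) \<in> left_ideal_gen H (augmentation_part K \<epsilon> ?B)"
          using G(2) Bplus_in[OF rc minus_counit_Bplus[OF rc xb(2)]] xb(1)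
          by (simp add: d_tens xb B(1) left_ideal_def)
      qed
      then show "y \<in> left_ideal_gen H (augmentation_part K \<epsilon> ?B)" by (simp add: s)
    qed
    show "left_ideal_gen H (augmentation_part K \<epsilon> ?B) \<subseteq> d ` ?HB"
      unfolding G(1)
    proof (rule subspace_gen_least[OF image_submodule[OF HH_module module d HB]], rule subsetI)
      fix w assume "w \<in> {x \<otimes>\<^bsub>H\<^esub> a | x a. x \<in> carrier H \<and> a \<in> augmentation_part K \<epsilon> ?B}"
      then obtain x a where w: "w = x \<otimes>\<^bsub>H\<^esub> a" "x \<in> carrier H" "a \<in> ?B" "\<epsilon> a = \<zero>\<^bsub>K\<^esub>"
        by (auto simp: augmentation_part_def)
      have a: "a \<in> carrier H" by (rule B(1)[OF w(3)])
      \<comment> \<open>The correction term vanishes because \<epsilon> a = 0, so every generator x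
        a is itself a value of d.\<close>
      have "d (tens K H H x a) = w"
        using w a module_diff_zero[OF module a] by (simp add: d_tens)
      then show "w \<in> d ` ?HB" using tens_in_tensor_sub[OF w(2,3)] by (metis imageI)
    qed
  qed
  finally show ?thesis by (simp add: proj_def[abs_def])
qed

end

section \<open>Inclusion preservation and the final bijection\<close>

lemma coinvariants_mono:
  assumes "left_ideal I H" "left_ideal J H" "I \<subseteq> J"
  shows "coinvariants K H \<Delta> I \<subseteq> coinvariants K H \<Delta> J"
  using tensor_sub_mono[OF assms(3) order_refl, of K H H "carrier H"]
  by (auto simp: coinvariants_iff assms(1,2))

lemma left_ideal_gen_aug_mono:
  "B \<subseteq> C \<Longrightarrow> left_ideal_gen H (augmentation_part K \<epsilon> B) \<subseteq> left_ideal_gen H (augmentation_part K \<epsilon> C)"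
  by (auto simp: left_ideal_gen_def augmentation_part_def)

end

theorem theorem2:
  fixes K :: "'k ring" and H :: "('k, 'h) module"
    and \<Delta> :: "'h \<Rightarrow> ('h \<times> 'h \<Rightarrow> 'k) set" and \<epsilon> :: "'h \<Rightarrow> 'k" and S :: "'h \<Rightarrow> 'h"
  assumes "hopf_algebra K H \<Delta> \<epsilon> S"
  defines "\<L> \<equiv> coequalizer_left_ideal_coideals K H \<Delta> \<epsilon>"
    and "\<R> \<equiv> equalizer_right_coideal_subalgebras K H \<Delta>"
    and "\<Psi> \<equiv> \<lambda>I. coinvariants K H \<Delta> I"
    and "\<Phi> \<equiv> \<lambda>B. left_ideal_gen H (augmentation_part K \<epsilon> B)"
  shows "\<Psi> \<in> \<L> \<rightarrow> \<R> \<and> \<Phi> \<in> \<R> \<rightarrow> \<L> \<and>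
    (\<forall>I \<in> \<L>. \<Phi> (\<Psi> I) = I) \<and> (\<forall>B \<in> \<R>. \<Psi> (\<Phi> B) = B) \<and>
    bij_betw \<Psi> \<L> \<R> \<and> bij_betw \<Phi> \<R> \<L> \<and>
    (\<forall>I \<in> \<L>. \<forall>J \<in> \<L>. I \<subseteq> J \<longrightarrow> \<Psi> I \<subseteq> \<Psi> J) \<and>
    (\<forall>B \<in> \<R>. \<forall>C \<in> \<R>. B \<subseteq> C \<longrightarrow> \<Phi> B \<subseteq> \<Phi> C)"
proof -
  interpret hopf_algebra K H \<Delta> \<epsilon> S by fact
  \<comment> \<open>The two sets become the fixed points of the composites \<Phi> \<Psi> and \<Psi>
    \<Phi> among left ideal coideals and right coideal subalgebras, so the inverse laws are part of
    membership.\<close>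
  have L: "I \<in> \<L> \<longleftrightarrow> left_ideal_coideal K H \<Delta> \<epsilon> I \<and> I = \<Phi> (\<Psi> I)" for I
    using coequalizer_iff[of I]
    by (auto simp: \<L>_def \<Phi>_def \<Psi>_def coequalizer_left_ideal_coideals_def left_ideal_coideal_def)
  have R: "B \<in> \<R> \<longleftrightarrow> right_coideal_subalgebra K H \<Delta> B \<and> B = \<Psi> (\<Phi> B)" for B
    using equalizer_iff[of B] by (auto simp: \<R>_def \<Phi>_def \<Psi>_def equalizer_right_coideal_subalgebras_def)
  have li: "left_ideal I H" if "I \<in> \<L>" for I using that by (simp add: L left_ideal_coideal_def)
  \<comment> \<open>Applying \<Psi> to I = \<Phi> (\<Psi> I) shows that \<Psi> I is a fixed point on
    the other side; the argument for \<Phi> is symmetric.\<close>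
  have \<Psi>: "\<Psi> I \<in> \<R>" if "I \<in> \<L>" for I
    using that coinvariants_right_coideal_subalgebra[OF li[OF that]] by (simp add: L R \<Psi>_def)
  have \<Phi>: "\<Phi> B \<in> \<L>" if "B \<in> \<R>" for B
    using that HBplus_coideal[of B] by (simp add: L R \<Phi>_def)
  have inv: "\<forall>I \<in> \<L>. \<Phi> (\<Psi> I) = I" "\<forall>B \<in> \<R>. \<Psi> (\<Phi> B) = B" by (simp_all add: L R)
  have bij: "bij_betw \<Psi> \<L> \<R>" "bij_betw \<Phi> \<R> \<L>"
    by (rule bij_betw_byWitness; use inv \<Psi> \<Phi> in blast)+
  have mono_\<Psi>: "\<Psi> I \<subseteq> \<Psi> J" if "I \<in> \<L>" "J \<in> \<L>" "I \<subseteq> J" for I J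
    unfolding \<Psi>_def using that li by (intro coinvariants_mono)
  have mono_\<Phi>: "\<Phi> B \<subseteq> \<Phi> C" if "B \<subseteq> C" for B C
    unfolding \<Phi>_def using that by (rule left_ideal_gen_aug_mono)
  show ?thesis
    by (intro conjI inv bij Pi_I ballI impI; (rule \<Psi> \<Phi> mono_\<Psi> mono_\<Phi>)?; assumption)
qed

end
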